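(* $\mathrm{FinSpan}$, the category of finite sets and spans between them, is the PROP for bicommutative bimonoids. That is, for every symmetric monoidal category $\mathcal{C}$, the category of algebras of $\mathrm{FinSpan}$ over $\mathcal{C}$ is equivalent to the category of bicommutative bimonoids in $\mathcal{C}$ and bimonoid homomorphisms between them.
   Context: A PROP is a (strict) symmetric monoidal category whose objects are the natural numbers and whose tensor product on objects is addition. An algebra of a PROP $\mathcal{T}$ over a symmetric monoidal category $\mathcal{C}$ is a (strong) symmetric monoidal functor $\mathcal{T}\to\mathcal{C}$; morphisms of algebras are monoidal natural transformations. $\mathcal{T}$ is called the PROP for a kind of structure if, for each $\mathcal{C}$, the category of algebras of $\mathcal{T}$ over $\mathcal{C}$ is equivalent to the category of such structures in $\mathcal{C}$. $\mathrm{FinSpan}$ has finite sets as objects, and morphisms $X\to Y$ are isomorphism classes of triples $(S, f:S\to X, g:S\to Y)$ with $S$ a finite set and $f,g$ functions, composed by pullback. It is made into a PROP by choosing one representative finite set of each cardinality, with tensor product given by disjoint union and the evident symmetry. (Equivalently it is the PROP $\mathrm{Mat}(\mathbb{N})$ whose morphisms $m\to n$ are $n\times m$ matrices over $\mathbb{N}=\{0,1,2,\dots\}$, with composition given by matrix multiplication and tensor product given by block diagonal sum; a span corresponds to the matrix with $(i,j)$ entry $|\{s\in S : f(s)=j,\ g(s)=i\}|$.) Let $\mathcal{C}$ be a symmetric monoidal category with unit $I$ and symmetry $\tau$ (associators and unitors are suppressed). A commutative monoid in $\mathcal{C}$ is an object $A$ with morphisms $\mu_A: A\otimes A\to A$,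 $\eta_A: I\to A$ satisfying associativity, the unit laws and commutativity. A cocommutative comonoid is an object $A$ with $\Delta_A: A\to A\otimes A$, $\epsilon_A: A\to I$ satisfying the dual axioms. A bicommutative bimonoid is an object that is both a commutative monoid and a cocommutative comonoid such that $\Delta_A\mu_A=(\mu_A\otimes\mu_A)(1_A\otimes\tau_{AA}\otimes 1_A)(\Delta_A\otimes\Delta_A)$, $\Delta_A\eta_A=\eta_A\otimes\eta_A$, $\epsilon_A\mu_A=\epsilon_A\otimes\epsilon_A$, $\epsilon_A\eta_A=1_I$. A bimonoid homomorphism $f:A\to B$ is a morphism of $\mathcal{C}$ that is both a monoid homomorphism ($\mu_B(f\otimes f)=f\mu_A$, $f\eta_A=\eta_B$) and a comonoid homomorphism ($\Delta_B f=(f\otimes f)\Delta_A$, $\epsilon_B f=\epsilon_A$). *)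

theory Defs
  imports "HOL-Library.FuncSet"
begin

section \<open>Categories, functors and equivalence of categories\<close>

record ('o, 'a) cat_data =
  Obj :: "'o set"
  Arr :: "'a set"
  Dom :: "'a \<Rightarrow> 'o"
  Cod :: "'a \<Rightarrow> 'o"
  Ident :: "'o \<Rightarrow> 'a"
  Comp :: "'a \<Rightarrow> 'a \<Rightarrow> 'a"  (infixr "\<cdot>\<index>" 55)

definition Hom :: "('o, 'a, 'z) cat_data_scheme \<Rightarrow> 'o \<Rightarrow> 'o \<Rightarrow> 'a set" where
  "Hom C A B = {f \<in> Arr C. Dom C f = A \<and> Cod C f = B}"

text \<open>Composition is written in applicative order: \<open>g \<cdot> f\<close> is \<open>f\<close> followed by \<open>g\<close>.\<close>

locale category =
  fixes C :: "('o, 'a, 'z) cat_data_scheme" (structure)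
  assumes dom_obj: "f \<in> Arr C \<Longrightarrow> Dom C f \<in> Obj C"
    and cod_obj: "f \<in> Arr C \<Longrightarrow> Cod C f \<in> Obj C"
    and ident_hom: "A \<in> Obj C \<Longrightarrow> Ident C A \<in> Hom C A A"
    and comp_hom: "\<lbrakk>f \<in> Hom C A B; g \<in> Hom C B D\<rbrakk> \<Longrightarrow> g \<cdot> f \<in> Hom C A D"
    and comp_ident_left: "f \<in> Hom C A B \<Longrightarrow> Ident C B \<cdot> f = f"
    and comp_ident_right: "f \<in> Hom C A B \<Longrightarrow> f \<cdot> Ident C A = f"
    and comp_assoc: "\<lbrakk>f \<in> Hom C A B; g \<in> Hom C B D; h \<in> Hom C D E\<rbrakk> \<Longrightarrow>
          (h \<cdot> g) \<cdot> f = h \<cdot> (g \<cdot> f)"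

definition inverse_arrows :: "('o, 'a, 'z) cat_data_scheme \<Rightarrow> 'a \<Rightarrow> 'a \<Rightarrow> bool" where
  "inverse_arrows C f g \<longleftrightarrow>
     f \<in> Arr C \<and> g \<in> Hom C (Cod C f) (Dom C f) \<and>
     g \<cdot>\<^bsub>C\<^esub> f = Ident C (Dom C f) \<and> f \<cdot>\<^bsub>C\<^esub> g = Ident C (Cod C f)"

definition iso_arrow :: "('o, 'a, 'z) cat_data_scheme \<Rightarrow> 'a \<Rightarrow> bool" where
  "iso_arrow C f \<longleftrightarrow> (\<exists>g. inverse_arrows C f g)"

definition inv_arrow :: "('o, 'a, 'z) cat_data_scheme \<Rightarrow> 'a \<Rightarrow> 'a" where
  "inv_arrow C f = (THE g. inverse_arrows C f g)"

record ('o, 'a, 'p, 'b) functor_data =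
  FObj :: "'o \<Rightarrow> 'p"
  FArr :: "'a \<Rightarrow> 'b"

text \<open>
  Functors and natural transformations are required to be extensional (\<open>undefined\<close> outside the
  objects and arrows of the source), so that two of them are equal iff they agree on the source.
\<close>

locale cat_functor = D: category D + E: category E
  for D :: "('o, 'a, 'z) cat_data_scheme"
  and E :: "('p, 'b, 'y) cat_data_scheme" +
  fixes F :: "('o, 'a, 'p, 'b, 'x) functor_data_scheme"
  assumes obj_ext: "FObj F \<in> extensional (Obj D)"
    and arr_ext: "FArr F \<in> extensional (Arr D)"
    and obj: "A \<in> Obj D \<Longrightarrow> FObj F A \<in> Obj E"
    and arr: "f \<in> Hom D A B \<Longrightarrow> FArr F f \<in> Hom E (FObj F A) (FObj F B)"
    and pres_ident: "A \<in> Obj D \<Longrightarrow> FArr F (Ident D A) = Ident E (FObj F A)"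
    and pres_comp: "\<lbrakk>f \<in> Hom D A B; g \<in> Hom D B B'\<rbrakk> \<Longrightarrow>
          FArr F (g \<cdot>\<^bsub>D\<^esub> f) = FArr F g \<cdot>\<^bsub>E\<^esub> FArr F f"

definition id_functor :: "('o, 'a, 'z) cat_data_scheme \<Rightarrow> ('o, 'a, 'o, 'a) functor_data" where
  "id_functor D = \<lparr>FObj = (\<lambda>A\<in>Obj D. A), FArr = (\<lambda>f\<in>Arr D. f)\<rparr>"

definition comp_functor ::
  "('o, 'a, 'z) cat_data_scheme \<Rightarrow> ('p, 'b, 'q, 'c) functor_data \<Rightarrow>
   ('o, 'a, 'p, 'b) functor_data \<Rightarrow> ('o, 'a, 'q, 'c) functor_data" where
  "comp_functor D G F =
     \<lparr>FObj = (\<lambda>A\<in>Obj D. FObj G (FObj F A)), FArr = (\<lambda>f\<in>Arr D. FArr G (FArr F f))\<rparr>"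

definition nat_trans ::
  "('o, 'a, 'z) cat_data_scheme \<Rightarrow> ('p, 'b, 'y) cat_data_scheme \<Rightarrow>
   ('o, 'a, 'p, 'b, 'x) functor_data_scheme \<Rightarrow> ('o, 'a, 'p, 'b, 'x) functor_data_scheme \<Rightarrow>
   ('o \<Rightarrow> 'b) \<Rightarrow> bool" where
  "nat_trans D E F G \<eta> \<longleftrightarrow>
     \<eta> \<in> extensional (Obj D) \<and>
     (\<forall>A\<in>Obj D. \<eta> A \<in> Hom E (FObj F A) (FObj G A)) \<and>
     (\<forall>f\<in>Arr D. \<eta> (Cod D f) \<cdot>\<^bsub>E\<^esub> FArr F f = FArr G f \<cdot>\<^bsub>E\<^esub> \<eta> (Dom D f))"

definition naturally_isomorphic ::
  "('o, 'a, 'z) cat_data_scheme \<Rightarrow> ('p, 'b, 'y) cat_data_scheme \<Rightarrow>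
   ('o, 'a, 'p, 'b, 'x) functor_data_scheme \<Rightarrow> ('o, 'a, 'p, 'b, 'x) functor_data_scheme \<Rightarrow>
   bool" where
  "naturally_isomorphic D E F G \<longleftrightarrow>
     (\<exists>\<eta>. nat_trans D E F G \<eta> \<and> (\<forall>A\<in>Obj D. iso_arrow E (\<eta> A)))"

text \<open>The locale predicate \<open>cat_functor\<close> includes that source and target are categories.\<close>

definition equivalent_categories ::
  "('o, 'a, 'z) cat_data_scheme \<Rightarrow> ('p, 'b, 'y) cat_data_scheme \<Rightarrow> bool" where
  "equivalent_categories D E \<longleftrightarrow>
     (\<exists>(F :: ('o, 'a, 'p, 'b) functor_data) (G :: ('p, 'b, 'o, 'a) functor_data).
        cat_functor D E F \<and> cat_functor E D G \<and>
        naturally_isomorphic D D (id_functor D) (comp_functor D G F) \<and>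
        naturally_isomorphic E E (comp_functor E F G) (id_functor E))"


section \<open>Symmetric monoidal categories and PROPs\<close>

text \<open>
  Structural arrows: \<open>Assoc A B D : (A \<odot> B) \<odot> D \<rightarrow> A \<odot> (B \<odot> D)\<close>, \<open>LUnit A : I \<odot> A \<rightarrow> A\<close>,
  \<open>RUnit A : A \<odot> I \<rightarrow> A\<close> and \<open>Symm A B : A \<odot> B \<rightarrow> B \<odot> A\<close>. The tensor product is \<open>\<odot>\<close> on objects
  and \<open>\<otimes>\<close> on arrows.
\<close>

record ('o, 'a) smc_data = "('o, 'a) cat_data" +
  TensO :: "'o \<Rightarrow> 'o \<Rightarrow> 'o"  (infixr "\<odot>\<index>" 65)
  TensA :: "'a \<Rightarrow> 'a \<Rightarrow> 'a"  (infixr "\<otimes>\<index>" 65)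
  MUnit :: "'o"
  Assoc :: "'o \<Rightarrow> 'o \<Rightarrow> 'o \<Rightarrow> 'a"
  LUnit :: "'o \<Rightarrow> 'a"
  RUnit :: "'o \<Rightarrow> 'a"
  Symm :: "'o \<Rightarrow> 'o \<Rightarrow> 'a"

locale symmetric_monoidal_category = category C
  for C :: "('o, 'a, 'z) smc_data_scheme" (structure) +
  assumes unit_obj: "MUnit C \<in> Obj C"
    and tens_obj: "\<lbrakk>A \<in> Obj C; B \<in> Obj C\<rbrakk> \<Longrightarrow> A \<odot> B \<in> Obj C"
    and tens_hom: "\<lbrakk>f \<in> Hom C A A'; g \<in> Hom C B B'\<rbrakk> \<Longrightarrow> f \<otimes> g \<in> Hom C (A \<odot> B) (A' \<odot> B')"
    and tens_ident: "\<lbrakk>A \<in> Obj C; B \<in> Obj C\<rbrakk> \<Longrightarrow> Ident C A \<otimes> Ident C B = Ident C (A \<odot> B)"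
    and tens_comp: "\<lbrakk>f \<in> Hom C A A'; f' \<in> Hom C A' A''; g \<in> Hom C B B'; g' \<in> Hom C B' B''\<rbrakk> \<Longrightarrow>
          (f' \<cdot> f) \<otimes> (g' \<cdot> g) = (f' \<otimes> g') \<cdot> (f \<otimes> g)"
    and assoc_hom: "\<lbrakk>A \<in> Obj C; B \<in> Obj C; D \<in> Obj C\<rbrakk> \<Longrightarrow>
          Assoc C A B D \<in> Hom C ((A \<odot> B) \<odot> D) (A \<odot> (B \<odot> D))"
    and assoc_iso: "\<lbrakk>A \<in> Obj C; B \<in> Obj C; D \<in> Obj C\<rbrakk> \<Longrightarrow> iso_arrow C (Assoc C A B D)"
    and assoc_natural: "\<lbrakk>f \<in> Hom C A A'; g \<in> Hom C B B'; h \<in> Hom C D D'\<rbrakk> \<Longrightarrow>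
          Assoc C A' B' D' \<cdot> ((f \<otimes> g) \<otimes> h) = (f \<otimes> (g \<otimes> h)) \<cdot> Assoc C A B D"
    and lunit_hom: "A \<in> Obj C \<Longrightarrow> LUnit C A \<in> Hom C (MUnit C \<odot> A) A"
    and lunit_iso: "A \<in> Obj C \<Longrightarrow> iso_arrow C (LUnit C A)"
    and lunit_natural: "f \<in> Hom C A B \<Longrightarrow>
          LUnit C B \<cdot> (Ident C (MUnit C) \<otimes> f) = f \<cdot> LUnit C A"
    and runit_hom: "A \<in> Obj C \<Longrightarrow> RUnit C A \<in> Hom C (A \<odot> MUnit C) A"
    and runit_iso: "A \<in> Obj C \<Longrightarrow> iso_arrow C (RUnit C A)"
    and runit_natural: "f \<in> Hom C A B \<Longrightarrow>
          RUnit C B \<cdot> (f \<otimes> Ident C (MUnit C)) = f \<cdot> RUnit C A"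
    and symm_hom: "\<lbrakk>A \<in> Obj C; B \<in> Obj C\<rbrakk> \<Longrightarrow> Symm C A B \<in> Hom C (A \<odot> B) (B \<odot> A)"
    and symm_natural: "\<lbrakk>f \<in> Hom C A A'; g \<in> Hom C B B'\<rbrakk> \<Longrightarrow>
          Symm C A' B' \<cdot> (f \<otimes> g) = (g \<otimes> f) \<cdot> Symm C A B"
    and symm_symm: "\<lbrakk>A \<in> Obj C; B \<in> Obj C\<rbrakk> \<Longrightarrow> Symm C B A \<cdot> Symm C A B = Ident C (A \<odot> B)"
    and pentagon: "\<lbrakk>A \<in> Obj C; B \<in> Obj C; D \<in> Obj C; E \<in> Obj C\<rbrakk> \<Longrightarrow>
          Assoc C A B (D \<odot> E) \<cdot> Assoc C (A \<odot> B) D E =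
          (Ident C A \<otimes> Assoc C B D E) \<cdot> Assoc C A (B \<odot> D) E \<cdot> (Assoc C A B D \<otimes> Ident C E)"
    and triangle: "\<lbrakk>A \<in> Obj C; B \<in> Obj C\<rbrakk> \<Longrightarrow>
          (Ident C A \<otimes> LUnit C B) \<cdot> Assoc C A (MUnit C) B = RUnit C A \<otimes> Ident C B"
    and hexagon: "\<lbrakk>A \<in> Obj C; B \<in> Obj C; D \<in> Obj C\<rbrakk> \<Longrightarrow>
          Assoc C B D A \<cdot> Symm C A (B \<odot> D) \<cdot> Assoc C A B D =
          (Ident C B \<otimes> Symm C A D) \<cdot> Assoc C B A D \<cdot> (Symm C A B \<otimes> Ident C D)"

locale strict_symmetric_monoidal_category = symmetric_monoidal_category C
  for C :: "('o, 'a, 'z) smc_data_scheme" (structure) +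
  assumes strict_assoc: "\<lbrakk>A \<in> Obj C; B \<in> Obj C; D \<in> Obj C\<rbrakk> \<Longrightarrow> (A \<odot> B) \<odot> D = A \<odot> (B \<odot> D)"
    and strict_lunit: "A \<in> Obj C \<Longrightarrow> MUnit C \<odot> A = A"
    and strict_runit: "A \<in> Obj C \<Longrightarrow> A \<odot> MUnit C = A"
    and assoc_ident: "\<lbrakk>A \<in> Obj C; B \<in> Obj C; D \<in> Obj C\<rbrakk> \<Longrightarrow>
          Assoc C A B D = Ident C (A \<odot> (B \<odot> D))"
    and lunit_ident: "A \<in> Obj C \<Longrightarrow> LUnit C A = Ident C A"
    and runit_ident: "A \<in> Obj C \<Longrightarrow> RUnit C A = Ident C A"

locale prop_category = strict_symmetric_monoidal_category T
  for T :: "(nat, 'a, 'z) smc_data_scheme" (structure) +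
  assumes obj_nat: "Obj T = UNIV"
    and unit_zero: "MUnit T = 0"
    and tens_add: "m \<odot> n = m + n"


section \<open>Algebras of a PROP\<close>

text \<open>
  Strong symmetric monoidal functors: \<open>FTens F A B : F A \<odot> F B \<rightarrow> F (A \<odot> B)\<close> and
  \<open>FUnit F : I \<rightarrow> F I\<close> are the structure isomorphisms.
\<close>

record ('o, 'a, 'p, 'b) smf_data = "('o, 'a, 'p, 'b) functor_data" +
  FTens :: "'o \<Rightarrow> 'o \<Rightarrow> 'b"
  FUnit :: "'b"

locale symmetric_monoidal_functor =
  T: symmetric_monoidal_category T + C: symmetric_monoidal_category C + cat_functor T C F
  for T :: "('o, 'a, 'z) smc_data_scheme"
  and C :: "('p, 'b, 'y) smc_data_scheme"
  and F :: "('o, 'a, 'p, 'b) smf_data" +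
  assumes ftens_ext: "(\<lambda>(A, B). FTens F A B) \<in> extensional (Obj T \<times> Obj T)"
    and ftens_hom: "\<lbrakk>A \<in> Obj T; B \<in> Obj T\<rbrakk> \<Longrightarrow>
          FTens F A B \<in> Hom C (FObj F A \<odot>\<^bsub>C\<^esub> FObj F B) (FObj F (A \<odot>\<^bsub>T\<^esub> B))"
    and ftens_iso: "\<lbrakk>A \<in> Obj T; B \<in> Obj T\<rbrakk> \<Longrightarrow> iso_arrow C (FTens F A B)"
    and ftens_natural: "\<lbrakk>f \<in> Hom T A A'; g \<in> Hom T B B'\<rbrakk> \<Longrightarrow>
          FTens F A' B' \<cdot>\<^bsub>C\<^esub> (FArr F f \<otimes>\<^bsub>C\<^esub> FArr F g) = FArr F (f \<otimes>\<^bsub>T\<^esub> g) \<cdot>\<^bsub>C\<^esub> FTens F A B"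
    and funit_hom: "FUnit F \<in> Hom C (MUnit C) (FObj F (MUnit T))"
    and funit_iso: "iso_arrow C (FUnit F)"
    and pres_assoc: "\<lbrakk>A \<in> Obj T; B \<in> Obj T; D \<in> Obj T\<rbrakk> \<Longrightarrow>
          FArr F (Assoc T A B D) \<cdot>\<^bsub>C\<^esub> FTens F (A \<odot>\<^bsub>T\<^esub> B) D \<cdot>\<^bsub>C\<^esub>
            (FTens F A B \<otimes>\<^bsub>C\<^esub> Ident C (FObj F D)) =
          FTens F A (B \<odot>\<^bsub>T\<^esub> D) \<cdot>\<^bsub>C\<^esub> (Ident C (FObj F A) \<otimes>\<^bsub>C\<^esub> FTens F B D) \<cdot>\<^bsub>C\<^esub>
            Assoc C (FObj F A) (FObj F B) (FObj F D)"
    and pres_lunit: "A \<in> Obj T \<Longrightarrow>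
          FArr F (LUnit T A) \<cdot>\<^bsub>C\<^esub> FTens F (MUnit T) A \<cdot>\<^bsub>C\<^esub> (FUnit F \<otimes>\<^bsub>C\<^esub> Ident C (FObj F A)) =
          LUnit C (FObj F A)"
    and pres_runit: "A \<in> Obj T \<Longrightarrow>
          FArr F (RUnit T A) \<cdot>\<^bsub>C\<^esub> FTens F A (MUnit T) \<cdot>\<^bsub>C\<^esub> (Ident C (FObj F A) \<otimes>\<^bsub>C\<^esub> FUnit F) =
          RUnit C (FObj F A)"
    and pres_symm: "\<lbrakk>A \<in> Obj T; B \<in> Obj T\<rbrakk> \<Longrightarrow>
          FArr F (Symm T A B) \<cdot>\<^bsub>C\<^esub> FTens F A B = FTens F B A \<cdot>\<^bsub>C\<^esub> Symm C (FObj F A) (FObj F B)"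

definition monoidal_nat_trans ::
  "('o, 'a, 'z) smc_data_scheme \<Rightarrow> ('p, 'b, 'y) smc_data_scheme \<Rightarrow>
   ('o, 'a, 'p, 'b) smf_data \<Rightarrow> ('o, 'a, 'p, 'b) smf_data \<Rightarrow> ('o \<Rightarrow> 'b) \<Rightarrow> bool" where
  "monoidal_nat_trans T C F G \<eta> \<longleftrightarrow>
     nat_trans T C F G \<eta> \<and>
     (\<forall>A\<in>Obj T. \<forall>B\<in>Obj T.
        \<eta> (A \<odot>\<^bsub>T\<^esub> B) \<cdot>\<^bsub>C\<^esub> FTens F A B = FTens G A B \<cdot>\<^bsub>C\<^esub> (\<eta> A \<otimes>\<^bsub>C\<^esub> \<eta> B)) \<and>
     \<eta> (MUnit T) \<cdot>\<^bsub>C\<^esub> FUnit F = FUnit G"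

text \<open>An arrow is a transformation together with its source and target.\<close>

definition algebra_category ::
  "(nat, 'a, 'z) smc_data_scheme \<Rightarrow> ('p, 'b, 'y) smc_data_scheme \<Rightarrow>
   ((nat, 'a, 'p, 'b) smf_data,
    (nat, 'a, 'p, 'b) smf_data \<times> (nat, 'a, 'p, 'b) smf_data \<times> (nat \<Rightarrow> 'b)) cat_data" where
  "algebra_category T C =
     \<lparr>Obj = {F. symmetric_monoidal_functor T C F},
      Arr = {(F, G, \<eta>). symmetric_monoidal_functor T C F \<and> symmetric_monoidal_functor T C G \<and>
               monoidal_nat_trans T C F G \<eta>},
      Dom = (\<lambda>(F, G, \<eta>). F),
      Cod = (\<lambda>(F, G, \<eta>). G),
      Ident = (\<lambda>F. (F, F, \<lambda>A\<in>Obj T. Ident C (FObj F A))),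
      Comp = (\<lambda>(G', H, \<theta>) (F, G, \<eta>). (F, H, \<lambda>A\<in>Obj T. \<theta> A \<cdot>\<^bsub>C\<^esub> \<eta> A))\<rparr>"


section \<open>Bicommutative bimonoids\<close>

record ('o, 'a) bimonoid_data =
  carr :: "'o"
  bmul :: "'a"
  bone :: "'a"
  bcomul :: "'a"
  bcounit :: "'a"

locale commutative_monoid = symmetric_monoidal_category C
  for C :: "('o, 'a, 'z) smc_data_scheme" (structure) +
  fixes A :: 'o and \<mu> \<eta> :: 'a
  assumes monoid_obj: "A \<in> Obj C"
    and mul_hom: "\<mu> \<in> Hom C (A \<odot> A) A"
    and one_hom: "\<eta> \<in> Hom C (MUnit C) A"
    and mul_assoc: "\<mu> \<cdot> (\<mu> \<otimes> Ident C A) = \<mu> \<cdot> (Ident C A \<otimes> \<mu>) \<cdot> Assoc C A A A"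
    and mul_one_left: "\<mu> \<cdot> (\<eta> \<otimes> Ident C A) = LUnit C A"
    and mul_one_right: "\<mu> \<cdot> (Ident C A \<otimes> \<eta>) = RUnit C A"
    and mul_comm: "\<mu> \<cdot> Symm C A A = \<mu>"

locale cocommutative_comonoid = symmetric_monoidal_category C
  for C :: "('o, 'a, 'z) smc_data_scheme" (structure) +
  fixes A :: 'o and \<Delta> \<epsilon> :: 'a
  assumes comonoid_obj: "A \<in> Obj C"
    and comul_hom: "\<Delta> \<in> Hom C A (A \<odot> A)"
    and counit_hom: "\<epsilon> \<in> Hom C A (MUnit C)"
    and comul_coassoc: "Assoc C A A A \<cdot> (\<Delta> \<otimes> Ident C A) \<cdot> \<Delta> = (Ident C A \<otimes> \<Delta>) \<cdot> \<Delta>"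
    and comul_counit_left: "LUnit C A \<cdot> (\<epsilon> \<otimes> Ident C A) \<cdot> \<Delta> = Ident C A"
    and comul_counit_right: "RUnit C A \<cdot> (Ident C A \<otimes> \<epsilon>) \<cdot> \<Delta> = Ident C A"
    and comul_cocomm: "Symm C A A \<cdot> \<Delta> = \<Delta>"

text \<open>
  The map \<open>1 \<otimes> \<tau> \<otimes> 1 : (A \<odot> A) \<odot> (A \<odot> A) \<rightarrow> (A \<odot> A) \<odot> (A \<odot> A)\<close> with its associators made explicit.
\<close>

definition middle_swap :: "('o, 'a, 'z) smc_data_scheme \<Rightarrow> 'o \<Rightarrow> 'a" where
  "middle_swap C A =
     inv_arrow C (Assoc C A A (A \<odot>\<^bsub>C\<^esub> A)) \<cdot>\<^bsub>C\<^esub>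
     (Ident C A \<otimes>\<^bsub>C\<^esub>
        (Assoc C A A A \<cdot>\<^bsub>C\<^esub> (Symm C A A \<otimes>\<^bsub>C\<^esub> Ident C A) \<cdot>\<^bsub>C\<^esub> inv_arrow C (Assoc C A A A))) \<cdot>\<^bsub>C\<^esub>
     Assoc C A A (A \<odot>\<^bsub>C\<^esub> A)"

text \<open>
  Unitors made explicit: \<open>\<eta> \<otimes> \<eta>\<close> and \<open>\<epsilon> \<otimes> \<epsilon>\<close> are pre- and postcomposed with the isomorphism
  between \<open>I\<close> and \<open>I \<odot> I\<close>.
\<close>

locale bicommutative_bimonoid =
  commutative_monoid C "carr X" "bmul X" "bone X" +
  cocommutative_comonoid C "carr X" "bcomul X" "bcounit X"
  for C :: "('o, 'a, 'z) smc_data_scheme" (structure)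
  and X :: "('o, 'a) bimonoid_data" +
  assumes comul_mul: "bcomul X \<cdot> bmul X =
            (bmul X \<otimes> bmul X) \<cdot> middle_swap C (carr X) \<cdot> (bcomul X \<otimes> bcomul X)"
    and comul_one: "bcomul X \<cdot> bone X =
            (bone X \<otimes> bone X) \<cdot> inv_arrow C (LUnit C (MUnit C))"
    and counit_mul: "bcounit X \<cdot> bmul X =
            LUnit C (MUnit C) \<cdot> (bcounit X \<otimes> bcounit X)"
    and counit_one: "bcounit X \<cdot> bone X = Ident C (MUnit C)"

definition bimonoid_hom ::
  "('o, 'a, 'z) smc_data_scheme \<Rightarrow> ('o, 'a) bimonoid_data \<Rightarrow> ('o, 'a) bimonoid_data \<Rightarrow> 'a \<Rightarrow> bool"
  where
  "bimonoid_hom C X Y f \<longleftrightarrow>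
     f \<in> Hom C (carr X) (carr Y) \<and>
     bmul Y \<cdot>\<^bsub>C\<^esub> (f \<otimes>\<^bsub>C\<^esub> f) = f \<cdot>\<^bsub>C\<^esub> bmul X \<and>
     f \<cdot>\<^bsub>C\<^esub> bone X = bone Y \<and>
     bcomul Y \<cdot>\<^bsub>C\<^esub> f = (f \<otimes>\<^bsub>C\<^esub> f) \<cdot>\<^bsub>C\<^esub> bcomul X \<and>
     bcounit Y \<cdot>\<^bsub>C\<^esub> f = bcounit X"

definition bimonoid_category ::
  "('o, 'a, 'z) smc_data_scheme \<Rightarrow>
   (('o, 'a) bimonoid_data,
    ('o, 'a) bimonoid_data \<times> ('o, 'a) bimonoid_data \<times> 'a) cat_data" where
  "bimonoid_category C =
     \<lparr>Obj = {X. bicommutative_bimonoid C X},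
      Arr = {(X, Y, f). bicommutative_bimonoid C X \<and> bicommutative_bimonoid C Y \<and>
               bimonoid_hom C X Y f},
      Dom = (\<lambda>(X, Y, f). X),
      Cod = (\<lambda>(X, Y, f). Y),
      Ident = (\<lambda>X. (X, X, Ident C (carr X))),
      Comp = (\<lambda>(Y', Z, g) (X, Y, f). (X, Z, g \<cdot>\<^bsub>C\<^esub> f))\<rparr>"


section \<open>Spans of finite sets\<close>

text \<open>
  The chosen \<open>n\<close>-element set is \<open>{..<n}\<close>. A span \<open>{..<m} \<leftarrow> S \<rightarrow> {..<n}\<close> is a triple \<open>(S, f, g)\<close>; the
  values of \<open>f\<close> and \<open>g\<close> outside \<open>S\<close> are irrelevant, since spans are only considered up to
  isomorphism.
\<close>

type_synonym 's span = "'s set \<times> ('s \<Rightarrow> nat) \<times> ('s \<Rightarrow> nat)"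

definition is_span :: "nat \<Rightarrow> nat \<Rightarrow> 's span \<Rightarrow> bool" where
  "is_span m n = (\<lambda>(S, f, g). finite S \<and> f \<in> S \<rightarrow> {..<m} \<and> g \<in> S \<rightarrow> {..<n})"

definition span_iso :: "'s span \<Rightarrow> 't span \<Rightarrow> bool" where
  "span_iso = (\<lambda>(S, f, g) (T, h, k).
     \<exists>b. bij_betw b S T \<and> (\<forall>s\<in>S. h (b s) = f s \<and> k (b s) = g s))"

text \<open>
  Isomorphism classes are taken among spans whose apex is a subset of \<open>nat\<close>. Every finite set is in
  bijection with such a subset, so spans with a finite apex in any type have a (nonempty) class.
\<close>

definition span_class :: "'s span \<Rightarrow> nat span set" where
  "span_class X = {Y. span_iso X Y}"

definition span_pullback :: "'s span \<Rightarrow> 't span \<Rightarrow> ('s \<times> 't) span" where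
  "span_pullback = (\<lambda>(S, f, g) (T, h, k).
     ({(s, t). s \<in> S \<and> t \<in> T \<and> g s = h t}, \<lambda>(s, t). f s, \<lambda>(s, t). k t))"

text \<open>
  The disjoint union of \<open>{..<m}\<close> and \<open>{..<n}\<close> is identified with \<open>{..<m + n}\<close>, the second summand
  being shifted by \<open>m\<close>.
\<close>

definition span_sum :: "nat \<Rightarrow> nat \<Rightarrow> 's span \<Rightarrow> 't span \<Rightarrow> ('s + 't) span" where
  "span_sum m n = (\<lambda>(S, f, g) (T, h, k).
     (S <+> T, case_sum f (\<lambda>t. m + h t), case_sum g (\<lambda>t. n + k t)))"

text \<open>
  Arrows \<open>m \<rightarrow> n\<close> are triples \<open>(m, n, P)\<close> with \<open>P\<close> an isomorphism class. Composition and tensor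
  product are computed on representatives; the unions below do not depend on a choice of
  representatives, all members of the family being the same class.
\<close>

definition FinSpan :: "(nat, nat \<times> nat \<times> nat span set) smc_data" where
  "FinSpan =
     \<lparr>Obj = UNIV,
      Arr = {(m, n, span_class X) | m n (X :: nat span). is_span m n X},
      Dom = (\<lambda>(m, n, P). m),
      Cod = (\<lambda>(m, n, P). n),
      Ident = (\<lambda>n. (n, n, span_class ({..<n}, \<lambda>i. i, \<lambda>i. i))),
      Comp = (\<lambda>(n', p, Q) (m, n, P). (m, p, \<Union>X\<in>P. \<Union>Y\<in>Q. span_class (span_pullback X Y))),
      TensO = (+),
      TensA = (\<lambda>(m, n, P) (m', n', P').
        (m + m', n + n', \<Union>X\<in>P. \<Union>Y\<in>P'. span_class (span_sum m n X Y))),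
      MUnit = 0,
      Assoc = (\<lambda>m n p. (m + n + p, m + n + p, span_class ({..<m + n + p}, \<lambda>i. i, \<lambda>i. i))),
      LUnit = (\<lambda>n. (n, n, span_class ({..<n}, \<lambda>i. i, \<lambda>i. i))),
      RUnit = (\<lambda>n. (n, n, span_class ({..<n}, \<lambda>i. i, \<lambda>i. i))),
      Symm = (\<lambda>m n. (m + n, n + m,
        span_class ({..<m + n}, \<lambda>i. i, \<lambda>i. if i < m then n + i else i - m)))\<rparr>"

end

theory Submission
  imports Defs
begin

text \<open>
  An algebra \<open>F\<close> of \<open>FinSpan\<close> is sent to the image under \<open>F\<close> of the bimonoid carried by the object \<open>1\<close> of
  \<open>FinSpan\<close>, all of whose structure matrices have entries \<open>1\<close>. This functor is fully faithful, because
  a monoidal transformation is determined by its component at \<open>1\<close> and because every matrix is built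
  from the bimonoid structure by composition and tensor product.

  It is surjective on objects: a bimonoid with carrier \<open>A\<close> lives in the strict PROP of arrows between
  tensor powers of \<open>A\<close>. In a PROP with a bicommutative bimonoid on \<open>1\<close>, the cocommutative comonoid
  homomorphisms form a cartesian category in which \<open>1\<close> is a commutative monoid, so the homomorphisms
  \<open>m \<rightarrow> 1\<close> can be added, and a matrix acts as the tuple of the linear combinations of the projections
  given by its rows. Composition of such tuples is matrix multiplication.
\<close>

section \<open>Calculating in symmetric monoidal categories\<close>

text \<open>Strictness is the obstacle: matrix arithmetic is readable only without associators,
  while \<open>C\<close> is an arbitrary symmetric monoidal category and no coherence theorem is
  invoked. The matrix calculus therefore lives in strict PROPs. Associators of \<open>C\<close>
  survive mainly where a PROP meets \<open>C\<close>: in the concatenation of tensor powers and in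
  the transport of axioms along structure isomorphisms. Transport works both ways: algebras preserve
  bimonoids, and the faithful inclusion of the PROP of tensor powers reflects them.

  A PROP may have arrows that are not comonoid homomorphisms. Duplication is natural only at the
  homomorphisms, and this naturality is what makes the distributive laws hold. The bimonoid axioms
  say that multiplication and unit are homomorphisms; cocommutativity makes the comultiplication
  one. Functoriality of the matrix action then follows by calculating with tuples, without normal
  forms for composites of generators.

  Since the first power of \<open>A\<close> is \<open>A\<close> itself, the functor of algebras hits
  every bimonoid on the nose, and the counit of the equivalence consists of identities.\<close>

context category
begin

lemma HomD:
  assumes "f \<in> Hom C A B"
  shows "f \<in> Arr C" "Dom C f = A" "Cod C f = B"
  using assms by (auto simp: Hom_def)

lemma HomI: "\<lbrakk>f \<in> Arr C; Dom C f = A; Cod C f = B\<rbrakk> \<Longrightarrow> f \<in> Hom C A B"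
  by (simp add: Hom_def)

lemma ident_simps [simp]:
  assumes "A \<in> Obj C"
  shows "Ident C A \<in> Arr C" "Dom C (Ident C A) = A" "Cod C (Ident C A) = A"
  using ident_hom[OF assms] by (auto simp: Hom_def)

lemma comp_simps [simp]:
  assumes "f \<in> Arr C" "g \<in> Arr C" "Dom C g = Cod C f"
  shows "g \<cdot> f \<in> Arr C" "Dom C (g \<cdot> f) = Dom C f" "Cod C (g \<cdot> f) = Cod C g"
  using comp_hom[of f "Dom C f" "Cod C f" g "Cod C g"] assms by (auto simp: Hom_def)

lemma comp_assoc_simp [simp]:
  "\<lbrakk>f \<in> Arr C; g \<in> Arr C; h \<in> Arr C; Dom C g = Cod C f; Dom C h = Cod C g\<rbrakk> \<Longrightarrow>
    (h \<cdot> g) \<cdot> f = h \<cdot> g \<cdot> f"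
  by (rule comp_assoc) (auto simp: Hom_def)

lemma comp_ident_simps [simp]:
  "\<lbrakk>f \<in> Arr C; Dom C f = A\<rbrakk> \<Longrightarrow> f \<cdot> Ident C A = f"
  "\<lbrakk>f \<in> Arr C; Cod C f = A\<rbrakk> \<Longrightarrow> Ident C A \<cdot> f = f"
  by (auto intro: comp_ident_left comp_ident_right simp: Hom_def)

declare dom_obj [simp] cod_obj [simp]

text \<open>Simplification nests composites to the right, so \<open>g \<cdot> f\<close> is not a
  subterm of \<open>g \<cdot> f \<cdot> x\<close>. This form applies an equation for it in front of
  an arbitrary tail.\<close>

lemma comp_reduce:
  assumes "g \<cdot> f = r" "f \<in> Arr C" "g \<in> Arr C" "Dom C g = Cod C f"
    "x \<in> Arr C" "Cod C x = Dom C f"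
  shows "g \<cdot> f \<cdot> x = r \<cdot> x"
  using assms(1)[symmetric] assms(2-) by simp

lemma comp_reduce_eq:
  assumes "g \<cdot> f = k \<cdot> h" "f \<in> Arr C" "g \<in> Arr C" "Dom C g = Cod C f"
    "h \<in> Arr C" "k \<in> Arr C" "Dom C k = Cod C h"
    "x \<in> Arr C" "Cod C x = Dom C f" "Cod C x = Dom C h"
  shows "g \<cdot> f \<cdot> x = k \<cdot> h \<cdot> x"
  using comp_reduce[OF assms(1-4,8,9)] assms(5-) by simp

lemma inverse_arrows_unique:
  assumes g: "inverse_arrows C f g" and h: "inverse_arrows C f h"
  shows "g = h"
proof -
  have *: "(g \<cdot> f) \<cdot> h = g \<cdot> f \<cdot> h"
    by (rule comp_assoc_simp) (use assms in \<open>auto simp: inverse_arrows_def Hom_def\<close>)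
  have "g \<cdot> f = Ident C (Cod C h)" "f \<cdot> h = Ident C (Dom C g)" "g \<in> Arr C" "h \<in> Arr C"
    using assms by (auto simp: inverse_arrows_def Hom_def)
  with * show ?thesis by simp
qed

lemma inv_arrowI: "inverse_arrows C f g \<Longrightarrow> inv_arrow C f = g"
  unfolding inv_arrow_def using inverse_arrows_unique by blast

lemma inverse_arrows_inv: "iso_arrow C f \<Longrightarrow> inverse_arrows C f (inv_arrow C f)"
  unfolding iso_arrow_def using inv_arrowI by metis

lemma iso_arr: "iso_arrow C f \<Longrightarrow> f \<in> Arr C"
  by (auto simp: iso_arrow_def inverse_arrows_def)

lemma inv_simps [simp]:
  assumes "iso_arrow C f"
  shows "inv_arrow C f \<in> Arr C" "Dom C (inv_arrow C f) = Cod C f" "Cod C (inv_arrow C f) = Dom C f"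
    "inv_arrow C f \<cdot> f = Ident C (Dom C f)" "f \<cdot> inv_arrow C f = Ident C (Cod C f)"
  using inverse_arrows_inv[OF assms] by (auto simp: inverse_arrows_def Hom_def)

lemma inv_comp_simps [simp]:
  assumes "iso_arrow C f" "x \<in> Arr C"
  shows "Cod C x = Dom C f \<Longrightarrow> inv_arrow C f \<cdot> f \<cdot> x = x"
    "Cod C x = Cod C f \<Longrightarrow> f \<cdot> inv_arrow C f \<cdot> x = x"
proof -
  note f = iso_arr[OF assms(1)] inverse_arrows_inv[OF assms(1)]
  show "inv_arrow C f \<cdot> f \<cdot> x = x" if "Cod C x = Dom C f"
    by (subst comp_reduce[where r = "Ident C (Dom C f)"]) (use assms f that in simp_all)
  show "f \<cdot> inv_arrow C f \<cdot> x = x" if "Cod C x = Cod C f"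
    by (subst comp_reduce[where r = "Ident C (Cod C f)"]) (use assms f that in simp_all)
qed

lemma iso_arrowI:
  "\<lbrakk>f \<in> Arr C; g \<in> Arr C; Dom C g = Cod C f; Cod C g = Dom C f;
    g \<cdot> f = Ident C (Dom C f); f \<cdot> g = Ident C (Cod C f)\<rbrakk> \<Longrightarrow> iso_arrow C f"
  unfolding iso_arrow_def inverse_arrows_def by (auto simp: Hom_def)

lemma inv_eqI:
  "\<lbrakk>f \<in> Arr C; g \<in> Arr C; Dom C g = Cod C f; Cod C g = Dom C f;
    g \<cdot> f = Ident C (Dom C f); f \<cdot> g = Ident C (Cod C f)\<rbrakk> \<Longrightarrow> inv_arrow C f = g"
  by (rule inv_arrowI) (auto simp: inverse_arrows_def Hom_def)

lemma iso_ident [simp]: "A \<in> Obj C \<Longrightarrow> iso_arrow C (Ident C A)"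
  by (rule iso_arrowI[where g = "Ident C A"]) auto

lemma inv_ident [simp]: "A \<in> Obj C \<Longrightarrow> inv_arrow C (Ident C A) = Ident C A"
  by (rule inv_eqI) auto

lemma iso_comp [simp]:
  assumes "iso_arrow C f" "iso_arrow C g" "Dom C g = Cod C f"
  shows "iso_arrow C (g \<cdot> f)"
  by (rule iso_arrowI[where g = "inv_arrow C f \<cdot> inv_arrow C g"])
    (use assms iso_arr in simp_all)

lemma inv_comp:
  assumes "iso_arrow C f" "iso_arrow C g" "Dom C g = Cod C f"
  shows "inv_arrow C (g \<cdot> f) = inv_arrow C f \<cdot> inv_arrow C g"
  by (rule inv_eqI) (use assms iso_arr in simp_all)

lemma iso_inv [simp]: "iso_arrow C f \<Longrightarrow> iso_arrow C (inv_arrow C f)"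
  by (rule iso_arrowI[where g = f]) (use iso_arr in simp_all)

lemma iso_cancel_right:
  assumes "f \<cdot> e = g \<cdot> e" "iso_arrow C e" "f \<in> Arr C" "g \<in> Arr C"
    "Dom C f = Cod C e" "Dom C g = Cod C e"
  shows "f = g"
proof -
  have "(f \<cdot> e) \<cdot> inv_arrow C e = (g \<cdot> e) \<cdot> inv_arrow C e" using assms(1) by simp
  then show ?thesis using assms(2-) iso_arr by simp
qed

lemma iso_cancel_left:
  assumes "e \<cdot> f = e \<cdot> g" "iso_arrow C e" "f \<in> Arr C" "g \<in> Arr C"
    "Cod C f = Dom C e" "Cod C g = Dom C e"
  shows "f = g"
proof -
  have "inv_arrow C e \<cdot> e \<cdot> f = inv_arrow C e \<cdot> e \<cdot> g" using assms(1) by simp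
  then show ?thesis using assms(2-) by simp
qed

lemma iso_transpose_left:
  assumes "e \<cdot> f = g" "iso_arrow C e" "f \<in> Arr C" "Cod C f = Dom C e"
  shows "f = inv_arrow C e \<cdot> g"
  using assms by auto

lemma iso_transpose_right:
  assumes "f \<cdot> e = g" "iso_arrow C e" "f \<in> Arr C" "Dom C f = Cod C e"
  shows "f = g \<cdot> inv_arrow C e"
  using assms iso_arr by auto

end

context symmetric_monoidal_category
begin

declare unit_obj [simp] tens_obj [simp] tens_ident [simp] assoc_iso [simp]
  lunit_iso [simp] runit_iso [simp] symm_symm [simp]

lemma tens_simps [simp]:
  assumes "f \<in> Arr C" "g \<in> Arr C"
  shows "f \<otimes> g \<in> Arr C" "Dom C (f \<otimes> g) = Dom C f \<odot> Dom C g" "Cod C (f \<otimes> g) = Cod C f \<odot> Cod C g"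
  using tens_hom[of f "Dom C f" "Cod C f" g "Dom C g" "Cod C g"] assms by (auto simp: Hom_def)

text \<open>Interchange is oriented towards composing inside the tensor. Together with right-nested
  composites this is the normal form in which diagrams are compared below.\<close>

lemma tens_merge [simp]:
  assumes "f \<in> Arr C" "f' \<in> Arr C" "g \<in> Arr C" "g' \<in> Arr C" "Dom C f' = Cod C f" "Dom C g' = Cod C g"
  shows "(f' \<otimes> g') \<cdot> (f \<otimes> g) = (f' \<cdot> f) \<otimes> (g' \<cdot> g)"
  using assms by (subst tens_comp[symmetric]) (auto simp: Hom_def)

lemma tens_merge_comp [simp]:
  assumes "f \<in> Arr C" "f' \<in> Arr C" "g \<in> Arr C" "g' \<in> Arr C" "Dom C f' = Cod C f" "Dom C g' = Cod C g"
    "x \<in> Arr C" "Cod C x = Dom C f \<odot> Dom C g"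
  shows "(f' \<otimes> g') \<cdot> (f \<otimes> g) \<cdot> x = ((f' \<cdot> f) \<otimes> (g' \<cdot> g)) \<cdot> x"
  by (rule comp_reduce) (use assms in simp_all)

lemma assoc_simps [simp]:
  assumes "A \<in> Obj C" "B \<in> Obj C" "D \<in> Obj C"
  shows "Assoc C A B D \<in> Arr C" "Dom C (Assoc C A B D) = (A \<odot> B) \<odot> D"
    "Cod C (Assoc C A B D) = A \<odot> (B \<odot> D)"
  using assoc_hom[OF assms] by (auto simp: Hom_def)

lemma unitor_simps [simp]:
  assumes "A \<in> Obj C"
  shows "LUnit C A \<in> Arr C" "Dom C (LUnit C A) = MUnit C \<odot> A" "Cod C (LUnit C A) = A"
    "RUnit C A \<in> Arr C" "Dom C (RUnit C A) = A \<odot> MUnit C" "Cod C (RUnit C A) = A"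
  using lunit_hom[OF assms] runit_hom[OF assms] by (auto simp: Hom_def)

lemma symm_simps [simp]:
  assumes "A \<in> Obj C" "B \<in> Obj C"
  shows "Symm C A B \<in> Arr C" "Dom C (Symm C A B) = A \<odot> B" "Cod C (Symm C A B) = B \<odot> A"
  using symm_hom[OF assms] by (auto simp: Hom_def)

lemma iso_tens [simp]:
  assumes "iso_arrow C f" "iso_arrow C g"
  shows "iso_arrow C (f \<otimes> g)"
  by (rule iso_arrowI[where g = "inv_arrow C f \<otimes> inv_arrow C g"])
    (use assms iso_arr in simp_all)

lemma inv_tens:
  assumes "iso_arrow C f" "iso_arrow C g"
  shows "inv_arrow C (f \<otimes> g) = inv_arrow C f \<otimes> inv_arrow C g"
  by (rule inv_eqI) (use assms iso_arr in simp_all)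

lemma iso_symm [simp]: "\<lbrakk>A \<in> Obj C; B \<in> Obj C\<rbrakk> \<Longrightarrow> iso_arrow C (Symm C A B)"
  by (rule iso_arrowI[where g = "Symm C B A"]) simp_all

lemma assoc_nat:
  assumes "f \<in> Arr C" "g \<in> Arr C" "h \<in> Arr C" "Cod C f = A'" "Cod C g = B'" "Cod C h = D'"
  shows "Assoc C A' B' D' \<cdot> ((f \<otimes> g) \<otimes> h) =
    (f \<otimes> g \<otimes> h) \<cdot> Assoc C (Dom C f) (Dom C g) (Dom C h)"
  by (rule assoc_natural) (use assms in \<open>auto simp: Hom_def\<close>)

lemma assoc_nat_comp:
  assumes "f \<in> Arr C" "g \<in> Arr C" "h \<in> Arr C" "Cod C f = A'" "Cod C g = B'" "Cod C h = D'"
    "x \<in> Arr C" "Cod C x = (Dom C f \<odot> Dom C g) \<odot> Dom C h"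
  shows "Assoc C A' B' D' \<cdot> ((f \<otimes> g) \<otimes> h) \<cdot> x =
    (f \<otimes> g \<otimes> h) \<cdot> Assoc C (Dom C f) (Dom C g) (Dom C h) \<cdot> x"
  by (rule comp_reduce_eq[OF assoc_nat]) (use assms in auto)

lemma lunit_nat:
  "\<lbrakk>f \<in> Arr C; Cod C f = B\<rbrakk> \<Longrightarrow> LUnit C B \<cdot> (Ident C (MUnit C) \<otimes> f) = f \<cdot> LUnit C (Dom C f)"
  by (rule lunit_natural) (auto simp: Hom_def)

lemma runit_nat:
  "\<lbrakk>f \<in> Arr C; Cod C f = B\<rbrakk> \<Longrightarrow> RUnit C B \<cdot> (f \<otimes> Ident C (MUnit C)) = f \<cdot> RUnit C (Dom C f)"
  by (rule runit_natural) (auto simp: Hom_def)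

lemma symm_nat:
  assumes "f \<in> Arr C" "g \<in> Arr C" "Cod C f = A'" "Cod C g = B'"
  shows "Symm C A' B' \<cdot> (f \<otimes> g) = (g \<otimes> f) \<cdot> Symm C (Dom C f) (Dom C g)"
  by (rule symm_natural) (use assms in \<open>auto simp: Hom_def\<close>)

text \<open>By naturality of the left unitor, tensoring with the unit object is isomorphic to the
  identity functor, hence faithful.\<close>

lemma tens_left_unit_cancel:
  assumes "Ident C (MUnit C) \<otimes> f = Ident C (MUnit C) \<otimes> g" "f \<in> Arr C" "g \<in> Arr C"
    "Dom C f = Dom C g" "Cod C f = Cod C g"
  shows "f = g"
proof (rule iso_cancel_right)
  show "f \<cdot> LUnit C (Dom C f) = g \<cdot> LUnit C (Dom C f)"
    using lunit_nat[of f "Cod C f"] lunit_nat[of g "Cod C g"] assms by simp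
qed (use assms in auto)

lemma tens_right_unit_cancel:
  assumes "f \<otimes> Ident C (MUnit C) = g \<otimes> Ident C (MUnit C)" "f \<in> Arr C" "g \<in> Arr C"
    "Dom C f = Dom C g" "Cod C f = Cod C g"
  shows "f = g"
proof (rule iso_cancel_right)
  show "f \<cdot> RUnit C (Dom C f) = g \<cdot> RUnit C (Dom C f)"
    using runit_nat[of f "Cod C f"] runit_nat[of g "Cod C g"] assms by simp
qed (use assms in auto)

text \<open>The next two laws are Kelly's redundant axioms of a monoidal category.\<close>

lemma lunit_tens:
  assumes A: "A \<in> Obj C" and B: "B \<in> Obj C"
  shows "LUnit C (A \<odot> B) \<cdot> Assoc C (MUnit C) A B = LUnit C A \<otimes> Ident C B"
proof (rule tens_left_unit_cancel)
  let ?I = "MUnit C"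
  \<comment> \<open>Two consecutive edges of the pentagon on \<open>?I, ?I, A, B\<close>.
    Precomposing with them brings both the pentagon and the triangle into play.\<close>
  let ?e = "Assoc C ?I (?I \<odot> A) B \<cdot> (Assoc C ?I ?I A \<otimes> Ident C B)"
  show "Ident C ?I \<otimes> (LUnit C (A \<odot> B) \<cdot> Assoc C ?I A B) =
    Ident C ?I \<otimes> (LUnit C A \<otimes> Ident C B)"
  proof (rule iso_cancel_right)
    have "(Ident C ?I \<otimes> (LUnit C (A \<odot> B) \<cdot> Assoc C ?I A B)) \<cdot> ?e =
        (Ident C ?I \<otimes> LUnit C (A \<odot> B)) \<cdot> (Ident C ?I \<otimes> Assoc C ?I A B) \<cdot> ?e"
      using A B by simp
    also have "\<dots> = (Ident C ?I \<otimes> LUnit C (A \<odot> B)) \<cdot> Assoc C ?I ?I (A \<odot> B) \<cdot> Assoc C (?I \<odot> ?I) A B"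
      by (subst pentagon) (use A B in simp_all)
    also have "\<dots> = (RUnit C ?I \<otimes> Ident C A \<otimes> Ident C B) \<cdot> Assoc C (?I \<odot> ?I) A B"
      using A B by (simp add: comp_reduce[OF triangle])
    also have "\<dots> = Assoc C ?I A B \<cdot> ((RUnit C ?I \<otimes> Ident C A) \<otimes> Ident C B)"
      using A B by (subst assoc_nat) auto
    also have "\<dots> = Assoc C ?I A B \<cdot> ((Ident C ?I \<otimes> LUnit C A) \<otimes> Ident C B) \<cdot> (Assoc C ?I ?I A \<otimes> Ident C B)"
      using A B by (subst triangle[symmetric]) auto
    also have "\<dots> = (Ident C ?I \<otimes> LUnit C A \<otimes> Ident C B) \<cdot> ?e"
      using A B by (subst assoc_nat_comp) auto
    finally show "(Ident C ?I \<otimes> (LUnit C (A \<odot> B) \<cdot> Assoc C ?I A B)) \<cdot> ?e =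
      (Ident C ?I \<otimes> LUnit C A \<otimes> Ident C B) \<cdot> ?e" .
  qed (use A B in auto)
qed (use A B in auto)

lemma runit_tens:
  assumes A: "A \<in> Obj C" and B: "B \<in> Obj C"
  shows "(Ident C A \<otimes> RUnit C B) \<cdot> Assoc C A B (MUnit C) = RUnit C (A \<odot> B)"
proof (rule tens_right_unit_cancel)
  let ?I = "MUnit C"
  let ?i = "Ident C ?I"
  show "((Ident C A \<otimes> RUnit C B) \<cdot> Assoc C A B ?I) \<otimes> ?i = RUnit C (A \<odot> B) \<otimes> ?i"
  proof (rule iso_cancel_left)
    \<comment> \<open>The mirror image: the pentagon on \<open>A, B, ?I, ?I\<close>, with triangles
      filled in at both ends.\<close>
    have "Assoc C A B ?I \<cdot> (((Ident C A \<otimes> RUnit C B) \<cdot> Assoc C A B ?I) \<otimes> ?i) =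
        Assoc C A B ?I \<cdot> ((Ident C A \<otimes> RUnit C B) \<otimes> ?i) \<cdot> (Assoc C A B ?I \<otimes> ?i)"
      using A B by simp
    also have "\<dots> = (Ident C A \<otimes> RUnit C B \<otimes> ?i) \<cdot> Assoc C A (B \<odot> ?I) ?I \<cdot> (Assoc C A B ?I \<otimes> ?i)"
      using A B by (subst assoc_nat_comp) auto
    also have "\<dots> = (Ident C A \<otimes> Ident C B \<otimes> LUnit C ?I) \<cdot>
        (Ident C A \<otimes> Assoc C B ?I ?I) \<cdot> Assoc C A (B \<odot> ?I) ?I \<cdot> (Assoc C A B ?I \<otimes> ?i)"
      using A B by (subst triangle[symmetric]) (auto simp del: tens_ident)
    also have "\<dots> = (Ident C A \<otimes> Ident C B \<otimes> LUnit C ?I) \<cdot> Assoc C A B (?I \<odot> ?I) \<cdot> Assoc C (A \<odot> B) ?I ?I"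
      by (subst pentagon) (use A B in simp_all)
    also have "\<dots> = Assoc C A B ?I \<cdot> ((Ident C A \<otimes> Ident C B) \<otimes> LUnit C ?I) \<cdot> Assoc C (A \<odot> B) ?I ?I"
      using A B by (subst assoc_nat_comp) (auto simp del: tens_ident)
    also have "\<dots> = Assoc C A B ?I \<cdot> (RUnit C (A \<odot> B) \<otimes> ?i)"
      using A B by (simp add: triangle)
    finally show "Assoc C A B ?I \<cdot> (((Ident C A \<otimes> RUnit C B) \<cdot> Assoc C A B ?I) \<otimes> ?i) =
      Assoc C A B ?I \<cdot> (RUnit C (A \<odot> B) \<otimes> ?i)" .
  qed (use A B in auto)
qed (use A B in auto)

end

section \<open>Bimonoids in a PROP\<close>

context prop_category
begin

declare obj_nat [simp] unit_zero [simp] tens_add [simp]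

abbreviation I :: "nat \<Rightarrow> 'a" where "I \<equiv> Ident T"

lemma structural_ident [simp]:
  "Assoc T m n p = I (m + (n + p))" "LUnit T m = I m" "RUnit T m = I m"
  by (simp_all add: assoc_ident lunit_ident runit_ident)

lemma tens_arr_assoc [simp]:
  "\<lbrakk>f \<in> Arr T; g \<in> Arr T; h \<in> Arr T\<rbrakk> \<Longrightarrow> (f \<otimes> g) \<otimes> h = f \<otimes> g \<otimes> h"
  using assoc_nat[of f g h "Cod T f" "Cod T g" "Cod T h"] by (simp add: add.assoc)

lemma tens_unit [simp]:
  assumes "f \<in> Arr T"
  shows "f \<otimes> I 0 = f" "I 0 \<otimes> f = f"
  using runit_nat[of f "Cod T f"] lunit_nat[of f "Cod T f"] assms by simp_all

lemma tens_ident_comp [simp]: "f \<in> Arr T \<Longrightarrow> I m \<otimes> I n \<otimes> f = I (m + n) \<otimes> f"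
  by (subst tens_arr_assoc[symmetric]) (simp_all del: tens_arr_assoc)

lemma symm_add_right: "Symm T m (n + p) = (I n \<otimes> Symm T m p) \<cdot> (Symm T m n \<otimes> I p)"
  using hexagon[of m n p] by (simp add: add_ac)

lemma symm_inverse:
  "\<lbrakk>f \<in> Arr T; Dom T f = n + m; Cod T f = m + n; f \<cdot> Symm T m n = I (m + n)\<rbrakk> \<Longrightarrow> f = Symm T n m"
  by (rule iso_cancel_right[where e = "Symm T m n"]) (simp_all add: add.commute)

text \<open>The second hexagon is the inverse of the first, because symmetries are inverse to each
  other.\<close>

lemma symm_add_left: "Symm T (m + n) p = (Symm T m p \<otimes> I n) \<cdot> (I m \<otimes> Symm T n p)"
proof -
  have "(Symm T m p \<otimes> I n) \<cdot> (I m \<otimes> Symm T n p) \<cdot> (I m \<otimes> Symm T p n) \<cdot> (Symm T p m \<otimes> I n) = I (p + (m + n))"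
    by (simp add: add_ac)
  then have "((Symm T m p \<otimes> I n) \<cdot> (I m \<otimes> Symm T n p)) \<cdot> Symm T p (m + n) = I (p + (m + n))"
    unfolding symm_add_right by (simp add: add_ac)
  then show ?thesis by (intro symm_inverse[symmetric]) (simp_all add: add_ac)
qed

text \<open>The hexagon makes \<open>Symm T m 0\<close> idempotent, and an invertible idempotent is
  an identity.\<close>

lemma symm_zero [simp]: "Symm T m 0 = I m" "Symm T 0 m = I m"
proof -
  have *: "Symm T m 0 = Symm T m 0 \<cdot> Symm T m 0" using symm_add_right[of m 0 0] by simp
  show m0: "Symm T m 0 = I m"
    by (rule iso_cancel_right[where e = "Symm T m 0"]) (use * in \<open>simp_all\<close>)
  show "Symm T 0 m = I m"
    using symm_symm[of 0 m] m0 by simp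
qed

section \<open>Shuffles of blocks of strands\<close>

text \<open>With four equal arguments this is \<open>middle_swap\<close> without its associators.
  Unequal blocks allow naturality to be stated and duplication to be built one strand at a
  time.\<close>

definition mid :: "nat \<Rightarrow> nat \<Rightarrow> nat \<Rightarrow> nat \<Rightarrow> 'a" where
  "mid m n p q = I m \<otimes> Symm T n p \<otimes> I q"

lemma mid_simps [simp]:
  "mid m n p q \<in> Arr T" "Dom T (mid m n p q) = m + (n + (p + q))" "Cod T (mid m n p q) = m + (p + (n + q))"
  by (simp_all add: mid_def add.assoc)

lemma mid_unit [simp]: "mid m 0 p q = I (m + (p + q))" "mid m n 0 q = I (m + (n + q))"
  by (simp_all add: mid_def)

lemma mid_natural:
  assumes "f \<in> Arr T" "g \<in> Arr T" "h \<in> Arr T" "k \<in> Arr T"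
    "Cod T f = m" "Cod T g = n" "Cod T h = p" "Cod T k = q"
  shows "mid m n p q \<cdot> (f \<otimes> g \<otimes> h \<otimes> k) =
    (f \<otimes> h \<otimes> g \<otimes> k) \<cdot> mid (Dom T f) (Dom T g) (Dom T h) (Dom T k)"
proof -
  have "mid m n p q \<cdot> (f \<otimes> g \<otimes> h \<otimes> k) = (I m \<otimes> Symm T n p \<otimes> I q) \<cdot> (f \<otimes> (g \<otimes> h) \<otimes> k)"
    using assms by (simp add: mid_def)
  also have "\<dots> = f \<otimes> (Symm T n p \<cdot> (g \<otimes> h)) \<otimes> k"
    using assms by (simp del: tens_arr_assoc)
  also have "\<dots> = f \<otimes> ((h \<otimes> g) \<cdot> Symm T (Dom T g) (Dom T h)) \<otimes> k"
    using assms by (simp add: symm_nat)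
  also have "\<dots> = (f \<otimes> (h \<otimes> g) \<otimes> k) \<cdot> mid (Dom T f) (Dom T g) (Dom T h) (Dom T k)"
    using assms by (simp add: mid_def del: tens_arr_assoc)
  finally show ?thesis using assms by simp
qed

lemma symm_whisker_right: "Symm T m (n + p) \<otimes> I q = (I n \<otimes> Symm T m p \<otimes> I q) \<cdot> (Symm T m n \<otimes> I (p + q))"
  using tens_merge[of "Symm T m n \<otimes> I p" "I n \<otimes> Symm T m p" "I q" "I q"]
  by (simp add: symm_add_right)

lemma symm_whisker_left: "I q \<otimes> Symm T (m + n) p = (I q \<otimes> Symm T m p \<otimes> I n) \<cdot> (I (q + m) \<otimes> Symm T n p)"
  using tens_merge[of "I q" "I q" "I m \<otimes> Symm T n p" "Symm T m p \<otimes> I n"]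
  by (simp add: symm_add_left)

text \<open>Both sides send the blocks \<open>m m n n p p\<close> to \<open>m n p m n p\<close>.
  Without the outer strands, each is the disjoint crossings of \<open>m\<close> with
  \<open>n\<close> and of \<open>n\<close> with \<open>p\<close>, followed by the crossing of
  \<open>m\<close> with \<open>p\<close>.\<close>

lemma mid_mid:
  "mid m m (n + p) (n + p) \<cdot> (I (m + m) \<otimes> mid n n p p) =
   mid (m + n) (m + n) p p \<cdot> (mid m m n n \<otimes> I (p + p))"
proof -
  let ?s = "Symm T m n" and ?t = "Symm T n p" and ?u = "Symm T m p"
  have "(Symm T m (n + p) \<otimes> I n) \<cdot> (I (m + n) \<otimes> ?t) =
      (I n \<otimes> ?u \<otimes> I n) \<cdot> (?s \<otimes> ?t)"
    by (simp add: symm_whisker_right add_ac)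
  moreover have "(I n \<otimes> Symm T (m + n) p) \<cdot> (?s \<otimes> I (n + p)) = (I n \<otimes> ?u \<otimes> I n) \<cdot> (?s \<otimes> ?t)"
    by (simp add: symm_whisker_left add_ac)
  ultimately have "I m \<otimes> ((Symm T m (n + p) \<otimes> I n) \<cdot> (I (m + n) \<otimes> ?t)) \<otimes> I p =
      I m \<otimes> ((I n \<otimes> Symm T (m + n) p) \<cdot> (?s \<otimes> I (n + p))) \<otimes> I p"
    by simp
  moreover have "I m \<otimes> ((Symm T m (n + p) \<otimes> I n) \<cdot> (I (m + n) \<otimes> ?t)) \<otimes> I p =
      mid m m (n + p) (n + p) \<cdot> (I (m + m) \<otimes> mid n n p p)"
  proof -
    have "mid m m (n + p) (n + p) \<cdot> (I (m + m) \<otimes> mid n n p p) =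
        (I m \<otimes> (Symm T m (n + p) \<otimes> I n) \<otimes> I p) \<cdot> (I m \<otimes> (I (m + n) \<otimes> ?t) \<otimes> I p)"
      by (simp add: mid_def add_ac)
    then show ?thesis by (simp add: add_ac del: tens_arr_assoc)
  qed
  moreover have "I m \<otimes> ((I n \<otimes> Symm T (m + n) p) \<cdot> (?s \<otimes> I (n + p))) \<otimes> I p =
      mid (m + n) (m + n) p p \<cdot> (mid m m n n \<otimes> I (p + p))"
  proof -
    have "mid (m + n) (m + n) p p \<cdot> (mid m m n n \<otimes> I (p + p)) =
        (I m \<otimes> (I n \<otimes> Symm T (m + n) p) \<otimes> I p) \<cdot> (I m \<otimes> (?s \<otimes> I (n + p)) \<otimes> I p)"
      by (simp add: mid_def add_ac)
    then show ?thesis by (simp add: add_ac del: tens_arr_assoc)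
  qed
  ultimately show ?thesis by simp
qed

text \<open>Both sides send \<open>m m n n\<close> to \<open>n m n m\<close>. The crossing of the
  two doubled blocks splits into four elementary crossings, the last of which is undone by
  \<open>mid n n m m\<close>.\<close>

lemma symm_mid:
  "mid n n m m \<cdot> Symm T (m + m) (n + n) = (Symm T m n \<otimes> Symm T m n) \<cdot> mid m m n n"
proof -
  let ?s = "Symm T m n"
  have "Symm T (m + m) (n + n) = (I n \<otimes> ?s \<otimes> I m) \<cdot> (?s \<otimes> ?s) \<cdot> (I m \<otimes> ?s \<otimes> I n)"
    using symm_add_right[of "m + m" n n] symm_whisker_left[of n m m n]
      tens_merge[of "I m \<otimes> ?s" "?s \<otimes> I m" "I n" "I n", symmetric] symm_add_left[of m m n]
    by (simp add: add_ac)
  then have "mid n n m m \<cdot> Symm T (m + m) (n + n) =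
      (mid n n m m \<cdot> (I n \<otimes> ?s \<otimes> I m)) \<cdot> (?s \<otimes> ?s) \<cdot> (I m \<otimes> ?s \<otimes> I n)"
    by (simp add: add_ac)
  also have "mid n n m m \<cdot> (I n \<otimes> ?s \<otimes> I m) = I (n + (m + (n + m)))"
    unfolding mid_def
    by (simp add: add_ac)
  finally show ?thesis by (simp add: mid_def add_ac)
qed

end

text \<open>Placing the bimonoid on the generating object \<open>1\<close> makes every object a
  tensor power of its carrier, so every object inherits a comonoid structure.\<close>

locale prop_bimonoid = prop_category T + bicommutative_bimonoid T X
  for T :: "(nat, 'a, 'z) smc_data_scheme" (structure)
  and X :: "(nat, 'a) bimonoid_data" +
  assumes carr_one: "carr X = 1"
begin

abbreviation mul :: 'a ("\<mu>") where "\<mu> \<equiv> bmul X"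
abbreviation one :: 'a ("\<eta>") where "\<eta> \<equiv> bone X"
abbreviation comul :: 'a ("\<Delta>") where "\<Delta> \<equiv> bcomul X"
abbreviation counit :: 'a ("\<epsilon>") where "\<epsilon> \<equiv> bcounit X"

lemma structure_simps [simp]:
  "\<mu> \<in> Arr T" "Dom T \<mu> = Suc (Suc 0)" "Cod T \<mu> = Suc 0"
  "\<eta> \<in> Arr T" "Dom T \<eta> = 0" "Cod T \<eta> = Suc 0"
  "\<Delta> \<in> Arr T" "Dom T \<Delta> = Suc 0" "Cod T \<Delta> = Suc (Suc 0)"
  "\<epsilon> \<in> Arr T" "Dom T \<epsilon> = Suc 0" "Cod T \<epsilon> = 0"
  using mul_hom one_hom comul_hom counit_hom by (auto simp: Hom_def carr_one)

lemma strict_mul_axioms: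
  "\<mu> \<cdot> (\<mu> \<otimes> I (Suc 0)) = \<mu> \<cdot> (I (Suc 0) \<otimes> \<mu>)" "\<mu> \<cdot> (\<eta> \<otimes> I (Suc 0)) = I (Suc 0)"
  "\<mu> \<cdot> (I (Suc 0) \<otimes> \<eta>) = I (Suc 0)" "\<mu> \<cdot> Symm T (Suc 0) (Suc 0) = \<mu>"
  using mul_assoc mul_one_left mul_one_right mul_comm by (simp_all add: carr_one)

lemma strict_comul_axioms:
  "(\<Delta> \<otimes> I (Suc 0)) \<cdot> \<Delta> = (I (Suc 0) \<otimes> \<Delta>) \<cdot> \<Delta>" "(\<epsilon> \<otimes> I (Suc 0)) \<cdot> \<Delta> = I (Suc 0)"
  "(I (Suc 0) \<otimes> \<epsilon>) \<cdot> \<Delta> = I (Suc 0)" "Symm T (Suc 0) (Suc 0) \<cdot> \<Delta> = \<Delta>"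
  using comul_coassoc comul_counit_left comul_counit_right comul_cocomm by (simp_all add: carr_one)

lemma strict_bimonoid_axioms:
  "\<Delta> \<cdot> \<mu> = (\<mu> \<otimes> \<mu>) \<cdot> mid (Suc 0) (Suc 0) (Suc 0) (Suc 0) \<cdot> (\<Delta> \<otimes> \<Delta>)"
  "\<Delta> \<cdot> \<eta> = \<eta> \<otimes> \<eta>" "\<epsilon> \<cdot> \<mu> = \<epsilon> \<otimes> \<epsilon>" "\<epsilon> \<cdot> \<eta> = I 0"
  using comul_mul comul_one counit_mul counit_one
  by (simp_all add: carr_one middle_swap_def mid_def)

section \<open>Copying and discarding on all objects\<close>

text \<open>The two copies of the \<open>n\<close> strands stay contiguous:
  \<open>mid n n 1 1\<close> moves the first copy of the new strand in front of the second
  block.\<close>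

primrec copy :: "nat \<Rightarrow> 'a" where
  "copy 0 = I 0"
| "copy (Suc n) = mid n n 1 1 \<cdot> (copy n \<otimes> \<Delta>)"

primrec del :: "nat \<Rightarrow> 'a" where
  "del 0 = I 0"
| "del (Suc n) = del n \<otimes> \<epsilon>"

lemma copy_simps [simp]: "copy n \<in> Arr T \<and> Dom T (copy n) = n \<and> Cod T (copy n) = n + n"
  by (induction n) simp_all

lemma del_simps [simp]: "del n \<in> Arr T \<and> Dom T (del n) = n \<and> Cod T (del n) = 0"
  by (induction n) simp_all

lemma copy_one: "copy (Suc 0) = \<Delta>" and del_one: "del (Suc 0) = \<epsilon>"
  by simp_all

text \<open>The recursion for \<open>copy\<close> is the case \<open>n = 1\<close>. In the induction
  step the two shuffles are rearranged by \<open>mid_mid\<close>.\<close>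

lemma copy_add: "copy (m + n) = mid m m n n \<cdot> (copy m \<otimes> copy n)"
proof (induction n)
  case (Suc n)
  have "copy (m + Suc n) = mid (m + n) (m + n) 1 1 \<cdot> ((mid m m n n \<cdot> (copy m \<otimes> copy n)) \<otimes> (I 2 \<cdot> \<Delta>))"
    by (simp add: Suc)
  also have "\<dots> = (mid (m + n) (m + n) 1 1 \<cdot> (mid m m n n \<otimes> I (1 + 1))) \<cdot> (copy m \<otimes> copy n \<otimes> \<Delta>)"
  proof -
    have "copy m \<otimes> copy n \<otimes> \<Delta> = (copy m \<otimes> copy n) \<otimes> \<Delta>" by simp
    then show ?thesis by (simp add: numeral_2_eq_2 del: tens_arr_assoc)
  qed
  also have "\<dots> = (mid m m (n + 1) (n + 1) \<cdot> (I (m + m) \<otimes> mid n n 1 1)) \<cdot> (copy m \<otimes> copy n \<otimes> \<Delta>)"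
    by (simp only: mid_mid)
  also have "\<dots> = mid m m (Suc n) (Suc n) \<cdot> (copy m \<otimes> copy (Suc n))"
    by simp
  finally show ?case .
qed simp

lemma del_add: "del (m + n) = del m \<otimes> del n"
  by (induction n) simp_all

text \<open>\<open>f\<close> and \<open>h\<close> read the first block of inputs, \<open>g\<close>
  and \<open>k\<close> the second. A pairing on a sum of objects is thereby computed on each summand
  separately.\<close>

lemma copy_natural_tens:
  assumes "f \<in> Arr T" "g \<in> Arr T" "h \<in> Arr T" "k \<in> Arr T"
    "Dom T f = m" "Dom T h = m" "Dom T g = n" "Dom T k = n"
  shows "(f \<otimes> g \<otimes> h \<otimes> k) \<cdot> copy (m + n) =
    mid (Cod T f) (Cod T h) (Cod T g) (Cod T k) \<cdot> (((f \<otimes> h) \<cdot> copy m) \<otimes> ((g \<otimes> k) \<cdot> copy n))"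
proof -
  have "(f \<otimes> g \<otimes> h \<otimes> k) \<cdot> copy (m + n) = ((f \<otimes> g \<otimes> h \<otimes> k) \<cdot> mid m m n n) \<cdot> (copy m \<otimes> copy n)"
    using assms by (simp add: copy_add)
  also have "(f \<otimes> g \<otimes> h \<otimes> k) \<cdot> mid m m n n =
      mid (Cod T f) (Cod T h) (Cod T g) (Cod T k) \<cdot> (f \<otimes> h \<otimes> g \<otimes> k)"
    using assms by (subst mid_natural) simp_all
  finally show ?thesis using assms
    by (simp del: tens_arr_assoc add: tens_arr_assoc[of f h "g \<otimes> k", symmetric])
qed

lemma counit_right: "(I n \<otimes> del n) \<cdot> copy n = I n"
proof (induction n)
  case (Suc n)
  have "(I (Suc n) \<otimes> del (Suc n)) \<cdot> copy (n + 1) = (I n \<otimes> I 1 \<otimes> del n \<otimes> \<epsilon>) \<cdot> copy (n + 1)"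
    by (simp del: copy.simps)
  also have "\<dots> = I (Suc n)"
    by (subst copy_natural_tens) (simp_all add: Suc strict_comul_axioms)
  finally show ?case by simp
qed simp

lemma counit_left: "(del n \<otimes> I n) \<cdot> copy n = I n"
proof (induction n)
  case (Suc n)
  have "(del (Suc n) \<otimes> I (Suc n)) \<cdot> copy (n + 1) = (del n \<otimes> \<epsilon> \<otimes> I n \<otimes> I 1) \<cdot> copy (n + 1)"
    by (simp del: copy.simps)
  also have "\<dots> = I (Suc n)"
    by (subst copy_natural_tens) (simp_all add: Suc strict_comul_axioms)
  finally show ?case by simp
qed simp

section \<open>Comonoid homomorphisms\<close>

text \<open>The arrows at which copying and discarding are natural. This is a genuine restriction:
  the ambient PROP may contain arrows that do not come from the bimonoid.\<close>

definition cohom :: "'a \<Rightarrow> bool" where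
  "cohom f \<longleftrightarrow> f \<in> Arr T \<and> copy (Cod T f) \<cdot> f = (f \<otimes> f) \<cdot> copy (Dom T f) \<and>
     del (Cod T f) \<cdot> f = del (Dom T f)"

lemma cohomD:
  assumes "cohom f"
  shows "f \<in> Arr T" "copy (Cod T f) \<cdot> f = (f \<otimes> f) \<cdot> copy (Dom T f)" "del (Cod T f) \<cdot> f = del (Dom T f)"
  using assms by (auto simp: cohom_def)

lemma cohom_ident [simp]: "cohom (I n)"
  by (simp add: cohom_def)

lemma cohom_comp [simp]:
  assumes f: "cohom f" and g: "cohom g" and "Dom T g = Cod T f"
  shows "cohom (g \<cdot> f)"
  using assms cohomD[OF f] cohomD[OF g]
  by (simp add: cohom_def comp_reduce[OF cohomD(2)[OF g]] comp_reduce[OF cohomD(3)[OF g]])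

text \<open>Duplication on a sum is the tensor of the duplications up to \<open>mid\<close>, and
  \<open>mid\<close> is natural.\<close>

lemma cohom_tens [simp]:
  assumes f: "cohom f" and g: "cohom g"
  shows "cohom (f \<otimes> g)"
proof -
  note [simp] = cohomD(1)[OF f] cohomD(1)[OF g]
  have "copy (Cod T f + Cod T g) \<cdot> (f \<otimes> g) =
      mid (Cod T f) (Cod T f) (Cod T g) (Cod T g) \<cdot> (((f \<otimes> f) \<cdot> copy (Dom T f)) \<otimes> ((g \<otimes> g) \<cdot> copy (Dom T g)))"
    using cohomD(2)[OF f] cohomD(2)[OF g] by (simp add: copy_add del: tens_arr_assoc)
  also have "\<dots> = (f \<otimes> g \<otimes> f \<otimes> g) \<cdot> copy (Dom T f + Dom T g)"
    by (subst copy_natural_tens) simp_all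
  finally show ?thesis using cohomD(3)[OF f] cohomD(3)[OF g]
    by (simp add: cohom_def del_add)
qed

lemma cohom_symm [simp]: "cohom (Symm T m n)"
proof -
  have "copy (n + m) \<cdot> Symm T m n = mid n n m m \<cdot> Symm T (m + m) (n + n) \<cdot> (copy m \<otimes> copy n)"
    by (simp add: copy_add symm_nat)
  also have "\<dots> = (Symm T m n \<otimes> Symm T m n) \<cdot> mid m m n n \<cdot> (copy m \<otimes> copy n)"
    by (rule comp_reduce_eq[OF symm_mid, THEN trans]) simp_all
  also have "\<dots> = (Symm T m n \<otimes> Symm T m n) \<cdot> copy (m + n)"
    by (simp add: copy_add)
  finally show ?thesis
    using symm_nat[of "del m" "del n" 0 0]
    by (simp add: cohom_def del_add)
qed

lemma cohom_mid [simp]: "cohom (mid m n p q)"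
  by (simp add: mid_def)

lemma cohom_one [simp]: "cohom \<eta>"
  by (simp add: cohom_def strict_bimonoid_axioms del: copy.simps(2) add: copy_one)

text \<open>Two of the bimonoid axioms, once \<open>copy\<close> on two strands is unfolded to a
  middle swap after \<open>\<Delta> \<otimes> \<Delta>\<close>.\<close>

lemma cohom_mul [simp]: "cohom \<mu>"
  using copy_add[of 1 1]
  by (simp add: cohom_def strict_bimonoid_axioms del: copy.simps(2) add: copy_one)

text \<open>As \<open>copy 0\<close> is an identity, the claim is that discarding both copies
  amounts to discarding the original.\<close>

lemma cohom_counit [simp]: "cohom \<epsilon>"
proof -
  have "(\<epsilon> \<otimes> \<epsilon>) \<cdot> \<Delta> = (I 0 \<otimes> \<epsilon>) \<cdot> (\<epsilon> \<otimes> I 1) \<cdot> \<Delta>"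
    by (simp del: tens_unit)
  then show ?thesis
    by (simp add: cohom_def strict_comul_axioms)
qed

text \<open>Duplicating twice gives four copies, and exchanging the middle two must change nothing.
  Coassociativity rearranges the four copies so that the middle two come from one
  \<open>\<Delta>\<close>.\<close>

lemma cohom_comul [simp]: "cohom \<Delta>"
proof -
  let ?i = "I (Suc 0)"
  have "(\<Delta> \<otimes> \<Delta>) \<cdot> \<Delta> = (\<Delta> \<otimes> I 2) \<cdot> (\<Delta> \<otimes> ?i) \<cdot> \<Delta>"
    unfolding strict_comul_axioms(1) by (simp add: numeral_2_eq_2)
  also have "\<dots> = (((\<Delta> \<otimes> ?i) \<cdot> \<Delta>) \<otimes> ?i) \<cdot> \<Delta>"
  proof -
    have "\<Delta> \<otimes> I 2 = (\<Delta> \<otimes> ?i) \<otimes> ?i" by (simp add: numeral_2_eq_2)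
    then show ?thesis by (simp del: tens_arr_assoc)
  qed
  also have "\<dots> = (((?i \<otimes> \<Delta>) \<cdot> \<Delta>) \<otimes> ?i) \<cdot> \<Delta>"
    by (simp only: strict_comul_axioms(1))
  also have "\<dots> = (?i \<otimes> \<Delta> \<otimes> ?i) \<cdot> (\<Delta> \<otimes> ?i) \<cdot> \<Delta>"
    using tens_merge_comp[of \<Delta> "?i \<otimes> \<Delta>" ?i ?i \<Delta>] by simp
  finally have quad: "(\<Delta> \<otimes> \<Delta>) \<cdot> \<Delta> = (?i \<otimes> \<Delta> \<otimes> ?i) \<cdot> (\<Delta> \<otimes> ?i) \<cdot> \<Delta>" .
  \<comment> \<open>Cocommutativity enters here: the swap acts on the two outputs of a single
    \<open>\<Delta>\<close>.\<close>
  have "mid 1 1 1 1 \<cdot> (?i \<otimes> \<Delta> \<otimes> ?i) = ?i \<otimes> \<Delta> \<otimes> ?i"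
    by (simp add: mid_def strict_comul_axioms)
  then have "mid 1 1 1 1 \<cdot> (?i \<otimes> \<Delta> \<otimes> ?i) \<cdot> (\<Delta> \<otimes> ?i) \<cdot> \<Delta> = (?i \<otimes> \<Delta> \<otimes> ?i) \<cdot> (\<Delta> \<otimes> ?i) \<cdot> \<Delta>"
    by (rule comp_reduce) simp_all
  then have "mid 1 1 1 1 \<cdot> (\<Delta> \<otimes> \<Delta>) \<cdot> \<Delta> = (\<Delta> \<otimes> \<Delta>) \<cdot> \<Delta>"
    unfolding quad .
  moreover have "(\<epsilon> \<otimes> \<epsilon>) \<cdot> \<Delta> = \<epsilon>"
    using cohomD(3)[OF cohom_counit] cohomD(2)[OF cohom_counit] by simp
  ultimately show ?thesis
    using copy_add[of 1 1] del_add[of 1 1]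
    by (simp add: cohom_def del: copy.simps(2) add: copy_one)
qed

lemma cohom_del [simp]: "cohom (del n)"
  by (induction n) simp_all

lemma cohom_copy [simp]: "cohom (copy n)"
  by (induction n) simp_all

text \<open>
  Cocommutative comonoids form a cartesian category; the following is the uniqueness of pairings.
\<close>

lemma cohom_pair:
  assumes f: "cohom f" and "Cod T f = m + n"
  shows "f = (((I m \<otimes> del n) \<cdot> f) \<otimes> ((del m \<otimes> I n) \<cdot> f)) \<cdot> copy (Dom T f)"
proof -
  have [simp]: "f \<in> Arr T" using cohomD(1)[OF f] .
  have "(((I m \<otimes> del n) \<cdot> f) \<otimes> ((del m \<otimes> I n) \<cdot> f)) \<cdot> copy (Dom T f) =
      ((I m \<otimes> del n) \<otimes> (del m \<otimes> I n)) \<cdot> (f \<otimes> f) \<cdot> copy (Dom T f)"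
    using assms by (simp del: tens_arr_assoc)
  \<comment> \<open>The homomorphism property moves \<open>f\<close> in front of the duplication;
    what remains is an instance of the counit laws on \<open>m + n\<close>.\<close>
  also have "\<dots> = ((I m \<otimes> del n) \<otimes> (del m \<otimes> I n)) \<cdot> copy (m + n) \<cdot> f"
    using assms(2) cohomD(2)[OF f] by simp
  also have "\<dots> = ((I m \<otimes> del n \<otimes> del m \<otimes> I n) \<cdot> copy (m + n)) \<cdot> f"
    using assms(2) by simp
  also have "(I m \<otimes> del n \<otimes> del m \<otimes> I n) \<cdot> copy (m + n) = I (m + n)"
    by (subst copy_natural_tens) (simp_all add: counit_left counit_right)
  finally show ?thesis using assms by simp
qed

section \<open>Linear combinations and the action of matrices\<close>

text \<open>The \<open>k\<close>-fold sum of the identity under convolution. The recursion starts at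
  zero, which is the constant arrow \<open>\<eta> \<cdot> \<epsilon>\<close>.\<close>

primrec scalar :: "nat \<Rightarrow> 'a" where
  "scalar 0 = \<eta> \<cdot> \<epsilon>"
| "scalar (Suc k) = \<mu> \<cdot> (scalar k \<otimes> I 1) \<cdot> \<Delta>"

primrec row :: "nat \<Rightarrow> (nat \<Rightarrow> nat) \<Rightarrow> 'a" where
  "row 0 r = \<eta>"
| "row (Suc m) r = \<mu> \<cdot> (row m r \<otimes> scalar (r m))"

text \<open>The tuple of its rows as linear forms: \<open>M i j\<close> is the coefficient of input
  \<open>j\<close> in output \<open>i\<close>, matching the convention for composing
  matrices.\<close>

primrec matrix :: "nat \<Rightarrow> nat \<Rightarrow> (nat \<Rightarrow> nat \<Rightarrow> nat) \<Rightarrow> 'a" where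
  "matrix m 0 M = del m"
| "matrix m (Suc n) M = (matrix m n M \<otimes> row m (M n)) \<cdot> copy m"

lemma scalar_simps [simp]:
  "scalar k \<in> Arr T \<and> Dom T (scalar k) = Suc 0 \<and> Cod T (scalar k) = Suc 0"
  by (induction k) simp_all

lemma row_simps [simp]:
  "row m r \<in> Arr T \<and> Dom T (row m r) = m \<and> Cod T (row m r) = Suc 0"
  by (induction m) simp_all

lemma matrix_simps [simp]:
  "matrix m n M \<in> Arr T \<and> Dom T (matrix m n M) = m \<and> Cod T (matrix m n M) = n"
  by (induction n) simp_all

lemma cohom_scalar [simp]: "cohom (scalar k)"
  by (induction k) simp_all

lemma cohom_row [simp]: "cohom (row m r)"
  by (induction m) simp_all

lemma cohom_matrix [simp]: "cohom (matrix m n M)"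
  by (induction n) simp_all

lemma row_cong: "(\<And>j. j < m \<Longrightarrow> r j = s j) \<Longrightarrow> row m r = row m s"
  by (induction m) simp_all

text \<open>Coefficients are total functions on the naturals, so equalities of matrices are
  available only within range and are used through this rule.\<close>

lemma matrix_cong: "(\<And>i j. \<lbrakk>i < n; j < m\<rbrakk> \<Longrightarrow> M i j = N i j) \<Longrightarrow> matrix m n M = matrix m n N"
proof (induction n)
  case (Suc n)
  then show ?case using row_cong[of m "M n" "N n"] by simp
qed simp

lemma mul_left_comp:
  "\<lbrakk>f \<in> Arr T; g \<in> Arr T; Cod T f = 0; Cod T g = 1\<rbrakk> \<Longrightarrow> \<mu> \<cdot> ((\<eta> \<cdot> f) \<otimes> g) = f \<otimes> g"
proof -
  assume f: "f \<in> Arr T" "g \<in> Arr T" "Cod T f = 0" "Cod T g = 1"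
  then have "\<mu> \<cdot> ((\<eta> \<cdot> f) \<otimes> g) = (\<mu> \<cdot> (\<eta> \<otimes> I (Suc 0))) \<cdot> (f \<otimes> g)" by simp
  with f show ?thesis by (simp add: strict_mul_axioms)
qed

lemma mul_right_comp:
  "\<lbrakk>f \<in> Arr T; g \<in> Arr T; Cod T f = 1; Cod T g = 0\<rbrakk> \<Longrightarrow> \<mu> \<cdot> (f \<otimes> (\<eta> \<cdot> g)) = f \<otimes> g"
proof -
  assume f: "f \<in> Arr T" "g \<in> Arr T" "Cod T f = 1" "Cod T g = 0"
  then have "\<mu> \<cdot> (f \<otimes> (\<eta> \<cdot> g)) = (\<mu> \<cdot> (I (Suc 0) \<otimes> \<eta>)) \<cdot> (f \<otimes> g)" by simp
  with f show ?thesis by (simp add: strict_mul_axioms)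
qed

lemma mul_assoc_comp:
  "\<lbrakk>f \<in> Arr T; g \<in> Arr T; h \<in> Arr T; Cod T f = 1; Cod T g = 1; Cod T h = 1\<rbrakk> \<Longrightarrow>
    \<mu> \<cdot> ((\<mu> \<cdot> (f \<otimes> g)) \<otimes> h) = \<mu> \<cdot> (f \<otimes> (\<mu> \<cdot> (g \<otimes> h)))"
proof -
  assume *: "f \<in> Arr T" "g \<in> Arr T" "h \<in> Arr T" "Cod T f = 1" "Cod T g = 1" "Cod T h = 1"
  then have "\<mu> \<cdot> ((\<mu> \<cdot> (f \<otimes> g)) \<otimes> h) = (\<mu> \<cdot> (\<mu> \<otimes> I (Suc 0))) \<cdot> ((f \<otimes> g) \<otimes> h)"
    by (simp del: tens_arr_assoc)
  also have "\<dots> = \<mu> \<cdot> (f \<otimes> (\<mu> \<cdot> (g \<otimes> h)))"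
    using * by (simp add: strict_mul_axioms)
  finally show ?thesis .
qed

lemma scalar_one: "scalar (Suc 0) = I (Suc 0)"
  using comp_reduce[OF mul_left_comp[of \<epsilon> "I (Suc 0)"], of \<Delta>] by (simp add: strict_comul_axioms)

text \<open>The distributive law in the scalar: coassociativity and associativity regroup the copies
  and the summands in parallel.\<close>

lemma scalar_add: "scalar (k + l) = \<mu> \<cdot> (scalar k \<otimes> scalar l) \<cdot> \<Delta>"
proof (induction l)
  case 0
  have "\<mu> \<cdot> (scalar k \<otimes> scalar 0) \<cdot> \<Delta> = (\<mu> \<cdot> (scalar k \<otimes> (\<eta> \<cdot> \<epsilon>))) \<cdot> \<Delta>"
    by simp
  also have "\<dots> = (scalar k \<otimes> \<epsilon>) \<cdot> \<Delta>"
    by (subst mul_right_comp) simp_all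
  also have "\<dots> = (scalar k \<otimes> I 0) \<cdot> (I (Suc 0) \<otimes> \<epsilon>) \<cdot> \<Delta>"
    by (simp del: tens_unit)
  finally show ?case by (simp add: strict_comul_axioms)
next
  case (Suc l)
  let ?k = "scalar k" and ?l = "scalar l" and ?i = "I (Suc 0)"
  have "\<mu> \<cdot> (?k \<otimes> scalar (Suc l)) \<cdot> \<Delta> = (\<mu> \<cdot> (?k \<otimes> (\<mu> \<cdot> (?l \<otimes> ?i)))) \<cdot> (?i \<otimes> \<Delta>) \<cdot> \<Delta>"
    by simp
  also have "\<dots> = (\<mu> \<cdot> ((\<mu> \<cdot> (?k \<otimes> ?l)) \<otimes> ?i)) \<cdot> (\<Delta> \<otimes> ?i) \<cdot> \<Delta>"
    by (simp add: mul_assoc_comp strict_comul_axioms)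
  also have "\<dots> = scalar (k + Suc l)"
    by (simp add: Suc)
  finally show ?case by simp
qed

lemma row_zero: "row m (\<lambda>j. 0) = \<eta> \<cdot> del m"
proof (induction m)
  case (Suc m)
  then show ?case
    using mul_left_comp[of "del m" "\<eta> \<cdot> \<epsilon>"] tens_merge[of "del m" "I 0" \<epsilon> \<eta>] by simp
qed simp

text \<open>The dual of the argument for \<open>\<Delta>\<close>: in a fourfold sum the middle two
  terms can be added first, and commutativity exchanges them.\<close>

lemma mul_mul_mid: "\<mu> \<cdot> (\<mu> \<otimes> \<mu>) \<cdot> mid 1 1 1 1 = \<mu> \<cdot> (\<mu> \<otimes> \<mu>)"
proof -
  let ?i = "I (Suc 0)"
  have *: "\<mu> \<cdot> (\<mu> \<otimes> \<mu>) = \<mu> \<cdot> (?i \<otimes> \<mu>) \<cdot> (?i \<otimes> \<mu> \<otimes> ?i)"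
    using mul_assoc_comp[of ?i ?i \<mu>] by (simp add: strict_mul_axioms)
  have "(\<mu> \<cdot> (\<mu> \<otimes> \<mu>)) \<cdot> mid 1 1 1 1 = \<mu> \<cdot> (?i \<otimes> \<mu>) \<cdot> (?i \<otimes> \<mu> \<otimes> ?i)"
    unfolding * by (simp add: mid_def strict_mul_axioms(4))
  then show ?thesis unfolding *[symmetric] by simp
qed

text \<open>Commutativity of \<open>\<mu>\<close> separates the last input from the others: a sum of
  two sums is regrouped input by input, and \<open>scalar_add\<close> treats the last one.\<close>

lemma row_add: "row m (\<lambda>j. r j + s j) = \<mu> \<cdot> (row m r \<otimes> row m s) \<cdot> copy m"
proof (induction m)
  case 0
  then show ?case using mul_left_comp[of "I 0" \<eta>] by simp
next
  case (Suc m)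
  let ?R = "row m r" and ?S = "row m s" and ?p = "scalar (r m)" and ?q = "scalar (s m)"
  have "\<mu> \<cdot> (row (Suc m) r \<otimes> row (Suc m) s) \<cdot> copy (Suc m) =
      \<mu> \<cdot> (\<mu> \<otimes> \<mu>) \<cdot> (?R \<otimes> ?p \<otimes> ?S \<otimes> ?q) \<cdot> copy (m + 1)"
  proof -
    have "?R \<otimes> ?p \<otimes> ?S \<otimes> ?q = (?R \<otimes> ?p) \<otimes> (?S \<otimes> ?q)" by simp
    then show ?thesis by (simp del: tens_arr_assoc copy.simps)
  qed
  also have "\<dots> = \<mu> \<cdot> (\<mu> \<otimes> \<mu>) \<cdot> mid 1 1 1 1 \<cdot> (((?R \<otimes> ?S) \<cdot> copy m) \<otimes> ((?p \<otimes> ?q) \<cdot> \<Delta>))"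
    by (subst copy_natural_tens) (simp_all del: copy.simps add: copy_one)
  also have "\<dots> = (\<mu> \<cdot> (\<mu> \<otimes> \<mu>) \<cdot> mid 1 1 1 1) \<cdot> (((?R \<otimes> ?S) \<cdot> copy m) \<otimes> ((?p \<otimes> ?q) \<cdot> \<Delta>))"
    by simp
  also have "\<dots> = (\<mu> \<cdot> (\<mu> \<otimes> \<mu>)) \<cdot> (((?R \<otimes> ?S) \<cdot> copy m) \<otimes> ((?p \<otimes> ?q) \<cdot> \<Delta>))"
    by (simp only: mul_mul_mid)
  also have "\<dots> = row (Suc m) (\<lambda>j. r j + s j)"
    by (simp add: Suc scalar_add)
  finally show ?case by simp
qed

text \<open>A scalar duplicates the value of the row. As the row is a comonoid homomorphism, its
  inputs can be duplicated instead, and \<open>row_add\<close> applies.\<close>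

lemma scalar_row: "scalar k \<cdot> row m r = row m (\<lambda>j. k * r j)"
proof (induction k)
  case 0
  have "\<epsilon> \<cdot> row m r = del m" using cohomD(3)[OF cohom_row[of m r]] by simp
  then show ?case by (simp add: row_zero)
next
  case (Suc k)
  have *: "\<Delta> \<cdot> row m r = (row m r \<otimes> row m r) \<cdot> copy m"
    using cohomD(2)[OF cohom_row[of m r]] by (simp del: copy.simps add: copy_one)
  show ?case using row_add[of m "\<lambda>j. k * r j" r] by (simp add: * Suc add.commute)
qed

text \<open>The last row of the matrix enters the sum with the last coefficient of the form, so each
  induction step is one use of \<open>scalar_row\<close> and one of \<open>row_add\<close>.\<close>

lemma row_matrix: "row n s \<cdot> matrix m n M = row m (\<lambda>j. \<Sum>i<n. s i * M i j)"
proof (induction n)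
  case 0
  then show ?case by (simp add: row_zero)
next
  case (Suc n)
  then show ?case by (simp add: scalar_row row_add)
qed

text \<open>Since \<open>matrix m n M\<close> is a comonoid homomorphism, it can be moved through
  the duplication that builds a tuple. Composition thus proceeds row by row.\<close>

lemma matrix_comp: "matrix n p N \<cdot> matrix m n M = matrix m p (\<lambda>i j. \<Sum>k<n. N i k * M k j)"
proof (induction p)
  case 0
  show ?case using cohomD(3)[OF cohom_matrix[of m n M]] by simp
next
  case (Suc p)
  then show ?case using cohomD(2)[OF cohom_matrix[of m n M]] by (simp add: row_matrix)
qed

section \<open>Block matrices, identities and symmetries\<close>

lemma row_append: "row (m + m') r = \<mu> \<cdot> (row m r \<otimes> row m' (\<lambda>j. r (m + j)))"
proof (induction m')
  case 0
  show ?case using mul_right_comp[of "row m r" "I 0"] by simp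
next
  case (Suc m')
  then show ?case by (simp add: mul_assoc_comp)
qed

text \<open>Inputs with coefficient zero contribute a constant unit, which the unit law of
  \<open>\<mu>\<close> absorbs, so they are merely discarded.\<close>

lemma row_pad_right: "row (m + m') (\<lambda>j. if j < m then r j else 0) = row m r \<otimes> del m'"
proof -
  have "row m (\<lambda>j. if j < m then r j else 0) = row m r" by (rule row_cong) simp
  then show ?thesis by (simp add: row_append row_zero mul_right_comp)
qed

lemma row_pad_left: "row (m + m') (\<lambda>j. if j < m then 0 else r (j - m)) = del m \<otimes> row m' r"
proof -
  have "row m (\<lambda>j. if j < m then 0 else r (j - m)) = row m (\<lambda>j. 0)" by (rule row_cong) simp
  then show ?thesis by (simp add: row_append row_zero mul_left_comp)
qed

lemma del_del: "(del n \<otimes> del n) \<cdot> copy n = del n"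
  using cohomD(2)[OF cohom_del[of n]] by simp

lemma del_copy_right: "\<lbrakk>f \<in> Arr T; Dom T f = n\<rbrakk> \<Longrightarrow> (f \<otimes> del n) \<cdot> copy n = f"
  using tens_merge_comp[of "I n" f "del n" "I 0" "copy n"] by (simp add: counit_right)

lemma del_copy_left: "\<lbrakk>f \<in> Arr T; Dom T f = n\<rbrakk> \<Longrightarrow> (del n \<otimes> f) \<cdot> copy n = f"
  using tens_merge_comp[of "del n" "I 0" "I n" f "copy n"] by (simp add: counit_left)

lemma matrix_pad_right:
  "matrix (m + m') n (\<lambda>i j. if j < m then M i j else 0) = matrix m n M \<otimes> del m'"
proof (induction n)
  case (Suc n)
  then show ?case
    by (simp add: row_pad_right copy_natural_tens del_del)
qed (simp add: del_add)

lemma matrix_pad_left: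
  "matrix (m + m') n (\<lambda>i j. if j < m then 0 else M i (j - m)) = del m \<otimes> matrix m' n M"
proof (induction n)
  case (Suc n)
  then show ?case
    by (simp add: row_pad_left copy_natural_tens del_del)
qed (simp add: del_add)

text \<open>Split off the last row: the earlier rows discard the last input, the last row keeps only
  that one, and the counit laws recombine the two parts.\<close>

lemma matrix_ident: "matrix n n (\<lambda>i j. if i = j then 1 else 0) = I n"
proof (induction n)
  case (Suc n)
  have 1: "matrix (n + 1) n (\<lambda>i j. if i = j then 1 else 0) = I n \<otimes> \<epsilon>"
    unfolding Suc[symmetric] del_one[symmetric] One_nat_def[symmetric] matrix_pad_right[symmetric]
    by (rule matrix_cong) simp
  have "row (n + 1) (\<lambda>j. if n = j then 1 else 0) = del n \<otimes> row 1 (\<lambda>j. 1)"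
    unfolding row_pad_left[symmetric] by (rule row_cong) simp
  also have "row 1 (\<lambda>j. 1) = I 1"
    using mul_left_comp[of "I 0" "scalar 1"] scalar_one by simp
  finally have 2: "row (n + 1) (\<lambda>j. if n = j then 1 else 0) = del n \<otimes> I 1" .
  have "matrix (Suc n) (Suc n) (\<lambda>i j. if i = j then 1 else 0) =
      (I n \<otimes> \<epsilon> \<otimes> del n \<otimes> I 1) \<cdot> copy (n + 1)"
    using 1 2 by (simp del: copy.simps row.simps)
  also have "\<dots> = I (Suc n)"
    by (subst copy_natural_tens) (simp_all add: counit_right strict_comul_axioms)
  finally show ?case .
qed simp

text \<open>Induction on the rows of \<open>N\<close>. With none left, the rows of \<open>M\<close>
  discard the second block of inputs; each further row discards the first block.\<close>

lemma matrix_tens: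
  "matrix (m + m') (n + n') (\<lambda>i j. if i < n then if j < m then M i j else 0
     else if j < m then 0 else N (i - n) (j - m)) = matrix m n M \<otimes> matrix m' n' N"
proof (induction n')
  case 0
  show ?case
    unfolding matrix.simps matrix_pad_right[symmetric] add_0_right by (rule matrix_cong) simp
next
  case (Suc n')
  then show ?case
    by (simp add: row_pad_left copy_natural_tens del_copy_right)
qed

text \<open>Both sides are comonoid homomorphisms into \<open>n + m\<close>, so by uniqueness of
  pairings it suffices to compare projections. Those of the matrix come from matrix multiplication,
  those of the symmetry from naturality.\<close>

lemma matrix_symm:
  "matrix (m + n) (n + m) (\<lambda>i j. if i = (if j < m then n + j else j - m) then 1 else 0) = Symm T m n"
  (is "?M = _")
proof -
  let ?\<delta> = "\<lambda>i j. if i = j then 1 else (0::nat)"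
  have p: "I n \<otimes> del m = matrix (n + m) n (\<lambda>i j. if j < n then ?\<delta> i j else 0)"
    unfolding matrix_pad_right[of n m n ?\<delta>] by (simp add: matrix_ident)
  have q: "del n \<otimes> I m = matrix (n + m) m (\<lambda>i j. if j < n then 0 else ?\<delta> i (j - n))"
    unfolding matrix_pad_left[of n m m ?\<delta>] by (simp add: matrix_ident)
  have "(I n \<otimes> del m) \<cdot> ?M = matrix (m + n) n (\<lambda>i j. if j < m then 0 else ?\<delta> i (j - m))"
    unfolding p matrix_comp
  proof (rule matrix_cong, goal_cases)
    case (1 i j)
    have "(\<Sum>k<n + m. (if k < n then ?\<delta> i k else 0) * (if k = (if j < m then n + j else j - m) then 1 else 0)) =
        (\<Sum>k<n + m. if i = k then (if j < m then 0 else ?\<delta> i (j - m)) else 0)"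
      by (rule sum.cong) (use 1 in auto)
    also have "\<dots> = (if j < m then 0 else ?\<delta> i (j - m))"
      using 1 by simp
    finally show ?case .
  qed
  then have p': "(I n \<otimes> del m) \<cdot> ?M = del m \<otimes> I n"
    unfolding matrix_pad_left[of m n n ?\<delta>] matrix_ident .
  have "(del n \<otimes> I m) \<cdot> ?M = matrix (m + n) m (\<lambda>i j. if j < m then ?\<delta> i j else 0)"
    unfolding q matrix_comp
  proof (rule matrix_cong, goal_cases)
    case (1 i j)
    \<comment> \<open>Row \<open>i\<close> of this projection has its only nonzero entry in column
      \<open>n + i\<close>, which is the only candidate for a nonzero term.\<close>
    have "(\<Sum>k<n + m. (if k < n then 0 else ?\<delta> i (k - n)) * (if k = (if j < m then n + j else j - m) then 1 else 0)) =
        (\<Sum>k<n + m. if n + i = k then (if j < m then ?\<delta> i j else 0) else 0)"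
      by (rule sum.cong) (use 1 in auto)
    also have "\<dots> = (if j < m then ?\<delta> i j else 0)"
      using 1 by simp
    finally show ?case .
  qed
  then have q': "(del n \<otimes> I m) \<cdot> ?M = I m \<otimes> del n"
    unfolding matrix_pad_right[of m n m ?\<delta>] matrix_ident .
  note p' q'
  moreover have "(I n \<otimes> del m) \<cdot> Symm T m n = del m \<otimes> I n"
    using symm_nat[of "del m" "I n" 0 n] by simp
  moreover have "(del n \<otimes> I m) \<cdot> Symm T m n = I m \<otimes> del n"
    using symm_nat[of "I m" "del n" m 0] by simp
  ultimately show ?thesis
    using cohom_pair[of ?M n m] cohom_pair[of "Symm T m n" n m] by simp
qed

end

section \<open>Spans as matrices\<close>

definition span_matrix :: "'s span \<Rightarrow> nat \<Rightarrow> nat \<Rightarrow> nat" where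
  "span_matrix = (\<lambda>(S, f, g) i j. card {s \<in> S. f s = j \<and> g s = i})"

text \<open>The class is cut out by its counts instead of being generated by a chosen span, so it
  depends on no choice; that it is inhabited is a separate fact. Entries of \<open>M\<close> out of
  range have no influence.\<close>

definition matrix_arrow :: "nat \<Rightarrow> nat \<Rightarrow> (nat \<Rightarrow> nat \<Rightarrow> nat) \<Rightarrow> nat \<times> nat \<times> nat span set" where
  "matrix_arrow m n M =
     (m, n, {Y. is_span m n Y \<and> (\<forall>i<n. \<forall>j<m. span_matrix Y i j = M i j)})"

lemma span_iso_is_span:
  assumes "span_iso X Y" "is_span m n X"
  shows "is_span m n Y"
proof -
  obtain S f g T h k where [simp]: "X = (S, f, g)" "Y = (T, h, k)" by (cases X, cases Y) auto
  obtain b where b: "bij_betw b S T" "\<And>s. s \<in> S \<Longrightarrow> h (b s) = f s" "\<And>s. s \<in> S \<Longrightarrow> k (b s) = g s"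
    using assms(1) by (auto simp: span_iso_def)
  have "finite T" using b(1) assms(2) by (auto simp: is_span_def dest: bij_betw_finite)
  moreover have "T = b ` S" using b(1) by (simp add: bij_betw_def)
  ultimately show ?thesis using assms(2) b by (auto simp: is_span_def)
qed

lemma span_iso_matrix:
  assumes "span_iso X Y"
  shows "span_matrix Y = span_matrix X"
proof (intro ext)
  fix i j
  obtain S f g T h k where [simp]: "X = (S, f, g)" "Y = (T, h, k)" by (cases X, cases Y) auto
  obtain b where b: "bij_betw b S T" "\<And>s. s \<in> S \<Longrightarrow> h (b s) = f s" "\<And>s. s \<in> S \<Longrightarrow> k (b s) = g s"
    using assms by (auto simp: span_iso_def)
  have "bij_betw b {s \<in> S. f s = j \<and> g s = i} {t \<in> T. h t = j \<and> k t = i}"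
    using b unfolding bij_betw_def by (auto simp: inj_on_def)
  then show "span_matrix Y i j = span_matrix X i j"
    by (simp add: span_matrix_def bij_betw_same_card)
qed

text \<open>Bijections between corresponding fibres glue to an isomorphism of spans.\<close>

lemma span_isoI:
  assumes X: "is_span m n X" and Y: "is_span m n Y"
    and eq: "\<And>i j. \<lbrakk>i < n; j < m\<rbrakk> \<Longrightarrow> span_matrix Y i j = span_matrix X i j"
  shows "span_iso X Y"
proof -
  obtain S f g T h k where XY: "X = (S, f, g)" "Y = (T, h, k)" by (cases X, cases Y) auto
  define A where "A i j = {s \<in> S. f s = j \<and> g s = i}" for i j
  define B where "B i j = {t \<in> T. h t = j \<and> k t = i}" for i j
  have "\<exists>b. bij_betw b (A i j) (B i j)" if "i < n" "j < m" for i j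
    using eq[OF that] X Y by (intro finite_same_card_bij) (auto simp: XY A_def B_def span_matrix_def is_span_def)
  then obtain b where b: "\<And>i j. \<lbrakk>i < n; j < m\<rbrakk> \<Longrightarrow> bij_betw (b i j) (A i j) (B i j)"
    by metis
  define c where "c s = b (g s) (f s) s" for s
  have in_A: "s \<in> A (g s) (f s)" "g s < n" "f s < m" if "s \<in> S" for s
    using that X by (auto simp: A_def XY is_span_def)
  have in_B: "t \<in> B (k t) (h t)" "k t < n" "h t < m" if "t \<in> T" for t
    using that Y by (auto simp: B_def XY is_span_def)
  have c: "c s \<in> T" "h (c s) = f s" "k (c s) = g s" if "s \<in> S" for s
    using bij_betw_apply[OF b in_A(1)[OF that]] in_A[OF that] by (auto simp: c_def B_def)
  have "inj_on c S"
  proof (rule inj_onI)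
    fix s s' assume s: "s \<in> S" "s' \<in> S" and "c s = c s'"
    then have "f s = f s'" "g s = g s'" using c[OF s(1)] c[OF s(2)] by auto
    with \<open>c s = c s'\<close> show "s = s'"
      using b[of "g s" "f s"] in_A[OF s(1)] in_A[OF s(2)] by (auto simp: c_def bij_betw_def inj_on_def)
  qed
  moreover have "T \<subseteq> c ` S"
  proof
    fix t assume t: "t \<in> T"
    then obtain s where s: "s \<in> A (k t) (h t)" "t = b (k t) (h t) s"
      using b[of "k t" "h t"] in_B[OF t] by (auto simp: bij_betw_def)
    then have "s \<in> S" "t = c s" by (auto simp: A_def c_def)
    then show "t \<in> c ` S" by blast
  qed
  ultimately have "bij_betw c S T" using c by (auto simp: bij_betw_def)
  with c show ?thesis unfolding span_iso_def XY by auto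
qed

text \<open>The fibre counts are a complete isomorphism invariant. The apex type of \<open>X\<close>
  is arbitrary, as pullbacks and sums have apexes of pairs and of tagged elements.\<close>

lemma span_class_matrix_arrow:
  assumes "is_span m n X"
  shows "(m, n, span_class X) = matrix_arrow m n (span_matrix X)"
proof -
  have "span_iso X Y \<longleftrightarrow> is_span m n Y \<and> (\<forall>i<n. \<forall>j<m. span_matrix Y i j = span_matrix X i j)"
    for Y :: "nat span"
    using span_isoI[OF assms, of Y] span_iso_is_span[OF _ assms, of Y] span_iso_matrix[of X Y]
    by auto
  then show ?thesis unfolding span_class_def matrix_arrow_def by auto
qed

text \<open>A finite apex is transported along an enumeration to an initial segment of the
  naturals.\<close>

lemma span_class_nonempty:
  assumes "is_span m n X"
  shows "span_class X \<noteq> {}"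
proof -
  obtain S f g where X: "X = (S, f, g)" by (cases X)
  with assms have "finite S" by (simp add: is_span_def)
  then obtain b where b: "bij_betw b S {0..<card S}" using ex_bij_betw_finite_nat by blast
  then have "span_iso X ({0..<card S}, f \<circ> inv_into S b, g \<circ> inv_into S b)"
    by (auto simp: span_iso_def X bij_betw_inv_into_left intro!: exI[of _ b])
  then show ?thesis by (auto simp: span_class_def)
qed

lemma matrix_arrow_cong:
  "(\<And>i j. \<lbrakk>i < n; j < m\<rbrakk> \<Longrightarrow> M i j = N i j) \<Longrightarrow> matrix_arrow m n M = matrix_arrow m n N"
  by (auto simp: matrix_arrow_def)

lemma matrix_arrow_representative:
  "\<exists>Y :: nat span. is_span m n Y \<and> matrix_arrow m n M = (m, n, span_class Y) \<and>
     (\<forall>i<n. \<forall>j<m. span_matrix Y i j = M i j)"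
proof -
  \<comment> \<open>Over the entry \<open>(i, j)\<close> lie \<open>M i j\<close> points; the second
    component merely tells them apart.\<close>
  define S where "S = (SIGMA p:{..<n} \<times> {..<m}. {..<M (fst p) (snd p)})"
  define X :: "((nat \<times> nat) \<times> nat) span" where "X = (S, \<lambda>s. snd (fst s), \<lambda>s. fst (fst s))"
  have X: "is_span m n X" by (auto simp: is_span_def X_def S_def)
  have M: "span_matrix X i j = M i j" if "i < n" "j < m" for i j
  proof -
    have "{s \<in> S. snd (fst s) = j \<and> fst (fst s) = i} = {(i, j)} \<times> {..<M i j}"
      using that by (auto simp: S_def)
    then show ?thesis by (simp add: span_matrix_def X_def card_cartesian_product)
  qed
  obtain Y :: "nat span" where "span_iso X Y" using span_class_nonempty[OF X] by (auto simp: span_class_def)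
  then have Y: "is_span m n Y" "span_matrix Y = span_matrix X"
    using span_iso_is_span[OF _ X] span_iso_matrix by blast+
  moreover have "matrix_arrow m n M = (m, n, span_class Y)"
    unfolding span_class_matrix_arrow[OF Y(1)] Y(2) by (rule matrix_arrow_cong) (simp add: M)
  ultimately show ?thesis using M by metis
qed

lemma matrix_arrow_class_nonempty: "snd (snd (matrix_arrow m n M)) \<noteq> {}"
proof -
  obtain Y :: "nat span" where "is_span m n Y" "\<forall>i<n. \<forall>j<m. span_matrix Y i j = M i j"
    using matrix_arrow_representative[of m n M] by blast
  then have "Y \<in> snd (snd (matrix_arrow m n M))" by (simp add: matrix_arrow_def)
  then show ?thesis by blast
qed

text \<open>A representative of the common class has both matrices as its fibre counts.\<close>

lemma matrix_arrow_eq_iff: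
  "matrix_arrow m n M = matrix_arrow m' n' N \<longleftrightarrow>
     m = m' \<and> n = n' \<and> (\<forall>i<n. \<forall>j<m. M i j = N i j)" (is "?L \<longleftrightarrow> ?R")
proof
  assume ?L
  then have mn: "m = m'" "n = n'" by (auto simp: matrix_arrow_def)
  obtain Y :: "nat span" where Y: "is_span m n Y" "\<forall>i<n. \<forall>j<m. span_matrix Y i j = M i j"
    using matrix_arrow_representative[of m n M] by blast
  then have "Y \<in> snd (snd (matrix_arrow m n M))" by (simp add: matrix_arrow_def)
  then have "Y \<in> snd (snd (matrix_arrow m n N))" using \<open>?L\<close> mn by simp
  then have "\<forall>i<n. \<forall>j<m. span_matrix Y i j = N i j" by (simp add: matrix_arrow_def)
  with Y mn show ?R by simp
qed (auto simp: matrix_arrow_def)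

lemma span_pullback_matrix:
  assumes X: "is_span m n X" and Y: "is_span n p Y"
  shows "is_span m p (span_pullback X Y)"
    "span_matrix (span_pullback X Y) i j = (\<Sum>k<n. span_matrix Y i k * span_matrix X k j)"
proof -
  obtain S f g T h l where XY: "X = (S, f, g)" "Y = (T, h, l)" by (cases X, cases Y) auto
  have fin: "finite S" "finite T" using X Y by (auto simp: is_span_def XY)
  have "finite {(s, t). s \<in> S \<and> t \<in> T \<and> g s = h t}"
    by (rule finite_subset[of _ "S \<times> T"]) (use fin in auto)
  then show "is_span m p (span_pullback X Y)"
    using X Y by (auto simp: is_span_def XY span_pullback_def)
  define A where "A k = {t \<in> T. h t = k \<and> l t = i}" for k
  define B where "B k = {s \<in> S. f s = j \<and> g s = k}" for k
  \<comment> \<open>A fibre of the pullback splits over the middle point \<open>k\<close> into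
    products of fibres; counting these gives the matrix product.\<close>
  have "{st \<in> {(s, t). s \<in> S \<and> t \<in> T \<and> g s = h t}.
      (case st of (s, t) \<Rightarrow> f s) = j \<and> (case st of (s, t) \<Rightarrow> l t) = i} = (\<Union>k<n. B k \<times> A k)"
    using X Y by (auto simp: is_span_def XY A_def B_def)
  then have "span_matrix (span_pullback X Y) i j = card (\<Union>k<n. B k \<times> A k)"
    by (simp add: span_matrix_def span_pullback_def XY)
  also have "\<dots> = (\<Sum>k<n. card (B k \<times> A k))"
    by (rule card_UN_disjoint) (use fin in \<open>auto simp: A_def B_def\<close>)
  finally show "span_matrix (span_pullback X Y) i j = (\<Sum>k<n. span_matrix Y i k * span_matrix X k j)"
    by (simp add: A_def B_def span_matrix_def XY card_cartesian_product mult.commute)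
qed

definition block_sum ::
  "nat \<Rightarrow> nat \<Rightarrow> (nat \<Rightarrow> nat \<Rightarrow> nat) \<Rightarrow> (nat \<Rightarrow> nat \<Rightarrow> nat) \<Rightarrow> nat \<Rightarrow> nat \<Rightarrow> nat" where
  "block_sum m n M N i j = (if i < n then if j < m then M i j else 0
     else if j < m then 0 else N (i - n) (j - m))"

lemma span_sum_matrix:
  assumes X: "is_span m n X" and Y: "is_span m' n' Y"
  shows "is_span (m + m') (n + n') (span_sum m n X Y)"
    "span_matrix (span_sum m n X Y) i j = block_sum m n (span_matrix X) (span_matrix Y) i j"
proof -
  obtain S f g T h l where XY: "X = (S, f, g)" "Y = (T, h, l)" by (cases X, cases Y) auto
  show "is_span (m + m') (n + n') (span_sum m n X Y)"
    using X Y by (auto simp: is_span_def XY span_sum_def Pi_def split: sum.split)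
  have "{s \<in> S <+> T. case_sum f (\<lambda>t. m + h t) s = j \<and> case_sum g (\<lambda>t. n + l t) s = i} =
      (if i < n then if j < m then Inl ` {s \<in> S. f s = j \<and> g s = i} else {}
       else if j < m then {} else Inr ` {t \<in> T. h t = j - m \<and> l t = i - n})"
    using X Y by (auto simp: is_span_def XY Pi_def)
  then show "span_matrix (span_sum m n X Y) i j = block_sum m n (span_matrix X) (span_matrix Y) i j"
    by (simp add: span_matrix_def span_sum_def XY block_sum_def card_image)
qed

abbreviation matrix_mult :: "nat \<Rightarrow> (nat \<Rightarrow> nat \<Rightarrow> nat) \<Rightarrow> (nat \<Rightarrow> nat \<Rightarrow> nat) \<Rightarrow> nat \<Rightarrow> nat \<Rightarrow> nat" where
  "matrix_mult n N M \<equiv> (\<lambda>i j. \<Sum>k<n. N i k * M k j)"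

text \<open>The matrix of the graph of \<open>p\<close>. The structural arrows of
  \<open>FinSpan\<close> are spans whose left leg is an identity, so they all have this
  form.\<close>

definition fun_matrix :: "(nat \<Rightarrow> nat) \<Rightarrow> nat \<Rightarrow> nat \<Rightarrow> nat" where
  "fun_matrix p i j = (if i = p j then 1 else 0)"

lemma fun_span_matrix:
  assumes "p \<in> {..<m} \<rightarrow> {..<n}"
  shows "(m, n, span_class ({..<m}, \<lambda>i. i, p)) = matrix_arrow m n (fun_matrix p)"
proof -
  have "span_matrix ({..<m}, \<lambda>i. i, p) i j = fun_matrix p i j" if "j < m" for i j
  proof -
    have "{s \<in> {..<m}. s = j \<and> p s = i} = (if i = p j then {j} else {})" using that by auto
    then show ?thesis by (simp add: span_matrix_def fun_matrix_def)
  qed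
  then show ?thesis
    using assms by (subst span_class_matrix_arrow) (auto simp: is_span_def intro: matrix_arrow_cong)
qed

abbreviation symm_fun :: "nat \<Rightarrow> nat \<Rightarrow> nat \<Rightarrow> nat" where
  "symm_fun m n \<equiv> (\<lambda>i. if i < m then n + i else i - m)"

section \<open>The operations of \<open>FinSpan\<close> in terms of matrices\<close>

lemma FinSpan_Obj [simp]: "Obj FinSpan = UNIV"
  and FinSpan_TensO [simp]: "m \<odot>\<^bsub>FinSpan\<^esub> n = m + n"
  and FinSpan_MUnit [simp]: "MUnit FinSpan = 0"
  by (simp_all add: FinSpan_def)

lemma FinSpan_Arr: "Arr FinSpan = {matrix_arrow m n M | m n M. True}"
proof -
  have *: "Arr FinSpan = {(m, n, span_class X) | m n (X :: nat span). is_span m n X}"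
    by (simp add: FinSpan_def)
  show ?thesis
    unfolding * using span_class_matrix_arrow matrix_arrow_representative by blast
qed

lemma matrix_arrow_simps [simp]:
  "matrix_arrow m n M \<in> Arr FinSpan"
  "Dom FinSpan (matrix_arrow m n M) = m" "Cod FinSpan (matrix_arrow m n M) = n"
  unfolding FinSpan_Arr by (auto simp: FinSpan_def matrix_arrow_def)

lemma FinSpan_HomE:
  assumes "f \<in> Hom FinSpan m n"
  obtains M where "f = matrix_arrow m n M"
  using assms unfolding Hom_def FinSpan_Arr by auto

lemma matrix_arrow_Hom [simp]: "matrix_arrow m n M \<in> Hom FinSpan m n"
  by (simp add: Hom_def)

lemma FinSpan_Ident: "Ident FinSpan n = matrix_arrow n n (fun_matrix (\<lambda>i. i))"
  by (simp add: FinSpan_def fun_span_matrix)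

lemma FinSpan_Symm: "Symm FinSpan m n = matrix_arrow (m + n) (n + m) (fun_matrix (symm_fun m n))"
  by (subst fun_span_matrix[symmetric]) (auto simp: FinSpan_def)

lemma FinSpan_structural [simp]:
  "Assoc FinSpan m n p = Ident FinSpan (m + n + p)"
  "LUnit FinSpan m = Ident FinSpan m" "RUnit FinSpan m = Ident FinSpan m"
  by (simp_all add: FinSpan_def)

text \<open>All pairs of representatives give the same class, so the union in the definition
  collapses; for this both classes have to be inhabited.\<close>

lemma FinSpan_Comp:
  "matrix_arrow n p N \<cdot>\<^bsub>FinSpan\<^esub> matrix_arrow m n M = matrix_arrow m p (matrix_mult n N M)"
proof -
  let ?P = "snd (snd (matrix_arrow m n M))" and ?Q = "snd (snd (matrix_arrow n p N))"
  let ?R = "snd (snd (matrix_arrow m p (matrix_mult n N M)))"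
  have "span_class (span_pullback X Y) = ?R" if "X \<in> ?P" "Y \<in> ?Q" for X Y
  proof -
    from that have X: "is_span m n X" "\<And>i j. \<lbrakk>i < n; j < m\<rbrakk> \<Longrightarrow> span_matrix X i j = M i j"
      and Y: "is_span n p Y" "\<And>i j. \<lbrakk>i < p; j < n\<rbrakk> \<Longrightarrow> span_matrix Y i j = N i j"
      by (auto simp: matrix_arrow_def)
    have "(m, p, span_class (span_pullback X Y)) = matrix_arrow m p (matrix_mult n N M)"
      using X Y by (subst span_class_matrix_arrow[OF span_pullback_matrix(1)])
        (auto simp: span_pullback_matrix(2)[OF X(1) Y(1)] intro!: matrix_arrow_cong)
    from arg_cong[OF this, of "\<lambda>x. snd (snd x)"] show ?thesis by simp
  qed
  moreover have "?P \<noteq> {}" "?Q \<noteq> {}"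
    by (rule matrix_arrow_class_nonempty)+
  ultimately have "(\<Union>X\<in>?P. \<Union>Y\<in>?Q. span_class (span_pullback X Y)) = ?R" by auto
  then show ?thesis by (simp add: FinSpan_def matrix_arrow_def)
qed

lemma FinSpan_TensA:
  "matrix_arrow m n M \<otimes>\<^bsub>FinSpan\<^esub> matrix_arrow m' n' N =
     matrix_arrow (m + m') (n + n') (block_sum m n M N)"
proof -
  let ?P = "snd (snd (matrix_arrow m n M))" and ?Q = "snd (snd (matrix_arrow m' n' N))"
  let ?R = "snd (snd (matrix_arrow (m + m') (n + n') (block_sum m n M N)))"
  have "span_class (span_sum m n X Y) = ?R" if "X \<in> ?P" "Y \<in> ?Q" for X Y
  proof -
    from that have X: "is_span m n X" "\<And>i j. \<lbrakk>i < n; j < m\<rbrakk> \<Longrightarrow> span_matrix X i j = M i j"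
      and Y: "is_span m' n' Y" "\<And>i j. \<lbrakk>i < n'; j < m'\<rbrakk> \<Longrightarrow> span_matrix Y i j = N i j"
      by (auto simp: matrix_arrow_def)
    have "(m + m', n + n', span_class (span_sum m n X Y)) = matrix_arrow (m + m') (n + n') (block_sum m n M N)"
      using X Y by (subst span_class_matrix_arrow[OF span_sum_matrix(1)])
        (auto simp: span_sum_matrix(2)[OF X(1) Y(1)] block_sum_def intro!: matrix_arrow_cong)
    from arg_cong[OF this, of "\<lambda>x. snd (snd x)"] show ?thesis by simp
  qed
  moreover have "?P \<noteq> {}" "?Q \<noteq> {}"
    by (rule matrix_arrow_class_nonempty)+
  ultimately have "(\<Union>X\<in>?P. \<Union>Y\<in>?Q. span_class (span_sum m n X Y)) = ?R" by auto
  then show ?thesis by (simp add: FinSpan_def matrix_arrow_def)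
qed

section \<open>Function matrices and block sums\<close>

lemma matrix_mult_fun_right:
  assumes "p j < n"
  shows "matrix_mult n N (fun_matrix p) i j = N i (p j)"
proof -
  have "matrix_mult n N (fun_matrix p) i j = (\<Sum>k<n. if k = p j then N i k else 0)"
    by (rule sum.cong) (simp_all add: fun_matrix_def)
  with assms show ?thesis by simp
qed

text \<open>The second hypothesis says that \<open>q i\<close> is the only preimage of
  \<open>i\<close> under \<open>p\<close> below \<open>n\<close>. Hence row \<open>i\<close> of the
  product is row \<open>q i\<close> of \<open>M\<close>.\<close>

lemma matrix_mult_fun_left:
  assumes "q i < n" "\<And>k. k < n \<Longrightarrow> i = p k \<longleftrightarrow> k = q i"
  shows "matrix_mult n (fun_matrix p) M i j = M (q i) j"
proof -
  have "matrix_mult n (fun_matrix p) M i j = (\<Sum>k<n. if k = q i then M k j else 0)"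
    by (rule sum.cong) (use assms in \<open>auto simp: fun_matrix_def\<close>)
  with assms show ?thesis by simp
qed

lemma matrix_mult_ident_left: "i < n \<Longrightarrow> matrix_mult n (fun_matrix (\<lambda>i. i)) M i j = M i j"
  by (rule matrix_mult_fun_left[where q = "\<lambda>i. i"]) auto

lemma sum_lessThan_add: "sum f {..<n + n'} = sum f {..<n} + (\<Sum>k<n'. f (n + k))" for f :: "nat \<Rightarrow> nat"
  by (induction n') (simp_all add: add.assoc)

lemma matrix_mult_block_sum:
  "matrix_mult (n + n') (block_sum n p N N') (block_sum m n M M') i j =
   block_sum m p (matrix_mult n N M) (matrix_mult n' N' M') i j"
  by (simp add: sum_lessThan_add block_sum_def)

lemma block_sum_fun:
  assumes "j < m \<Longrightarrow> p j < n"
  shows "fun_matrix (\<lambda>j. if j < m then p j else n + p' (j - m)) i j =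
    block_sum m n (fun_matrix p) (fun_matrix p') i j"
proof (cases "j < m")
  case True
  then show ?thesis using assms by (simp add: block_sum_def fun_matrix_def)
next
  case False
  have "i = n + k \<longleftrightarrow> \<not> i < n \<and> i - n = k" for k by linarith
  with False show ?thesis by (simp add: block_sum_def fun_matrix_def)
qed

interpretation FinSpan: category FinSpan
proof
  fix f g h A B D E
  show "f \<in> Hom FinSpan A B \<Longrightarrow> Ident FinSpan B \<cdot>\<^bsub>FinSpan\<^esub> f = f"
    by (elim FinSpan_HomE)
      (auto simp: FinSpan_Ident FinSpan_Comp matrix_mult_ident_left intro!: matrix_arrow_cong)
  show "f \<in> Hom FinSpan A B \<Longrightarrow> f \<cdot>\<^bsub>FinSpan\<^esub> Ident FinSpan A = f"
    by (elim FinSpan_HomE)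
      (auto simp: FinSpan_Ident FinSpan_Comp matrix_mult_fun_right intro!: matrix_arrow_cong)
  have "matrix_mult B (matrix_mult D M N) L = matrix_mult D M (matrix_mult B N L)" for M N L
    by (intro ext, simp add: sum_distrib_left sum_distrib_right mult.assoc, rule sum.swap)
  then show "\<lbrakk>f \<in> Hom FinSpan A B; g \<in> Hom FinSpan B D; h \<in> Hom FinSpan D E\<rbrakk> \<Longrightarrow>
      (h \<cdot>\<^bsub>FinSpan\<^esub> g) \<cdot>\<^bsub>FinSpan\<^esub> f = h \<cdot>\<^bsub>FinSpan\<^esub> g \<cdot>\<^bsub>FinSpan\<^esub> f"
    by (elim FinSpan_HomE) (simp add: FinSpan_Comp)
qed (auto elim!: FinSpan_HomE simp: FinSpan_Comp FinSpan_Ident)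

lemma FinSpan_TensA_ident:
  "Ident FinSpan m \<otimes>\<^bsub>FinSpan\<^esub> Ident FinSpan n = Ident FinSpan (m + n)"
  unfolding FinSpan_Ident FinSpan_TensA
  by (rule matrix_arrow_cong) (auto simp: block_sum_def fun_matrix_def)

lemma FinSpan_TensA_comp:
  "(matrix_arrow n p N \<cdot>\<^bsub>FinSpan\<^esub> matrix_arrow m n M) \<otimes>\<^bsub>FinSpan\<^esub>
     (matrix_arrow n' p' N' \<cdot>\<^bsub>FinSpan\<^esub> matrix_arrow m' n' M') =
   (matrix_arrow n p N \<otimes>\<^bsub>FinSpan\<^esub> matrix_arrow n' p' N') \<cdot>\<^bsub>FinSpan\<^esub>
     (matrix_arrow m n M \<otimes>\<^bsub>FinSpan\<^esub> matrix_arrow m' n' M')"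
  unfolding FinSpan_Comp FinSpan_TensA by (rule matrix_arrow_cong) (simp only: matrix_mult_block_sum)

lemma FinSpan_TensA_assoc:
  "(matrix_arrow m n M \<otimes>\<^bsub>FinSpan\<^esub> matrix_arrow m' n' M') \<otimes>\<^bsub>FinSpan\<^esub> matrix_arrow m'' n'' M'' =
   matrix_arrow m n M \<otimes>\<^bsub>FinSpan\<^esub> (matrix_arrow m' n' M' \<otimes>\<^bsub>FinSpan\<^esub> matrix_arrow m'' n'' M'')"
proof -
  have "block_sum (m + m') (n + n') (block_sum m n M M') M'' i j =
      block_sum m n M (block_sum m' n' M' M'') i j" for i j
    using less_diff_iff[of n i "n + n'"] less_diff_iff[of m j "m + m'"]
    by (cases "i < n"; cases "i < n + n'"; cases "j < m"; cases "j < m + m'")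
      (simp_all add: block_sum_def)
  then show ?thesis unfolding FinSpan_TensA by (simp add: matrix_arrow_eq_iff add.assoc)
qed

text \<open>On the left the symmetry permutes the rows of a block matrix, on the right it permutes
  the columns; the two results agree entry by entry.\<close>

lemma FinSpan_Symm_natural:
  "Symm FinSpan n n' \<cdot>\<^bsub>FinSpan\<^esub> (matrix_arrow m n M \<otimes>\<^bsub>FinSpan\<^esub> matrix_arrow m' n' N) =
   (matrix_arrow m' n' N \<otimes>\<^bsub>FinSpan\<^esub> matrix_arrow m n M) \<cdot>\<^bsub>FinSpan\<^esub> Symm FinSpan m m'"
proof -
  have 1: "matrix_mult (n + n') (fun_matrix (symm_fun n n')) (block_sum m n M N) i j =
      block_sum m n M N (symm_fun n' n i) j" if "i < n' + n" for i j
    by (rule matrix_mult_fun_left[where q = "symm_fun n' n"]) (use that in auto)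
  have 2: "matrix_mult (m' + m) (block_sum m' n' N M) (fun_matrix (symm_fun m m')) i j =
      block_sum m' n' N M i (symm_fun m m' j)" if "j < m + m'" for i j
    by (rule matrix_mult_fun_right) (use that in auto)
  show ?thesis
    unfolding FinSpan_Comp FinSpan_TensA FinSpan_Symm
    by (rule matrix_arrow_cong, subst 1, assumption, subst 2, assumption) (auto simp: block_sum_def)
qed

text \<open>Laws among structural arrows thereby become equations between functions on finite
  initial segments.\<close>

lemma FinSpan_Comp_fun:
  assumes "\<And>j. j < m \<Longrightarrow> p j < n"
  shows "matrix_arrow n n' (fun_matrix q) \<cdot>\<^bsub>FinSpan\<^esub> matrix_arrow m n (fun_matrix p) =
    matrix_arrow m n' (fun_matrix (\<lambda>j. q (p j)))"
  unfolding FinSpan_Comp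
  by (rule matrix_arrow_cong, subst matrix_mult_fun_right) (use assms in \<open>auto simp: fun_matrix_def\<close>)

lemma FinSpan_TensA_fun:
  assumes "\<And>j. j < m \<Longrightarrow> p j < n"
  shows "matrix_arrow m n (fun_matrix p) \<otimes>\<^bsub>FinSpan\<^esub> matrix_arrow m' n' (fun_matrix p') =
    matrix_arrow (m + m') (n + n') (fun_matrix (\<lambda>j. if j < m then p j else n + p' (j - m)))"
  unfolding FinSpan_TensA
  by (rule matrix_arrow_cong, rule block_sum_fun[symmetric]) (use assms in auto)

lemma fun_matrix_arrow_cong:
  "(\<And>j. j < m \<Longrightarrow> p j = q j) \<Longrightarrow> matrix_arrow m n (fun_matrix p) = matrix_arrow m n (fun_matrix q)"
  by (rule matrix_arrow_cong) (simp add: fun_matrix_def)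

section \<open>\<open>FinSpan\<close> is a PROP\<close>

interpretation FinSpan: strict_symmetric_monoidal_category FinSpan
proof
  fix f f' g g' h A A' A'' B B' B'' D D' E
  show "\<lbrakk>f \<in> Hom FinSpan A A'; g \<in> Hom FinSpan B B'\<rbrakk> \<Longrightarrow>
      f \<otimes>\<^bsub>FinSpan\<^esub> g \<in> Hom FinSpan (A \<odot>\<^bsub>FinSpan\<^esub> B) (A' \<odot>\<^bsub>FinSpan\<^esub> B')"
    by (elim FinSpan_HomE) (simp add: FinSpan_TensA)
  show "\<lbrakk>f \<in> Hom FinSpan A A'; f' \<in> Hom FinSpan A' A''; g \<in> Hom FinSpan B B'; g' \<in> Hom FinSpan B' B''\<rbrakk> \<Longrightarrow>
      (f' \<cdot>\<^bsub>FinSpan\<^esub> f) \<otimes>\<^bsub>FinSpan\<^esub> (g' \<cdot>\<^bsub>FinSpan\<^esub> g) =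
      (f' \<otimes>\<^bsub>FinSpan\<^esub> g') \<cdot>\<^bsub>FinSpan\<^esub> (f \<otimes>\<^bsub>FinSpan\<^esub> g)"
    by (elim FinSpan_HomE) (simp only: FinSpan_TensA_comp)
  show "\<lbrakk>f \<in> Hom FinSpan A A'; g \<in> Hom FinSpan B B'; h \<in> Hom FinSpan D D'\<rbrakk> \<Longrightarrow>
      Assoc FinSpan A' B' D' \<cdot>\<^bsub>FinSpan\<^esub> ((f \<otimes>\<^bsub>FinSpan\<^esub> g) \<otimes>\<^bsub>FinSpan\<^esub> h) =
      (f \<otimes>\<^bsub>FinSpan\<^esub> (g \<otimes>\<^bsub>FinSpan\<^esub> h)) \<cdot>\<^bsub>FinSpan\<^esub> Assoc FinSpan A B D"
    by (elim FinSpan_HomE) (simp add: FinSpan_TensA_assoc, simp add: FinSpan_TensA add.assoc)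
  show "f \<in> Hom FinSpan A B \<Longrightarrow>
      LUnit FinSpan B \<cdot>\<^bsub>FinSpan\<^esub> (Ident FinSpan (MUnit FinSpan) \<otimes>\<^bsub>FinSpan\<^esub> f) = f \<cdot>\<^bsub>FinSpan\<^esub> LUnit FinSpan A"
    by (elim FinSpan_HomE)
      (auto simp: FinSpan_Ident FinSpan_TensA FinSpan_Comp matrix_mult_fun_right matrix_mult_ident_left
        block_sum_def intro!: matrix_arrow_cong)
  show "f \<in> Hom FinSpan A B \<Longrightarrow>
      RUnit FinSpan B \<cdot>\<^bsub>FinSpan\<^esub> (f \<otimes>\<^bsub>FinSpan\<^esub> Ident FinSpan (MUnit FinSpan)) = f \<cdot>\<^bsub>FinSpan\<^esub> RUnit FinSpan A"
    by (elim FinSpan_HomE)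
      (auto simp: FinSpan_Ident FinSpan_TensA FinSpan_Comp matrix_mult_fun_right matrix_mult_ident_left
        block_sum_def intro!: matrix_arrow_cong)
  show "\<lbrakk>f \<in> Hom FinSpan A A'; g \<in> Hom FinSpan B B'\<rbrakk> \<Longrightarrow>
      Symm FinSpan A' B' \<cdot>\<^bsub>FinSpan\<^esub> (f \<otimes>\<^bsub>FinSpan\<^esub> g) = (g \<otimes>\<^bsub>FinSpan\<^esub> f) \<cdot>\<^bsub>FinSpan\<^esub> Symm FinSpan A B"
    by (elim FinSpan_HomE) (simp only: FinSpan_Symm_natural)
  show "Symm FinSpan B A \<cdot>\<^bsub>FinSpan\<^esub> Symm FinSpan A B = Ident FinSpan (A \<odot>\<^bsub>FinSpan\<^esub> B)"
    unfolding FinSpan_Symm FinSpan_Ident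
    by (subst FinSpan_Comp_fun) (auto intro!: fun_matrix_arrow_cong)
  show "Assoc FinSpan B D A \<cdot>\<^bsub>FinSpan\<^esub> Symm FinSpan A (B \<odot>\<^bsub>FinSpan\<^esub> D) \<cdot>\<^bsub>FinSpan\<^esub> Assoc FinSpan A B D =
      (Ident FinSpan B \<otimes>\<^bsub>FinSpan\<^esub> Symm FinSpan A D) \<cdot>\<^bsub>FinSpan\<^esub> Assoc FinSpan B A D \<cdot>\<^bsub>FinSpan\<^esub>
        (Symm FinSpan A B \<otimes>\<^bsub>FinSpan\<^esub> Ident FinSpan D)"
  proof -
    have "Symm FinSpan A B \<otimes>\<^bsub>FinSpan\<^esub> Ident FinSpan D = matrix_arrow (A + (B + D)) (B + (A + D))
        (fun_matrix (\<lambda>j. if j < A + B then symm_fun A B j else B + A + (j - (A + B))))"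
      unfolding FinSpan_Ident FinSpan_Symm by (subst FinSpan_TensA_fun) (auto simp: add.assoc)
    moreover have "Ident FinSpan B \<otimes>\<^bsub>FinSpan\<^esub> Symm FinSpan A D = matrix_arrow (B + (A + D)) (B + (D + A))
        (fun_matrix (\<lambda>j. if j < B then j else B + symm_fun A D (j - B)))"
      unfolding FinSpan_Ident FinSpan_Symm by (subst FinSpan_TensA_fun) auto
    moreover have "Symm FinSpan A (B + D) = matrix_arrow (A + (B + D)) (B + (D + A)) (fun_matrix (symm_fun A (B + D)))"
      by (simp add: FinSpan_Symm add.assoc)
    ultimately show ?thesis
      by (simp add: add.assoc) (subst FinSpan_Comp_fun; auto intro!: fun_matrix_arrow_cong)
  qed
qed (simp_all add: FinSpan_TensA_ident Hom_def FinSpan_Symm add_ac)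

interpretation FinSpan: prop_category FinSpan
  by unfold_locales simp_all

section \<open>The generating bimonoid of \<open>FinSpan\<close>\<close>

text \<open>These are the spans of the functions from a two-element and from an empty set to a
  point, read forwards for the monoid and backwards for the comonoid.\<close>

definition FinSpan_bimonoid :: "(nat, nat \<times> nat \<times> nat span set) bimonoid_data" where
  "FinSpan_bimonoid = \<lparr>carr = 1,
     bmul = matrix_arrow (Suc (Suc 0)) (Suc 0) (\<lambda>i j. 1), bone = matrix_arrow 0 (Suc 0) (\<lambda>i j. 1),
     bcomul = matrix_arrow (Suc 0) (Suc (Suc 0)) (\<lambda>i j. 1), bcounit = matrix_arrow (Suc 0) 0 (\<lambda>i j. 1)\<rparr>"

lemma FinSpan_bimonoid_simps [simp]:
  "carr FinSpan_bimonoid = Suc 0"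
  "bmul FinSpan_bimonoid = matrix_arrow (Suc (Suc 0)) (Suc 0) (\<lambda>i j. 1)"
  "bone FinSpan_bimonoid = matrix_arrow 0 (Suc 0) (\<lambda>i j. 1)"
  "bcomul FinSpan_bimonoid = matrix_arrow (Suc 0) (Suc (Suc 0)) (\<lambda>i j. 1)"
  "bcounit FinSpan_bimonoid = matrix_arrow (Suc 0) 0 (\<lambda>i j. 1)"
  by (simp_all add: FinSpan_bimonoid_def)

lemma FinSpan_inv_ident:
  "inv_arrow FinSpan (matrix_arrow n n (fun_matrix (\<lambda>i. i))) = matrix_arrow n n (fun_matrix (\<lambda>i. i))"
  using FinSpan.inv_ident[of n] by (simp add: FinSpan_Ident)

interpretation FinSpan: prop_bimonoid FinSpan FinSpan_bimonoid
  by unfold_locales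
    (simp_all add: middle_swap_def FinSpan_Comp FinSpan_TensA FinSpan_Ident FinSpan_Symm
      FinSpan_inv_ident matrix_arrow_eq_iff fun_matrix_def block_sum_def all_conj_distrib less_Suc_eq)

lemma FinSpan_scalar: "FinSpan.scalar k = matrix_arrow (Suc 0) (Suc 0) (\<lambda>i j. k)"
  by (induction k)
    (simp_all add: FinSpan_Comp FinSpan_TensA FinSpan_Ident matrix_arrow_eq_iff fun_matrix_def block_sum_def)

lemma FinSpan_row: "FinSpan.row m r = matrix_arrow m (Suc 0) (\<lambda>i. r)"
proof (induction m)
  case (Suc m)
  then show ?case
    by (auto simp: FinSpan_scalar FinSpan_Comp FinSpan_TensA matrix_arrow_eq_iff block_sum_def less_Suc_eq)
qed (simp add: matrix_arrow_eq_iff)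

text \<open>Two identity blocks on top of each other. Adding a strand inserts its first copy between
  the blocks, which cyclically shifts the rows of the second block.\<close>

lemma FinSpan_copy: "FinSpan.copy m = matrix_arrow m (m + m) (\<lambda>i j. if i = j \<or> i = m + j then 1 else 0)"
proof (induction m)
  case 0
  then show ?case by (simp add: FinSpan_Ident matrix_arrow_eq_iff)
next
  case (Suc m)
  have "Symm FinSpan m 1 \<otimes>\<^bsub>FinSpan\<^esub> Ident FinSpan 1 = matrix_arrow (m + 2) (m + 2)
      (fun_matrix (\<lambda>j. if j < m then j + 1 else if j = m then 0 else j))"
    unfolding FinSpan_Ident FinSpan_Symm
    by (subst FinSpan_TensA_fun) (auto intro!: fun_matrix_arrow_cong)
  then have mid: "FinSpan.mid m m 1 1 = matrix_arrow (m + (m + 2)) (m + (m + 2))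
      (fun_matrix (\<lambda>j. if j < m then j else if j < m + m then j + 1 else if j = m + m then m else j))"
    unfolding FinSpan.mid_def FinSpan_Ident
    by (auto simp: FinSpan_TensA_fun intro!: fun_matrix_arrow_cong)
  \<comment> \<open>The index map on the right is the inverse of the permutation in
    \<open>mid\<close>, as left multiplication permutes rows contravariantly.\<close>
  have *: "matrix_mult (m + (m + 2))
      (fun_matrix (\<lambda>j. if j < m then j else if j < m + m then j + 1 else if j = m + m then m else j)) N i j =
      N (if i < m then i else if i = m then m + m else if i < m + m + 1 then i - 1 else i) j"
    if "i < m + (m + 2)" for N i j
    by (rule matrix_mult_fun_left) (use that in auto)
  have "FinSpan.copy (Suc m) = matrix_arrow (Suc m) (m + (m + 2)) (matrix_mult (m + (m + 2))
      (fun_matrix (\<lambda>j. if j < m then j else if j < m + m then j + 1 else if j = m + m then m else j))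
      (block_sum m (m + m) (\<lambda>i j. if i = j \<or> i = m + j then 1 else 0) (\<lambda>i j. 1)))"
    using FinSpan_Comp[of "m + (m + 2)" "m + (m + 2)"] by (simp add: Suc mid[simplified] FinSpan_TensA add.assoc)
  also have "\<dots> = matrix_arrow (Suc m) (Suc m + Suc m) (\<lambda>i j. if i = j \<or> i = Suc m + j then 1 else 0)"
    unfolding matrix_arrow_eq_iff
    by (intro conjI allI impI, simp, simp, subst *, simp, auto simp: block_sum_def)
  finally show ?case .
qed

text \<open>In \<open>FinSpan\<close> itself the action of matrices is tautological. Consequently
  every arrow of \<open>FinSpan\<close> is built from the generating bimonoid.\<close>

lemma FinSpan_matrix: "FinSpan.matrix m n M = matrix_arrow m n M"
proof (induction n)
  case 0
  have "FinSpan.del m = matrix_arrow m 0 (\<lambda>i j. 0)"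
    by (induction m) (simp_all add: FinSpan_TensA FinSpan_Ident matrix_arrow_eq_iff)
  then show ?case by (simp add: matrix_arrow_eq_iff)
next
  case (Suc n)
  have *: "matrix_mult (m + m) N (\<lambda>k j. if k = j \<or> k = m + j then 1 else 0) i j = N i j + N i (m + j)"
    if "j < m" for N i j
  proof -
    have "(\<Sum>k<m. N i k * (if k = j \<or> k = m + j then 1 else 0)) = (\<Sum>k<m. if k = j then N i k else 0)"
      by (rule sum.cong) auto
    moreover have "(\<Sum>k<m. N i (m + k) * (if m + k = j \<or> m + k = m + j then 1 else 0)) =
        (\<Sum>k<m. if k = j then N i (m + k) else 0)"
      by (rule sum.cong) (use that in auto)
    ultimately show ?thesis using that by (simp add: sum_lessThan_add)
  qed
  have "FinSpan.matrix m (Suc n) M = matrix_arrow m (Suc n) (matrix_mult (m + m)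
      (block_sum m n M (\<lambda>i. M n)) (\<lambda>k j. if k = j \<or> k = m + j then 1 else 0))"
    using Suc by (simp add: FinSpan_row FinSpan_copy FinSpan_TensA FinSpan_Comp)
  also have "\<dots> = matrix_arrow m (Suc n) M"
    by (rule matrix_arrow_cong, subst *, assumption) (auto simp: block_sum_def less_Suc_eq)
  finally show ?case .
qed

section \<open>Bimonoids along monoidal functors\<close>

lemma (in prop_category) middle_swap_mid: "middle_swap T a = mid a a a a"
  by (simp add: middle_swap_def mid_def add.assoc)

locale prop_algebra = T: prop_category T + symmetric_monoidal_functor T C F
  for T :: "(nat, 'a, 'z) smc_data_scheme"
  and C :: "('o, 'b, 'y) smc_data_scheme" (structure)
  and F :: "(nat, 'a, 'o, 'b) smf_data"
begin

abbreviation \<phi> where "\<phi> \<equiv> FTens F"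
abbreviation u where "u \<equiv> FUnit F"
abbreviation i where "i n \<equiv> Ident C (FObj F n)"

lemma FObj_simps [simp]: "FObj F n \<in> Obj C"
  using obj by simp

lemma FArr_simps [simp]:
  assumes "f \<in> Arr T"
  shows "FArr F f \<in> Arr C" "Dom C (FArr F f) = FObj F (Dom T f)" "Cod C (FArr F f) = FObj F (Cod T f)"
  using arr[of f "Dom T f" "Cod T f"] assms by (auto simp: Hom_def)

lemma FArr_ident [simp]: "FArr F (Ident T n) = i n"
  by (simp add: pres_ident)

lemma FArr_comp [simp]:
  assumes "f \<in> Arr T" "g \<in> Arr T" "Dom T g = Cod T f"
  shows "FArr F g \<cdot> FArr F f = FArr F (g \<cdot>\<^bsub>T\<^esub> f)"
  using pres_comp[of f "Dom T f" "Cod T f" g "Cod T g"] assms by (auto simp: Hom_def)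

lemma FArr_comp_comp [simp]:
  assumes "f \<in> Arr T" "g \<in> Arr T" "Dom T g = Cod T f" "x \<in> Arr C" "Cod C x = FObj F (Dom T f)"
  shows "FArr F g \<cdot> FArr F f \<cdot> x = FArr F (g \<cdot>\<^bsub>T\<^esub> f) \<cdot> x"
  by (rule C.comp_reduce) (use assms in simp_all)

lemma ftens_simps [simp]:
  "\<phi> m n \<in> Arr C" "Dom C (\<phi> m n) = FObj F m \<odot> FObj F n" "Cod C (\<phi> m n) = FObj F (m + n)"
  "iso_arrow C (\<phi> m n)"
  using ftens_hom[of m n] ftens_iso[of m n] by (auto simp: Hom_def)

lemma funit_simps [simp]:
  "u \<in> Arr C" "Dom C u = MUnit C" "Cod C u = FObj F 0" "iso_arrow C u"
  using funit_hom funit_iso by (auto simp: Hom_def)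

text \<open>The tails \<open>x\<close> and \<open>y\<close> are part of the statement because
  simplification merges composites under the tensor, where plain naturality no longer
  matches.\<close>

lemma ftens_nat:
  assumes "f \<in> Arr T" "g \<in> Arr T" "Cod T f = m" "Cod T g = n"
    "x \<in> Arr C" "y \<in> Arr C" "Cod C x = FObj F (Dom T f)" "Cod C y = FObj F (Dom T g)"
  shows "\<phi> m n \<cdot> ((FArr F f \<cdot> x) \<otimes> (FArr F g \<cdot> y)) =
    FArr F (f \<otimes>\<^bsub>T\<^esub> g) \<cdot> \<phi> (Dom T f) (Dom T g) \<cdot> (x \<otimes> y)"
proof -
  have "\<phi> m n \<cdot> (FArr F f \<otimes> FArr F g) = FArr F (f \<otimes>\<^bsub>T\<^esub> g) \<cdot> \<phi> (Dom T f) (Dom T g)"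
    using assms by (intro ftens_natural) (auto simp: Hom_def)
  from C.comp_reduce[OF this, of "x \<otimes> y"] show ?thesis using assms by simp
qed

lemma ftens_inv_nat:
  assumes "f \<in> Arr T" "g \<in> Arr T" "Dom T f = m" "Dom T g = n"
    "x \<in> Arr C" "y \<in> Arr C" "Dom C x = FObj F (Cod T f)" "Dom C y = FObj F (Cod T g)"
  shows "((x \<cdot> FArr F f) \<otimes> (y \<cdot> FArr F g)) \<cdot> inv_arrow C (\<phi> m n) =
    (x \<otimes> y) \<cdot> inv_arrow C (\<phi> (Cod T f) (Cod T g)) \<cdot> FArr F (f \<otimes>\<^bsub>T\<^esub> g)"
proof -
  have "FArr F f \<otimes> FArr F g = inv_arrow C (\<phi> (Cod T f) (Cod T g)) \<cdot> FArr F (f \<otimes>\<^bsub>T\<^esub> g) \<cdot> \<phi> m n"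
    using ftens_nat[OF assms(1,2) refl refl, of "i m" "i n"] assms
    by (intro C.iso_transpose_left) simp_all
  then have "(x \<otimes> y) \<cdot> (FArr F f \<otimes> FArr F g) \<cdot> inv_arrow C (\<phi> m n) =
      (x \<otimes> y) \<cdot> (inv_arrow C (\<phi> (Cod T f) (Cod T g)) \<cdot> FArr F (f \<otimes>\<^bsub>T\<^esub> g) \<cdot> \<phi> m n) \<cdot> inv_arrow C (\<phi> m n)"
    by (simp only:)
  with assms show ?thesis by simp
qed

lemma ftens_assoc:
  "\<phi> (m + n) p \<cdot> (\<phi> m n \<otimes> i p) = \<phi> m (n + p) \<cdot> (i m \<otimes> \<phi> n p) \<cdot> Assoc C (FObj F m) (FObj F n) (FObj F p)"
  using pres_assoc[of m n p] by (simp add: add.assoc)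

text \<open>The inverse of \<open>ftens_assoc\<close>, with the associator moved to the other
  side.\<close>

lemma ftens_inv_assoc:
  "Assoc C (FObj F m) (FObj F n) (FObj F p) \<cdot> (inv_arrow C (\<phi> m n) \<otimes> i p) \<cdot> inv_arrow C (\<phi> (m + n) p) =
    (i m \<otimes> inv_arrow C (\<phi> n p)) \<cdot> inv_arrow C (\<phi> m (n + p))"
proof (rule C.iso_cancel_right)
  let ?e = "\<phi> (m + n) p \<cdot> (\<phi> m n \<otimes> i p)"
  have "((i m \<otimes> inv_arrow C (\<phi> n p)) \<cdot> inv_arrow C (\<phi> m (n + p))) \<cdot> ?e =
      Assoc C (FObj F m) (FObj F n) (FObj F p)"
    unfolding ftens_assoc by (simp add: add.assoc)
  then show "(Assoc C (FObj F m) (FObj F n) (FObj F p) \<cdot> (inv_arrow C (\<phi> m n) \<otimes> i p) \<cdot> inv_arrow C (\<phi> (m + n) p)) \<cdot> ?e =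
    ((i m \<otimes> inv_arrow C (\<phi> n p)) \<cdot> inv_arrow C (\<phi> m (n + p))) \<cdot> ?e" by simp
qed (simp_all add: add.assoc)

lemma lunit_eq: "LUnit C (FObj F n) = \<phi> 0 n \<cdot> (u \<otimes> i n)"
  and runit_eq: "RUnit C (FObj F n) = \<phi> n 0 \<cdot> (i n \<otimes> u)"
  using pres_lunit[of n] pres_runit[of n] by simp_all

lemma ftens_symm:
  "\<phi> n m \<cdot> Symm C (FObj F m) (FObj F n) = FArr F (Symm T m n) \<cdot> \<phi> m n"
  using pres_symm[of m n] by simp

text \<open>Splitting off one \<open>u\<close> leaves the unit coherence of \<open>F\<close> at
  \<open>0\<close>, and naturality of the left unitor moves the other \<open>u\<close> past
  it.\<close>

lemma ftens_unit: "\<phi> 0 0 \<cdot> (u \<otimes> u) = u \<cdot> LUnit C (MUnit C)"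
proof -
  have "\<phi> 0 0 \<cdot> (u \<otimes> u) = (\<phi> 0 0 \<cdot> (u \<otimes> i 0)) \<cdot> (Ident C (MUnit C) \<otimes> u)" by simp
  also have "\<dots> = u \<cdot> LUnit C (MUnit C)"
    unfolding lunit_eq[symmetric] by (simp add: C.lunit_nat)
  finally show ?thesis .
qed

definition image_bimonoid :: "(nat, 'a) bimonoid_data \<Rightarrow> ('o, 'b) bimonoid_data" where
  "image_bimonoid X = \<lparr>carr = FObj F (carr X),
     bmul = FArr F (bmul X) \<cdot> \<phi> (carr X) (carr X), bone = FArr F (bone X) \<cdot> u,
     bcomul = inv_arrow C (\<phi> (carr X) (carr X)) \<cdot> FArr F (bcomul X),
     bcounit = inv_arrow C u \<cdot> FArr F (bcounit X)\<rparr>"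

end

text \<open>Only the sources and targets of the structure arrows are assumed. The calculations below
  thus serve both for deducing the axioms in \<open>C\<close> from those in \<open>T\<close> and for
  the converse.\<close>

locale prop_algebra_bimonoid = prop_algebra T C F
  for T :: "(nat, 'a, 'z) smc_data_scheme"
  and C :: "('o, 'b, 'y) smc_data_scheme" (structure)
  and F :: "(nat, 'a, 'o, 'b) smf_data" +
  fixes X :: "(nat, 'a) bimonoid_data" and a
  assumes carr_X: "carr X = a"
    and bmul_X: "bmul X \<in> Hom T (a + a) a" and bone_X: "bone X \<in> Hom T 0 a"
    and bcomul_X: "bcomul X \<in> Hom T a (a + a)" and bcounit_X: "bcounit X \<in> Hom T a 0"
begin

abbreviation "\<mu> \<equiv> bmul X"
abbreviation "\<eta> \<equiv> bone X"
abbreviation "\<Delta> \<equiv> bcomul X"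
abbreviation "\<epsilon> \<equiv> bcounit X"
abbreviation "\<mu>' \<equiv> FArr F \<mu> \<cdot> \<phi> a a"
abbreviation "\<eta>' \<equiv> FArr F \<eta> \<cdot> u"
abbreviation "\<Delta>' \<equiv> inv_arrow C (\<phi> a a) \<cdot> FArr F \<Delta>"
abbreviation "\<epsilon>' \<equiv> inv_arrow C u \<cdot> FArr F \<epsilon>"

lemma X_simps [simp]:
  "\<mu> \<in> Arr T" "Dom T \<mu> = a + a" "Cod T \<mu> = a" "\<eta> \<in> Arr T" "Dom T \<eta> = 0" "Cod T \<eta> = a"
  "\<Delta> \<in> Arr T" "Dom T \<Delta> = a" "Cod T \<Delta> = a + a" "\<epsilon> \<in> Arr T" "Dom T \<epsilon> = a" "Cod T \<epsilon> = 0"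
  using bmul_X bone_X bcomul_X bcounit_X by (auto simp: Hom_def)

lemma image_assoc_left:
  "\<mu>' \<cdot> (\<mu>' \<otimes> i a) = FArr F (\<mu> \<cdot>\<^bsub>T\<^esub> (\<mu> \<otimes>\<^bsub>T\<^esub> Ident T a)) \<cdot> \<phi> (a + a) a \<cdot> (\<phi> a a \<otimes> i a)"
  using ftens_nat[of \<mu> "Ident T a" a a "\<phi> a a" "i a"] by (simp add: add.assoc)

lemma image_assoc_right:
  "\<mu>' \<cdot> (i a \<otimes> \<mu>') \<cdot> Assoc C (FObj F a) (FObj F a) (FObj F a) =
    FArr F (\<mu> \<cdot>\<^bsub>T\<^esub> (Ident T a \<otimes>\<^bsub>T\<^esub> \<mu>)) \<cdot> \<phi> (a + a) a \<cdot> (\<phi> a a \<otimes> i a)"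
  unfolding ftens_assoc
  using C.comp_reduce[OF ftens_nat[of "Ident T a" \<mu> a a "i a" "\<phi> a a"]] by (simp add: add.assoc)

lemma image_mul_one:
  "\<mu>' \<cdot> (\<eta>' \<otimes> i a) = FArr F (\<mu> \<cdot>\<^bsub>T\<^esub> (\<eta> \<otimes>\<^bsub>T\<^esub> Ident T a)) \<cdot> LUnit C (FObj F a)"
  "\<mu>' \<cdot> (i a \<otimes> \<eta>') = FArr F (\<mu> \<cdot>\<^bsub>T\<^esub> (Ident T a \<otimes>\<^bsub>T\<^esub> \<eta>)) \<cdot> RUnit C (FObj F a)"
  unfolding lunit_eq runit_eq
  using ftens_nat[of \<eta> "Ident T a" a a u "i a"] ftens_nat[of "Ident T a" \<eta> a a "i a" u] by simp_all

lemma image_comm: "\<mu>' \<cdot> Symm C (FObj F a) (FObj F a) = FArr F (\<mu> \<cdot>\<^bsub>T\<^esub> Symm T a a) \<cdot> \<phi> a a"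
  by (simp add: ftens_symm)

lemma image_coassoc_left:
  "Assoc C (FObj F a) (FObj F a) (FObj F a) \<cdot> (\<Delta>' \<otimes> i a) \<cdot> \<Delta>' =
    (i a \<otimes> inv_arrow C (\<phi> a a)) \<cdot> inv_arrow C (\<phi> a (a + a)) \<cdot> FArr F ((\<Delta> \<otimes>\<^bsub>T\<^esub> Ident T a) \<cdot>\<^bsub>T\<^esub> \<Delta>)"
proof -
  have "(\<Delta>' \<otimes> i a) \<cdot> \<Delta>' = (inv_arrow C (\<phi> a a) \<otimes> i a) \<cdot> inv_arrow C (\<phi> (a + a) a) \<cdot>
      FArr F ((\<Delta> \<otimes>\<^bsub>T\<^esub> Ident T a) \<cdot>\<^bsub>T\<^esub> \<Delta>)"
    using C.comp_reduce[OF ftens_inv_nat[of \<Delta> "Ident T a" a a "inv_arrow C (\<phi> a a)" "i a"], of "FArr F \<Delta>"]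
    by (simp add: add.assoc)
  then have "Assoc C (FObj F a) (FObj F a) (FObj F a) \<cdot> (\<Delta>' \<otimes> i a) \<cdot> \<Delta>' =
      (Assoc C (FObj F a) (FObj F a) (FObj F a) \<cdot> (inv_arrow C (\<phi> a a) \<otimes> i a) \<cdot> inv_arrow C (\<phi> (a + a) a)) \<cdot>
      FArr F ((\<Delta> \<otimes>\<^bsub>T\<^esub> Ident T a) \<cdot>\<^bsub>T\<^esub> \<Delta>)"
    by (simp add: add.assoc)
  then show ?thesis unfolding ftens_inv_assoc by (simp add: add.assoc)
qed

lemma image_coassoc_right:
  "(i a \<otimes> \<Delta>') \<cdot> \<Delta>' =
    (i a \<otimes> inv_arrow C (\<phi> a a)) \<cdot> inv_arrow C (\<phi> a (a + a)) \<cdot> FArr F ((Ident T a \<otimes>\<^bsub>T\<^esub> \<Delta>) \<cdot>\<^bsub>T\<^esub> \<Delta>)"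
  using C.comp_reduce[OF ftens_inv_nat[of "Ident T a" \<Delta> a a "i a" "inv_arrow C (\<phi> a a)"], of "FArr F \<Delta>"]
  by simp

lemma image_counit:
  "LUnit C (FObj F a) \<cdot> (\<epsilon>' \<otimes> i a) \<cdot> \<Delta>' = FArr F ((\<epsilon> \<otimes>\<^bsub>T\<^esub> Ident T a) \<cdot>\<^bsub>T\<^esub> \<Delta>)"
  "RUnit C (FObj F a) \<cdot> (i a \<otimes> \<epsilon>') \<cdot> \<Delta>' = FArr F ((Ident T a \<otimes>\<^bsub>T\<^esub> \<epsilon>) \<cdot>\<^bsub>T\<^esub> \<Delta>)"
  unfolding lunit_eq runit_eq
  using C.comp_reduce[OF ftens_inv_nat[of \<epsilon> "Ident T a" a a "inv_arrow C u" "i a"], of "FArr F \<Delta>"]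
    C.comp_reduce[OF ftens_inv_nat[of "Ident T a" \<epsilon> a a "i a" "inv_arrow C u"], of "FArr F \<Delta>"]
  by simp_all

lemma image_cocomm: "Symm C (FObj F a) (FObj F a) \<cdot> \<Delta>' = inv_arrow C (\<phi> a a) \<cdot> FArr F (Symm T a a \<cdot>\<^bsub>T\<^esub> \<Delta>)"
proof -
  have "Symm C (FObj F a) (FObj F a) \<cdot> inv_arrow C (\<phi> a a) = inv_arrow C (\<phi> a a) \<cdot> FArr F (Symm T a a)"
  proof (rule C.iso_cancel_left)
    have "(\<phi> a a \<cdot> Symm C (FObj F a) (FObj F a)) \<cdot> inv_arrow C (\<phi> a a) = FArr F (Symm T a a)"
      unfolding ftens_symm by simp
    then show "\<phi> a a \<cdot> Symm C (FObj F a) (FObj F a) \<cdot> inv_arrow C (\<phi> a a) =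
        \<phi> a a \<cdot> inv_arrow C (\<phi> a a) \<cdot> FArr F (Symm T a a)"
      by simp
  qed simp_all
  from C.comp_reduce[OF this, of "FArr F \<Delta>"] show ?thesis by simp
qed

lemma image_comul_one:
  "\<Delta>' \<cdot> \<eta>' = inv_arrow C (\<phi> a a) \<cdot> FArr F (\<Delta> \<cdot>\<^bsub>T\<^esub> \<eta>) \<cdot> u"
  "(\<eta>' \<otimes> \<eta>') \<cdot> inv_arrow C (LUnit C (MUnit C)) = inv_arrow C (\<phi> a a) \<cdot> FArr F (\<eta> \<otimes>\<^bsub>T\<^esub> \<eta>) \<cdot> u"
proof -
  have "\<phi> a a \<cdot> (\<eta>' \<otimes> \<eta>') = FArr F (\<eta> \<otimes>\<^bsub>T\<^esub> \<eta>) \<cdot> u \<cdot> LUnit C (MUnit C)"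
    by (subst ftens_nat) (simp_all add: ftens_unit)
  then have "\<eta>' \<otimes> \<eta>' = inv_arrow C (\<phi> a a) \<cdot> FArr F (\<eta> \<otimes>\<^bsub>T\<^esub> \<eta>) \<cdot> u \<cdot> LUnit C (MUnit C)"
    by (rule C.iso_transpose_left) simp_all
  then show "(\<eta>' \<otimes> \<eta>') \<cdot> inv_arrow C (LUnit C (MUnit C)) = inv_arrow C (\<phi> a a) \<cdot> FArr F (\<eta> \<otimes>\<^bsub>T\<^esub> \<eta>) \<cdot> u"
    by simp
qed simp

lemma image_counit_mul:
  "\<epsilon>' \<cdot> \<mu>' = inv_arrow C u \<cdot> FArr F (\<epsilon> \<cdot>\<^bsub>T\<^esub> \<mu>) \<cdot> \<phi> a a"
  "LUnit C (MUnit C) \<cdot> (\<epsilon>' \<otimes> \<epsilon>') = inv_arrow C u \<cdot> FArr F (\<epsilon> \<otimes>\<^bsub>T\<^esub> \<epsilon>) \<cdot> \<phi> a a"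
proof -
  have "u \<cdot> LUnit C (MUnit C) \<cdot> (\<epsilon>' \<otimes> \<epsilon>') = (u \<cdot> LUnit C (MUnit C)) \<cdot> (\<epsilon>' \<otimes> \<epsilon>')" by simp
  also have "\<dots> = \<phi> 0 0 \<cdot> ((FArr F \<epsilon> \<cdot> i a) \<otimes> (FArr F \<epsilon> \<cdot> i a))"
    unfolding ftens_unit[symmetric] by simp
  also have "\<dots> = FArr F (\<epsilon> \<otimes>\<^bsub>T\<^esub> \<epsilon>) \<cdot> \<phi> a a"
    by (subst ftens_nat) simp_all
  finally show "LUnit C (MUnit C) \<cdot> (\<epsilon>' \<otimes> \<epsilon>') = inv_arrow C u \<cdot> FArr F (\<epsilon> \<otimes>\<^bsub>T\<^esub> \<epsilon>) \<cdot> \<phi> a a"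
    by (rule C.iso_transpose_left) simp_all
qed simp

text \<open>The fourfold comparison map intertwines the swap in \<open>C\<close>, with its
  associators, and the strict swap in \<open>T\<close>.\<close>

lemma ftens_middle_swap:
  "\<phi> (a + a) (a + a) \<cdot> (\<phi> a a \<otimes> \<phi> a a) \<cdot> middle_swap C (FObj F a) =
   FArr F (T.mid a a a a) \<cdot> \<phi> (a + a) (a + a) \<cdot> (\<phi> a a \<otimes> \<phi> a a)"
proof -
  let ?A = "FObj F a"
  let ?\<alpha> = "Assoc C ?A ?A ?A" and ?\<beta> = "Assoc C ?A ?A (?A \<odot> ?A)" and ?s = "Symm T a a"
  let ?y = "\<phi> a (a + a) \<cdot> (i a \<otimes> \<phi> a a)"
  have 4: "\<phi> (a + a) (a + a) \<cdot> (\<phi> a a \<otimes> \<phi> a a) = \<phi> a (a + (a + a)) \<cdot> (i a \<otimes> ?y) \<cdot> ?\<beta>"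
  \<comment> \<open>The comparison is rebracketed as first factor, then the remaining three, because
    the associators in \<open>middle_swap\<close> do the same.\<close>
  proof -
    have "\<phi> (a + a) (a + a) \<cdot> (\<phi> a a \<otimes> \<phi> a a) =
        (\<phi> (a + a) (a + a) \<cdot> (\<phi> a a \<otimes> i (a + a))) \<cdot> ((i a \<otimes> i a) \<otimes> \<phi> a a)"
      by simp
    also have "\<dots> = \<phi> a (a + (a + a)) \<cdot> (i a \<otimes> \<phi> a (a + a)) \<cdot>
        Assoc C ?A ?A (FObj F (a + a)) \<cdot> ((i a \<otimes> i a) \<otimes> \<phi> a a)"
      unfolding ftens_assoc by (simp add: add.assoc)
    also have "\<dots> = \<phi> a (a + (a + a)) \<cdot> (i a \<otimes> \<phi> a (a + a)) \<cdot> (i a \<otimes> i a \<otimes> \<phi> a a) \<cdot> ?\<beta>"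
      by (subst C.assoc_nat) simp_all
    finally show ?thesis by simp
  qed
  have y: "?y \<cdot> ?\<alpha> \<cdot> (Symm C ?A ?A \<otimes> i a) \<cdot> inv_arrow C ?\<alpha> = FArr F (?s \<otimes>\<^bsub>T\<^esub> Ident T a) \<cdot> ?y"
  \<comment> \<open>Only the last three factors matter here. In the other bracketing of
    \<open>?y\<close> the symmetry meets \<open>\<phi> a a\<close> directly.\<close>
  proof -
    have "?y \<cdot> ?\<alpha> \<cdot> (Symm C ?A ?A \<otimes> i a) = (?y \<cdot> ?\<alpha>) \<cdot> (Symm C ?A ?A \<otimes> i a)"
      by (simp add: add.assoc)
    also have "?y \<cdot> ?\<alpha> = \<phi> (a + a) a \<cdot> (\<phi> a a \<otimes> i a)"
      unfolding ftens_assoc by (simp add: add.assoc)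
    also have "(\<phi> (a + a) a \<cdot> (\<phi> a a \<otimes> i a)) \<cdot> (Symm C ?A ?A \<otimes> i a) =
        \<phi> (a + a) a \<cdot> ((FArr F ?s \<cdot> \<phi> a a) \<otimes> (FArr F (Ident T a) \<cdot> i a))"
      by (simp add: ftens_symm)
    also have "\<dots> = FArr F (?s \<otimes>\<^bsub>T\<^esub> Ident T a) \<cdot> \<phi> (a + a) a \<cdot> (\<phi> a a \<otimes> i a)"
      by (subst ftens_nat) simp_all
    also have "\<dots> = FArr F (?s \<otimes>\<^bsub>T\<^esub> Ident T a) \<cdot> ?y \<cdot> ?\<alpha>"
      unfolding ftens_assoc by (simp add: add.assoc)
    finally have "(?y \<cdot> ?\<alpha> \<cdot> (Symm C ?A ?A \<otimes> i a)) \<cdot> inv_arrow C ?\<alpha> =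
        (FArr F (?s \<otimes>\<^bsub>T\<^esub> Ident T a) \<cdot> ?y \<cdot> ?\<alpha>) \<cdot> inv_arrow C ?\<alpha>"
      by (rule arg_cong)
    then show ?thesis by (simp add: add.assoc)
  qed
  have "\<phi> (a + a) (a + a) \<cdot> (\<phi> a a \<otimes> \<phi> a a) \<cdot> middle_swap C ?A =
      (\<phi> (a + a) (a + a) \<cdot> (\<phi> a a \<otimes> \<phi> a a)) \<cdot> middle_swap C ?A"
    by (simp add: middle_swap_def)
  also have "\<dots> = \<phi> a (a + (a + a)) \<cdot> (i a \<otimes> (?y \<cdot> ?\<alpha> \<cdot> (Symm C ?A ?A \<otimes> i a) \<cdot> inv_arrow C ?\<alpha>)) \<cdot> ?\<beta>"
    unfolding 4 by (simp add: middle_swap_def add.assoc)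
  also have "\<dots> = (\<phi> a (a + (a + a)) \<cdot> ((FArr F (Ident T a) \<cdot> i a) \<otimes> (FArr F (?s \<otimes>\<^bsub>T\<^esub> Ident T a) \<cdot> ?y))) \<cdot> ?\<beta>"
    unfolding y by (simp add: add.assoc)
  also have "\<dots> = (FArr F (Ident T a \<otimes>\<^bsub>T\<^esub> (?s \<otimes>\<^bsub>T\<^esub> Ident T a)) \<cdot> \<phi> a (a + (a + a)) \<cdot> (i a \<otimes> ?y)) \<cdot> ?\<beta>"
    by (subst ftens_nat) (simp_all add: add.assoc)
  also have "\<dots> = FArr F (T.mid a a a a) \<cdot> \<phi> a (a + (a + a)) \<cdot> (i a \<otimes> ?y) \<cdot> ?\<beta>"
    by (simp add: T.mid_def add.assoc)
  finally show ?thesis unfolding 4 .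
qed

lemma image_comul_mul:
  "\<Delta>' \<cdot> \<mu>' = inv_arrow C (\<phi> a a) \<cdot> FArr F (\<Delta> \<cdot>\<^bsub>T\<^esub> \<mu>) \<cdot> \<phi> a a"
  "(\<mu>' \<otimes> \<mu>') \<cdot> middle_swap C (FObj F a) \<cdot> (\<Delta>' \<otimes> \<Delta>') =
    inv_arrow C (\<phi> a a) \<cdot> FArr F ((\<mu> \<otimes>\<^bsub>T\<^esub> \<mu>) \<cdot>\<^bsub>T\<^esub> T.mid a a a a \<cdot>\<^bsub>T\<^esub> (\<Delta> \<otimes>\<^bsub>T\<^esub> \<Delta>)) \<cdot> \<phi> a a"
proof -
  let ?p = "\<phi> (a + a) (a + a) \<cdot> (\<phi> a a \<otimes> \<phi> a a)"
  have ms [simp]: "middle_swap C (FObj F a) \<in> Arr C"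
    "Dom C (middle_swap C (FObj F a)) = (FObj F a \<odot> FObj F a) \<odot> (FObj F a \<odot> FObj F a)"
    "Cod C (middle_swap C (FObj F a)) = (FObj F a \<odot> FObj F a) \<odot> (FObj F a \<odot> FObj F a)"
    by (simp_all add: middle_swap_def)
  have mm: "\<phi> a a \<cdot> (\<mu>' \<otimes> \<mu>') = FArr F (\<mu> \<otimes>\<^bsub>T\<^esub> \<mu>) \<cdot> ?p"
    by (subst ftens_nat) simp_all
  have "\<phi> (a + a) (a + a) \<cdot> ((FArr F \<Delta> \<cdot> i a) \<otimes> (FArr F \<Delta> \<cdot> i a)) = FArr F (\<Delta> \<otimes>\<^bsub>T\<^esub> \<Delta>) \<cdot> \<phi> a a"
    by (subst ftens_nat) simp_all
  then have dd: "?p \<cdot> (\<Delta>' \<otimes> \<Delta>') = FArr F (\<Delta> \<otimes>\<^bsub>T\<^esub> \<Delta>) \<cdot> \<phi> a a"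
    by simp
  have "\<phi> a a \<cdot> (\<mu>' \<otimes> \<mu>') \<cdot> middle_swap C (FObj F a) \<cdot> (\<Delta>' \<otimes> \<Delta>') =
      (\<phi> a a \<cdot> (\<mu>' \<otimes> \<mu>')) \<cdot> middle_swap C (FObj F a) \<cdot> (\<Delta>' \<otimes> \<Delta>')"
    by simp
  also have "\<dots> = FArr F (\<mu> \<otimes>\<^bsub>T\<^esub> \<mu>) \<cdot> (\<phi> (a + a) (a + a) \<cdot> (\<phi> a a \<otimes> \<phi> a a) \<cdot> middle_swap C (FObj F a)) \<cdot> (\<Delta>' \<otimes> \<Delta>')"
    unfolding mm by simp
  also have "\<dots> = FArr F (\<mu> \<otimes>\<^bsub>T\<^esub> \<mu>) \<cdot> FArr F (T.mid a a a a) \<cdot> ?p \<cdot> (\<Delta>' \<otimes> \<Delta>')"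
    unfolding ftens_middle_swap by (simp add: add.assoc)
  also have "\<dots> = FArr F ((\<mu> \<otimes>\<^bsub>T\<^esub> \<mu>) \<cdot>\<^bsub>T\<^esub> T.mid a a a a \<cdot>\<^bsub>T\<^esub> (\<Delta> \<otimes>\<^bsub>T\<^esub> \<Delta>)) \<cdot> \<phi> a a"
    unfolding dd by (simp add: add.assoc)
  finally show "(\<mu>' \<otimes> \<mu>') \<cdot> middle_swap C (FObj F a) \<cdot> (\<Delta>' \<otimes> \<Delta>') =
    inv_arrow C (\<phi> a a) \<cdot> FArr F ((\<mu> \<otimes>\<^bsub>T\<^esub> \<mu>) \<cdot>\<^bsub>T\<^esub> T.mid a a a a \<cdot>\<^bsub>T\<^esub> (\<Delta> \<otimes>\<^bsub>T\<^esub> \<Delta>)) \<cdot> \<phi> a a"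
    by (rule C.iso_transpose_left) simp_all
qed simp

lemma image_counit_one: "\<epsilon>' \<cdot> \<eta>' = inv_arrow C u \<cdot> FArr F (\<epsilon> \<cdot>\<^bsub>T\<^esub> \<eta>) \<cdot> u"
  by simp

text \<open>
  Both sides of each axiom in \<open>C\<close> are obtained from the corresponding arrows of \<open>T\<close> by applying
  \<open>F\<close> and composing with the same isomorphisms. So \<open>F\<close> preserves bimonoids, and reflects them if
  it is faithful.
\<close>

lemma image_bimonoid_simps [simp]:
  "carr (image_bimonoid X) = FObj F a" "bmul (image_bimonoid X) = \<mu>'" "bone (image_bimonoid X) = \<eta>'"
  "bcomul (image_bimonoid X) = \<Delta>'" "bcounit (image_bimonoid X) = \<epsilon>'"
  by (simp_all add: image_bimonoid_def carr_X)

theorem image_bimonoid_preserved: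
  assumes "bicommutative_bimonoid T X"
  shows "bicommutative_bimonoid C (image_bimonoid X)"
proof -
  interpret X: bicommutative_bimonoid T X by fact
  note ax [simp] = X.mul_assoc[unfolded carr_X T.structural_ident, simplified]
    X.mul_one_left[unfolded carr_X T.structural_ident] X.mul_one_right[unfolded carr_X T.structural_ident]
    X.mul_comm[unfolded carr_X] X.comul_coassoc[unfolded carr_X T.structural_ident, simplified]
    X.comul_counit_left[unfolded carr_X T.structural_ident, simplified]
    X.comul_counit_right[unfolded carr_X T.structural_ident, simplified]
    X.comul_cocomm[unfolded carr_X] X.comul_mul[unfolded carr_X T.middle_swap_mid]
    X.comul_one[unfolded T.structural_ident, simplified]
    X.counit_mul[unfolded T.structural_ident, simplified] X.counit_one[simplified]
  show ?thesis
    by unfold_locales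
      (simp_all only: image_bimonoid_simps image_assoc_left image_assoc_right image_mul_one image_comm
        image_coassoc_left image_coassoc_right image_counit image_cocomm image_comul_one image_counit_mul
        image_counit_one image_comul_mul, simp_all add: Hom_def add.assoc)
qed

text \<open>The isomorphisms around the images of \<open>f\<close> and \<open>g\<close> are stripped
  off before faithfulness is applied.\<close>

lemma FArr_cancel:
  assumes "inj_on (FArr F) (Hom T m n)" "x \<cdot> FArr F f \<cdot> y = x \<cdot> FArr F g \<cdot> y"
    "iso_arrow C x" "iso_arrow C y" "f \<in> Hom T m n" "g \<in> Hom T m n" "Dom C x = FObj F n" "Cod C y = FObj F m"
  shows "f = g"
proof -
  note [simp] = T.HomD[OF assms(5)] T.HomD[OF assms(6)] C.iso_arr[OF assms(3)] C.iso_arr[OF assms(4)]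
  have "FArr F f \<cdot> y = FArr F g \<cdot> y"
    by (rule C.iso_cancel_left[OF assms(2,3)]) (use assms in simp_all)
  then have "FArr F f = FArr F g"
    by (rule C.iso_cancel_right[OF _ assms(4)]) (use assms in simp_all)
  with assms show ?thesis by (auto dest: inj_onD)
qed

theorem image_bimonoid_reflected:
  assumes inj: "\<And>m n. inj_on (FArr F) (Hom T m n)"
    and bim: "bicommutative_bimonoid C (image_bimonoid X)"
  shows "bicommutative_bimonoid T X"
proof -
  interpret X: bicommutative_bimonoid C "image_bimonoid X" by fact
  let ?i = "Ident T a"
  have "\<mu> \<cdot>\<^bsub>T\<^esub> (\<mu> \<otimes>\<^bsub>T\<^esub> ?i) = \<mu> \<cdot>\<^bsub>T\<^esub> (?i \<otimes>\<^bsub>T\<^esub> \<mu>)"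
    by (rule FArr_cancel[OF inj[of "a + (a + a)" "a"], where x = "i a" and y = "\<phi> (a + a) a \<cdot> (\<phi> a a \<otimes> i a)"])
      (use X.mul_assoc image_assoc_left image_assoc_right in \<open>simp_all add: Hom_def add.assoc\<close>)
  moreover have "\<mu> \<cdot>\<^bsub>T\<^esub> (\<eta> \<otimes>\<^bsub>T\<^esub> ?i) = ?i"
    by (rule FArr_cancel[OF inj[of "a" "a"], where x = "i a" and y = "LUnit C (FObj F a)"])
      (use X.mul_one_left image_mul_one(1) in \<open>simp_all add: Hom_def add.assoc\<close>)
  moreover have "\<mu> \<cdot>\<^bsub>T\<^esub> (?i \<otimes>\<^bsub>T\<^esub> \<eta>) = ?i"
    by (rule FArr_cancel[OF inj[of "a" "a"], where x = "i a" and y = "RUnit C (FObj F a)"])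
      (use X.mul_one_right image_mul_one(2) in \<open>simp_all add: Hom_def add.assoc\<close>)
  moreover have "\<mu> \<cdot>\<^bsub>T\<^esub> Symm T a a = \<mu>"
    by (rule FArr_cancel[OF inj[of "a + a" "a"], where x = "i a" and y = "\<phi> a a"])
      (use X.mul_comm image_comm in \<open>simp_all add: Hom_def add.assoc\<close>)
  moreover have "(\<Delta> \<otimes>\<^bsub>T\<^esub> ?i) \<cdot>\<^bsub>T\<^esub> \<Delta> = (?i \<otimes>\<^bsub>T\<^esub> \<Delta>) \<cdot>\<^bsub>T\<^esub> \<Delta>"
    by (rule FArr_cancel[OF inj[of "a" "a + (a + a)"], where x = "(i a \<otimes> inv_arrow C (\<phi> a a)) \<cdot> inv_arrow C (\<phi> a (a + a))" and y = "i a"])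
      (use X.comul_coassoc image_coassoc_left image_coassoc_right in \<open>simp_all add: Hom_def add.assoc\<close>)
  moreover have "(\<epsilon> \<otimes>\<^bsub>T\<^esub> ?i) \<cdot>\<^bsub>T\<^esub> \<Delta> = ?i"
    by (rule FArr_cancel[OF inj[of "a" "a"], where x = "i a" and y = "i a"])
      (use X.comul_counit_left image_counit(1) in \<open>simp_all add: Hom_def add.assoc\<close>)
  moreover have "(?i \<otimes>\<^bsub>T\<^esub> \<epsilon>) \<cdot>\<^bsub>T\<^esub> \<Delta> = ?i"
    by (rule FArr_cancel[OF inj[of "a" "a"], where x = "i a" and y = "i a"])
      (use X.comul_counit_right image_counit(2) in \<open>simp_all add: Hom_def add.assoc\<close>)
  moreover have "Symm T a a \<cdot>\<^bsub>T\<^esub> \<Delta> = \<Delta>"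
    by (rule FArr_cancel[OF inj[of "a" "a + a"], where x = "inv_arrow C (\<phi> a a)" and y = "i a"])
      (use X.comul_cocomm image_cocomm in \<open>simp_all add: Hom_def add.assoc\<close>)
  moreover have "\<Delta> \<cdot>\<^bsub>T\<^esub> \<mu> = (\<mu> \<otimes>\<^bsub>T\<^esub> \<mu>) \<cdot>\<^bsub>T\<^esub> T.mid a a a a \<cdot>\<^bsub>T\<^esub> (\<Delta> \<otimes>\<^bsub>T\<^esub> \<Delta>)"
    by (rule FArr_cancel[OF inj[of "a + a" "a + a"], where x = "inv_arrow C (\<phi> a a)" and y = "\<phi> a a"])
      (use X.comul_mul image_comul_mul in \<open>simp_all add: Hom_def add.assoc\<close>)
  moreover have "\<Delta> \<cdot>\<^bsub>T\<^esub> \<eta> = \<eta> \<otimes>\<^bsub>T\<^esub> \<eta>"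
    by (rule FArr_cancel[OF inj[of "0" "a + a"], where x = "inv_arrow C (\<phi> a a)" and y = "u"])
      (use X.comul_one image_comul_one in \<open>simp_all add: Hom_def add.assoc\<close>)
  moreover have "\<epsilon> \<cdot>\<^bsub>T\<^esub> \<mu> = \<epsilon> \<otimes>\<^bsub>T\<^esub> \<epsilon>"
    by (rule FArr_cancel[OF inj[of "a + a" "0"], where x = "inv_arrow C u" and y = "\<phi> a a"])
      (use X.counit_mul image_counit_mul in \<open>simp_all add: Hom_def add.assoc\<close>)
  moreover have "\<epsilon> \<cdot>\<^bsub>T\<^esub> \<eta> = Ident T 0"
    by (rule FArr_cancel[OF inj[of "0" "0"], where x = "inv_arrow C u" and y = "u"])
      (use X.counit_one image_counit_one in \<open>simp_all add: Hom_def add.assoc\<close>)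
  ultimately show ?thesis
    by unfold_locales (simp_all add: carr_X Hom_def T.middle_swap_mid add.assoc)
qed

end

section \<open>The PROP of endomorphisms of an object\<close>

context symmetric_monoidal_category
begin

text \<open>The remaining redundant axiom of Kelly. Naturality of the left unitor at its own
  component gives \<open>LUnit C (?I \<odot> ?I) = Ident C ?I \<otimes> LUnit C ?I\<close>; then
  \<open>lunit_tens\<close> and the triangle have the same left-hand side.\<close>

lemma lunit_runit_unit: "LUnit C (MUnit C) = RUnit C (MUnit C)"
proof (rule tens_right_unit_cancel)
  let ?I = "MUnit C"
  have "LUnit C (?I \<odot> ?I) = Ident C ?I \<otimes> LUnit C ?I"
    by (rule iso_cancel_left[where e = "LUnit C ?I"]) (simp_all add: lunit_nat)
  then have "(Ident C ?I \<otimes> LUnit C ?I) \<cdot> Assoc C ?I ?I ?I = LUnit C ?I \<otimes> Ident C ?I"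
    using lunit_tens[of ?I ?I] by simp
  then show "LUnit C ?I \<otimes> Ident C ?I = RUnit C ?I \<otimes> Ident C ?I"
    by (simp add: triangle)
qed simp_all

lemma assoc_inv_nat:
  assumes "f \<in> Arr C" "g \<in> Arr C" "h \<in> Arr C"
  shows "inv_arrow C (Assoc C (Cod C f) (Cod C g) (Cod C h)) \<cdot> (f \<otimes> g \<otimes> h) =
    ((f \<otimes> g) \<otimes> h) \<cdot> inv_arrow C (Assoc C (Dom C f) (Dom C g) (Dom C h))"
proof (rule iso_cancel_right[where e = "Assoc C (Dom C f) (Dom C g) (Dom C h)"])
  have "inv_arrow C (Assoc C (Cod C f) (Cod C g) (Cod C h)) \<cdot> (f \<otimes> g \<otimes> h) \<cdot> Assoc C (Dom C f) (Dom C g) (Dom C h) =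
    (f \<otimes> g) \<otimes> h"
    using assms by (simp add: assoc_nat[symmetric])
  then show "(inv_arrow C (Assoc C (Cod C f) (Cod C g) (Cod C h)) \<cdot> (f \<otimes> g \<otimes> h)) \<cdot> Assoc C (Dom C f) (Dom C g) (Dom C h) =
    (((f \<otimes> g) \<otimes> h) \<cdot> inv_arrow C (Assoc C (Dom C f) (Dom C g) (Dom C h))) \<cdot> Assoc C (Dom C f) (Dom C g) (Dom C h)"
    using assms by simp
qed (use assms in simp_all)

end

locale tensor_powers = symmetric_monoidal_category C
  for C :: "('o, 'a, 'z) smc_data_scheme" (structure) +
  fixes A :: 'o
  assumes base_obj [simp]: "A \<in> Obj C"
begin

text \<open>The first power is \<open>A\<close> itself, not \<open>I \<odot> A\<close>.\<close>

fun pow :: "nat \<Rightarrow> 'o" where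
  "pow 0 = MUnit C"
| "pow (Suc 0) = A"
| "pow (Suc (Suc n)) = pow (Suc n) \<odot> A"

text \<open>Appending a factor. The left unitor at \<open>0\<close> absorbs the exceptional first
  power, so that \<open>cat\<close> can be defined by a uniform recursion.\<close>

definition snoc :: "nat \<Rightarrow> 'a" where
  "snoc n = (case n of 0 \<Rightarrow> LUnit C A | Suc m \<Rightarrow> Ident C (pow (Suc m) \<odot> A))"

text \<open>The concatenation isomorphism from \<open>pow m \<odot> pow n\<close> to
  \<open>pow (m + n)\<close>: the last factor is detached, the rest concatenated, and the factor
  appended again.\<close>

primrec cat :: "nat \<Rightarrow> nat \<Rightarrow> 'a" where
  "cat m 0 = RUnit C (pow m)"
| "cat m (Suc n) = snoc (m + n) \<cdot> (cat m n \<otimes> Ident C A) \<cdot>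
     inv_arrow C (Assoc C (pow m) (pow n) A) \<cdot> (Ident C (pow m) \<otimes> inv_arrow C (snoc n))"

lemma pow_obj [simp]: "pow n \<in> Obj C"
  by (induction n rule: pow.induct) simp_all

lemma snoc_simps [simp]:
  "snoc n \<in> Arr C" "Dom C (snoc n) = pow n \<odot> A" "Cod C (snoc n) = pow (Suc n)" "iso_arrow C (snoc n)"
  by (simp_all add: snoc_def split: nat.split)

lemma cat_arr [simp]:
  "cat m n \<in> Arr C \<and> Dom C (cat m n) = pow m \<odot> pow n \<and> Cod C (cat m n) = pow (m + n) \<and>
    iso_arrow C (cat m n)"
  by (induction n) simp_all

text \<open>The recursion is on the right argument, so the left unit law needs an induction. Its
  base case is the equality of the two unitors at the unit object.\<close>

lemma cat_zero_left: "cat 0 n = LUnit C (pow n)"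
proof (induction n)
  case 0
  then show ?case by (simp add: lunit_runit_unit)
next
  case (Suc n)
  have *: "(LUnit C (pow n) \<otimes> Ident C A) \<cdot> inv_arrow C (Assoc C (MUnit C) (pow n) A) = LUnit C (pow n \<odot> A)"
    by (rule iso_transpose_right[symmetric]) (simp_all add: lunit_tens)
  have "cat 0 (Suc n) = snoc n \<cdot> LUnit C (pow n \<odot> A) \<cdot> (Ident C (MUnit C) \<otimes> inv_arrow C (snoc n))"
    using comp_reduce[OF *, of "Ident C (MUnit C) \<otimes> inv_arrow C (snoc n)"] by (simp add: Suc)
  also have "\<dots> = LUnit C (pow (Suc n))"
    by (subst lunit_nat) simp_all
  finally show ?case .
qed

text \<open>The fragment of coherence on which the PROP of tensor powers rests. Induction on
  \<open>p\<close>: the base is \<open>runit_tens\<close>, and in the step the pentagon carries the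
  last factor across.\<close>

lemma cat_assoc:
  "cat (m + n) p \<cdot> (cat m n \<otimes> Ident C (pow p)) =
   cat m (n + p) \<cdot> (Ident C (pow m) \<otimes> cat n p) \<cdot> Assoc C (pow m) (pow n) (pow p)"
proof (induction p)
  case 0
  have "cat (m + n) 0 \<cdot> (cat m n \<otimes> Ident C (pow 0)) = cat m n \<cdot> RUnit C (pow m \<odot> pow n)"
    by (simp add: runit_nat)
  then show ?case by (simp add: runit_tens[symmetric])
next
  case (Suc p)
  let ?m = "Ident C (pow m)" and ?n = "Ident C (pow n)" and ?A = "Ident C A"
  let ?s = "inv_arrow C (snoc p)" and ?c = "cat m (n + p)" and ?S = "snoc (m + n + p)"
  let ?\<alpha> = "\<lambda>X Y Z. Assoc C X Y Z" and ?\<beta> = "\<lambda>X Y Z. inv_arrow C (Assoc C X Y Z)"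
  \<comment> \<open>The pentagon solved for the three associators that appear when the last factor
    is detached on both levels.\<close>
  have pent: "?\<beta> (pow m) (pow n \<odot> pow p) A \<cdot> (?m \<otimes> ?\<beta> (pow n) (pow p) A) \<cdot> ?\<alpha> (pow m) (pow n) (pow p \<odot> A) =
      (?\<alpha> (pow m) (pow n) (pow p) \<otimes> ?A) \<cdot> ?\<beta> (pow m \<odot> pow n) (pow p) A"
  proof (rule iso_cancel_right[where e = "?\<alpha> (pow m \<odot> pow n) (pow p) A"])
    have "(?\<beta> (pow m) (pow n \<odot> pow p) A \<cdot> (?m \<otimes> ?\<beta> (pow n) (pow p) A) \<cdot> ?\<alpha> (pow m) (pow n) (pow p \<odot> A)) \<cdot> ?\<alpha> (pow m \<odot> pow n) (pow p) A
      = ?\<beta> (pow m) (pow n \<odot> pow p) A \<cdot> (?m \<otimes> ?\<beta> (pow n) (pow p) A) \<cdot> (?\<alpha> (pow m) (pow n) (pow p \<odot> A) \<cdot> ?\<alpha> (pow m \<odot> pow n) (pow p) A)"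
      by simp
    also have "\<dots> = ?\<alpha> (pow m) (pow n) (pow p) \<otimes> ?A"
      by (subst pentagon) simp_all
    finally show "(?\<beta> (pow m) (pow n \<odot> pow p) A \<cdot> (?m \<otimes> ?\<beta> (pow n) (pow p) A) \<cdot> ?\<alpha> (pow m) (pow n) (pow p \<odot> A)) \<cdot> ?\<alpha> (pow m \<odot> pow n) (pow p) A =
        ((?\<alpha> (pow m) (pow n) (pow p) \<otimes> ?A) \<cdot> ?\<beta> (pow m \<odot> pow n) (pow p) A) \<cdot> ?\<alpha> (pow m \<odot> pow n) (pow p) A"
      by simp
  qed simp_all
  have "cat (m + n) (Suc p) \<cdot> (cat m n \<otimes> Ident C (pow (Suc p))) =
      ?S \<cdot> (cat (m + n) p \<otimes> ?A) \<cdot> (?\<beta> (pow (m + n)) (pow p) A \<cdot> (cat m n \<otimes> Ident C (pow p) \<otimes> ?A)) \<cdot>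
        (Ident C (pow m \<odot> pow n) \<otimes> ?s)"
    by simp
  also have "\<dots> = ?S \<cdot> ((cat (m + n) p \<cdot> (cat m n \<otimes> Ident C (pow p))) \<otimes> ?A) \<cdot> ?\<beta> (pow m \<odot> pow n) (pow p) A \<cdot>
        (Ident C (pow m \<odot> pow n) \<otimes> ?s)"
    using assoc_inv_nat[of "cat m n" "Ident C (pow p)" ?A] by (simp del: tens_ident)
  also have "\<dots> = ?S \<cdot> ((?c \<cdot> (?m \<otimes> cat n p) \<cdot> ?\<alpha> (pow m) (pow n) (pow p)) \<otimes> ?A) \<cdot> ?\<beta> (pow m \<odot> pow n) (pow p) A \<cdot>
        (Ident C (pow m \<odot> pow n) \<otimes> ?s)"
    by (simp only: Suc)
  also have "\<dots> = ?S \<cdot> (?c \<otimes> ?A) \<cdot> ((?m \<otimes> cat n p) \<otimes> ?A) \<cdot>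
      ((?\<alpha> (pow m) (pow n) (pow p) \<otimes> ?A) \<cdot> ?\<beta> (pow m \<odot> pow n) (pow p) A) \<cdot> (Ident C (pow m \<odot> pow n) \<otimes> ?s)"
    by (simp add: add.assoc)
  also have "\<dots> = ?S \<cdot> (?c \<otimes> ?A) \<cdot> (((?m \<otimes> cat n p) \<otimes> ?A) \<cdot> ?\<beta> (pow m) (pow n \<odot> pow p) A) \<cdot> (?m \<otimes> ?\<beta> (pow n) (pow p) A) \<cdot>
      (?\<alpha> (pow m) (pow n) (pow p \<odot> A) \<cdot> ((?m \<otimes> ?n) \<otimes> ?s))"
    unfolding pent[symmetric] by (simp add: add.assoc)
  also have "\<dots> = ?S \<cdot> (?c \<otimes> ?A) \<cdot> (?\<beta> (pow m) (pow (n + p)) A \<cdot> (?m \<otimes> cat n p \<otimes> ?A)) \<cdot> (?m \<otimes> ?\<beta> (pow n) (pow p) A) \<cdot>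
      (?m \<otimes> ?n \<otimes> ?s) \<cdot> ?\<alpha> (pow m) (pow n) (pow (Suc p))"
    using assoc_inv_nat[of ?m "cat n p" ?A] assoc_nat[of ?m ?n ?s, OF _ _ _ refl refl refl]
    by (simp add: add.assoc)
  also have "\<dots> = cat m (n + Suc p) \<cdot> (?m \<otimes> cat n (Suc p)) \<cdot> Assoc C (pow m) (pow n) (pow (Suc p))"
    by (simp add: add.assoc)
  finally show ?case .
qed

end

context tensor_powers
begin

definition endo_tens :: "nat \<times> nat \<times> 'a \<Rightarrow> nat \<times> nat \<times> 'a \<Rightarrow> 'a" where
  "endo_tens = (\<lambda>(m, n, f) (m', n', g). cat n n' \<cdot> (f \<otimes> g) \<cdot> inv_arrow C (cat m m'))"

text \<open>Powers with different exponents may be the same object of \<open>C\<close>, so an arrow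
  records its exponents.\<close>

definition endo_prop :: "(nat, nat \<times> nat \<times> 'a) smc_data" where
  "endo_prop =
     \<lparr>Obj = UNIV,
      Arr = {(m, n, f). f \<in> Hom C (pow m) (pow n)},
      Dom = (\<lambda>(m, n, f). m),
      Cod = (\<lambda>(m, n, f). n),
      Ident = (\<lambda>n. (n, n, Ident C (pow n))),
      Comp = (\<lambda>(n', p, g) (m, n, f). (m, p, g \<cdot> f)),
      TensO = (+),
      TensA = (\<lambda>(m, n, f) (m', n', g). (m + m', n + n', endo_tens (m, n, f) (m', n', g))),
      MUnit = 0,
      Assoc = (\<lambda>m n p. (m + n + p, m + n + p, Ident C (pow (m + n + p)))),
      LUnit = (\<lambda>n. (n, n, Ident C (pow n))),
      RUnit = (\<lambda>n. (n, n, Ident C (pow n))),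
      Symm = (\<lambda>m n. (m + n, n + m, cat n m \<cdot> Symm C (pow m) (pow n) \<cdot> inv_arrow C (cat m n)))\<rparr>"

definition endo_functor :: "(nat, nat \<times> nat \<times> 'a, 'o, 'a) smf_data" where
  "endo_functor = \<lparr>FObj = pow, FArr = (\<lambda>f\<in>Arr endo_prop. snd (snd f)), FTens = cat,
     FUnit = Ident C (MUnit C)\<rparr>"

lemma endo_simps [simp]:
  "Obj endo_prop = UNIV"
  "(m, n, f) \<in> Arr endo_prop \<longleftrightarrow> f \<in> Hom C (pow m) (pow n)"
  "Dom endo_prop (m, n, f) = m" "Cod endo_prop (m, n, f) = n"
  "Ident endo_prop n = (n, n, Ident C (pow n))"
  "(n', p, g) \<cdot>\<^bsub>endo_prop\<^esub> (m, n, f) = (m, p, g \<cdot> f)"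
  "m \<odot>\<^bsub>endo_prop\<^esub> n = m + n"
  "(m, n, f) \<otimes>\<^bsub>endo_prop\<^esub> (m', n', g) = (m + m', n + n', endo_tens (m, n, f) (m', n', g))"
  "MUnit endo_prop = 0"
  "Assoc endo_prop m n p = (m + n + p, m + n + p, Ident C (pow (m + n + p)))"
  "LUnit endo_prop n = (n, n, Ident C (pow n))"
  "RUnit endo_prop n = (n, n, Ident C (pow n))"
  "Symm endo_prop m n = (m + n, n + m, cat n m \<cdot> Symm C (pow m) (pow n) \<cdot> inv_arrow C (cat m n))"
  by (simp_all add: endo_prop_def)

lemma endo_HomE:
  assumes "f \<in> Hom endo_prop m n"
  obtains g where "f = (m, n, g)" "g \<in> Arr C" "Dom C g = pow m" "Cod C g = pow n"
  using assms by (cases f) (auto simp: Hom_def)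

lemma endo_HomI: "\<lbrakk>g \<in> Arr C; Dom C g = pow m; Cod C g = pow n\<rbrakk> \<Longrightarrow> (m, n, g) \<in> Hom endo_prop m n"
  by (simp add: Hom_def)

text \<open>After precomposition with a threefold concatenation, \<open>cat_assoc\<close> on the
  target side and naturality of the associator reduce both sides to the same composite.\<close>

lemma endo_tens_assoc:
  assumes "f \<in> Hom C (pow m) (pow n)" "g \<in> Hom C (pow m') (pow n')" "h \<in> Hom C (pow m'') (pow n'')"
  shows "endo_tens (m + m', n + n', endo_tens (m, n, f) (m', n', g)) (m'', n'', h) =
    endo_tens (m, n, f) (m' + m'', n' + n'', endo_tens (m', n', g) (m'', n'', h))"
proof (rule iso_cancel_right[where e = "cat (m + m') m'' \<cdot> (cat m m' \<otimes> Ident C (pow m''))"])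
  note [simp] = HomD[OF assms(1)] HomD[OF assms(2)] HomD[OF assms(3)]
  let ?L = "endo_tens (m + m', n + n', endo_tens (m, n, f) (m', n', g)) (m'', n'', h)"
  let ?R = "endo_tens (m, n, f) (m' + m'', n' + n'', endo_tens (m', n', g) (m'', n'', h))"
  have "?L \<cdot> cat (m + m') m'' \<cdot> (cat m m' \<otimes> Ident C (pow m'')) =
      (cat (n + n') n'' \<cdot> (cat n n' \<otimes> Ident C (pow n''))) \<cdot> ((f \<otimes> g) \<otimes> h)"
    by (simp add: endo_tens_def)
  also have "\<dots> = cat n (n' + n'') \<cdot> (Ident C (pow n) \<otimes> cat n' n'') \<cdot> (f \<otimes> g \<otimes> h) \<cdot> Assoc C (pow m) (pow m') (pow m'')"
    unfolding cat_assoc by (simp add: assoc_nat add.assoc)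
  also have "\<dots> = ?R \<cdot> cat (m + m') m'' \<cdot> (cat m m' \<otimes> Ident C (pow m''))"
    unfolding cat_assoc by (simp add: endo_tens_def add.assoc)
  finally show "?L \<cdot> cat (m + m') m'' \<cdot> (cat m m' \<otimes> Ident C (pow m'')) =
    ?R \<cdot> cat (m + m') m'' \<cdot> (cat m m' \<otimes> Ident C (pow m''))" .
qed (use assms in \<open>simp_all add: endo_tens_def Hom_def add.assoc\<close>)

text \<open>The hexagon of \<open>C\<close>, conjugated by threefold concatenations;
  \<open>cat_assoc\<close> supplies each change of bracketing.\<close>

lemma endo_hexagon:
  "cat (n + p) m \<cdot> Symm C (pow m) (pow (n + p)) \<cdot> inv_arrow C (cat m (n + p)) =
   endo_tens (n, n, Ident C (pow n)) (m + p, p + m, cat p m \<cdot> Symm C (pow m) (pow p) \<cdot> inv_arrow C (cat m p)) \<cdot>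
   endo_tens (m + n, n + m, cat n m \<cdot> Symm C (pow m) (pow n) \<cdot> inv_arrow C (cat m n)) (p, p, Ident C (pow p))"
  (is "?L = ?R")
proof (rule iso_cancel_right[where e = "cat (m + n) p \<cdot> (cat m n \<otimes> Ident C (pow p))"])
  let ?m = "Ident C (pow m)" and ?n = "Ident C (pow n)" and ?p = "Ident C (pow p)"
  let ?s = "Symm C (pow m) (pow n)" and ?t = "Symm C (pow m) (pow p)"
  have "?R \<cdot> cat (m + n) p \<cdot> (cat m n \<otimes> ?p) =
      cat n (p + m) \<cdot> (?n \<otimes> (cat p m \<cdot> ?t)) \<cdot> (?n \<otimes> inv_arrow C (cat m p)) \<cdot> inv_arrow C (cat n (m + p)) \<cdot>
      (cat (n + m) p \<cdot> (cat n m \<otimes> ?p)) \<cdot> (?s \<otimes> ?p)"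
    by (simp add: endo_tens_def add.assoc)
  also have "\<dots> = (cat n (p + m) \<cdot> (?n \<otimes> cat p m)) \<cdot> ((?n \<otimes> ?t) \<cdot> Assoc C (pow n) (pow m) (pow p) \<cdot> (?s \<otimes> ?p))"
    unfolding cat_assoc by (simp add: add.assoc)
  also have "\<dots> = (cat n (p + m) \<cdot> (?n \<otimes> cat p m) \<cdot> Assoc C (pow n) (pow p) (pow m)) \<cdot>
      Symm C (pow m) (pow n \<odot> pow p) \<cdot> Assoc C (pow m) (pow n) (pow p)"
    by (subst hexagon[symmetric]) simp_all
  also have "\<dots> = cat (n + p) m \<cdot> ((cat n p \<otimes> ?m) \<cdot> Symm C (pow m) (pow n \<odot> pow p)) \<cdot> Assoc C (pow m) (pow n) (pow p)"
    unfolding cat_assoc[symmetric] by simp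
  also have "\<dots> = cat (n + p) m \<cdot> (Symm C (pow m) (pow (n + p)) \<cdot> (?m \<otimes> cat n p)) \<cdot> Assoc C (pow m) (pow n) (pow p)"
    by (subst symm_nat[of ?m "cat n p"]) simp_all
  also have "\<dots> = ?L \<cdot> cat (m + n) p \<cdot> (cat m n \<otimes> ?p)"
    unfolding cat_assoc by (simp add: add.assoc)
  finally show "?L \<cdot> cat (m + n) p \<cdot> (cat m n \<otimes> ?p) = ?R \<cdot> cat (m + n) p \<cdot> (cat m n \<otimes> ?p)" ..
qed (simp_all add: endo_tens_def add_ac)

lemma category_endo: "category endo_prop"
proof
  fix f g h :: "nat \<times> nat \<times> 'a" and k m n p
  show "\<lbrakk>f \<in> Hom endo_prop k m; g \<in> Hom endo_prop m n; h \<in> Hom endo_prop n p\<rbrakk> \<Longrightarrow>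
      (h \<cdot>\<^bsub>endo_prop\<^esub> g) \<cdot>\<^bsub>endo_prop\<^esub> f = h \<cdot>\<^bsub>endo_prop\<^esub> (g \<cdot>\<^bsub>endo_prop\<^esub> f)"
    by (elim endo_HomE) simp
qed (auto elim!: endo_HomE intro!: endo_HomI)

lemma prop_endo: "prop_category endo_prop"
proof -
  interpret E: category endo_prop by (rule category_endo)
  have iso: "iso_arrow endo_prop (n, n, Ident C (pow n))" for n
    using E.iso_ident[of n] by simp
  show ?thesis
  proof
    fix f f' g g' h :: "nat \<times> nat \<times> 'a" and k m n p m' n' p' q
    show "\<lbrakk>f \<in> Hom endo_prop m n; g \<in> Hom endo_prop m' n'\<rbrakk> \<Longrightarrow>
        f \<otimes>\<^bsub>endo_prop\<^esub> g \<in> Hom endo_prop (m \<odot>\<^bsub>endo_prop\<^esub> m') (n \<odot>\<^bsub>endo_prop\<^esub> n')"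
      by (elim endo_HomE) (auto simp: endo_tens_def intro!: endo_HomI)
    show "\<lbrakk>f \<in> Hom endo_prop m n; f' \<in> Hom endo_prop n p; g \<in> Hom endo_prop m' n'; g' \<in> Hom endo_prop n' p'\<rbrakk> \<Longrightarrow>
        (f' \<cdot>\<^bsub>endo_prop\<^esub> f) \<otimes>\<^bsub>endo_prop\<^esub> (g' \<cdot>\<^bsub>endo_prop\<^esub> g) =
        (f' \<otimes>\<^bsub>endo_prop\<^esub> g') \<cdot>\<^bsub>endo_prop\<^esub> (f \<otimes>\<^bsub>endo_prop\<^esub> g)"
      by (elim endo_HomE) (simp add: endo_tens_def)
    show "\<lbrakk>f \<in> Hom endo_prop m n; g \<in> Hom endo_prop m' n'; h \<in> Hom endo_prop k p\<rbrakk> \<Longrightarrow>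
        Assoc endo_prop n n' p \<cdot>\<^bsub>endo_prop\<^esub> ((f \<otimes>\<^bsub>endo_prop\<^esub> g) \<otimes>\<^bsub>endo_prop\<^esub> h) =
        (f \<otimes>\<^bsub>endo_prop\<^esub> (g \<otimes>\<^bsub>endo_prop\<^esub> h)) \<cdot>\<^bsub>endo_prop\<^esub> Assoc endo_prop m m' k"
      by (elim endo_HomE, simp, subst endo_tens_assoc)
        (simp_all add: Hom_def endo_tens_def add.assoc)
    show "f \<in> Hom endo_prop m n \<Longrightarrow>
        LUnit endo_prop n \<cdot>\<^bsub>endo_prop\<^esub> (Ident endo_prop (MUnit endo_prop) \<otimes>\<^bsub>endo_prop\<^esub> f) =
        f \<cdot>\<^bsub>endo_prop\<^esub> LUnit endo_prop m"
      by (elim endo_HomE) (simp add: endo_tens_def cat_zero_left comp_reduce[OF lunit_nat])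
    show "f \<in> Hom endo_prop m n \<Longrightarrow>
        RUnit endo_prop n \<cdot>\<^bsub>endo_prop\<^esub> (f \<otimes>\<^bsub>endo_prop\<^esub> Ident endo_prop (MUnit endo_prop)) =
        f \<cdot>\<^bsub>endo_prop\<^esub> RUnit endo_prop m"
      by (elim endo_HomE) (simp add: endo_tens_def comp_reduce[OF runit_nat])
    show "\<lbrakk>f \<in> Hom endo_prop m n; g \<in> Hom endo_prop m' n'\<rbrakk> \<Longrightarrow>
        Symm endo_prop n n' \<cdot>\<^bsub>endo_prop\<^esub> (f \<otimes>\<^bsub>endo_prop\<^esub> g) =
        (g \<otimes>\<^bsub>endo_prop\<^esub> f) \<cdot>\<^bsub>endo_prop\<^esub> Symm endo_prop m m'"
      by (elim endo_HomE) (simp add: endo_tens_def comp_reduce_eq[OF symm_nat])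
    show "Symm endo_prop n m \<cdot>\<^bsub>endo_prop\<^esub> Symm endo_prop m n = Ident endo_prop (m \<odot>\<^bsub>endo_prop\<^esub> n)"
      by (simp add: comp_reduce[OF symm_symm])
    show "Assoc endo_prop n p m \<cdot>\<^bsub>endo_prop\<^esub> Symm endo_prop m (n \<odot>\<^bsub>endo_prop\<^esub> p) \<cdot>\<^bsub>endo_prop\<^esub> Assoc endo_prop m n p =
        (Ident endo_prop n \<otimes>\<^bsub>endo_prop\<^esub> Symm endo_prop m p) \<cdot>\<^bsub>endo_prop\<^esub> Assoc endo_prop n m p \<cdot>\<^bsub>endo_prop\<^esub>
        (Symm endo_prop m n \<otimes>\<^bsub>endo_prop\<^esub> Ident endo_prop p)"
      using endo_hexagon[of n p m] by (simp add: endo_tens_def add_ac)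
  qed (auto simp: iso endo_tens_def add_ac intro!: endo_HomI)
qed

lemma endo_functor_simps:
  "FObj endo_functor = pow" "FTens endo_functor = cat" "FUnit endo_functor = Ident C (MUnit C)"
  "f \<in> Hom C (pow m) (pow n) \<Longrightarrow> FArr endo_functor (m, n, f) = f"
  by (simp_all add: endo_functor_def)

lemma prop_algebra_endo: "prop_algebra endo_prop C endo_functor"
proof -
  interpret E: prop_category endo_prop by (rule prop_endo)
  have hom: "snd (snd f) \<in> Hom C (pow m) (pow n)" if "f \<in> Hom endo_prop m n" for f m n
    using that by (auto elim!: endo_HomE intro!: HomI)
  show ?thesis
  proof
    fix f g :: "nat \<times> nat \<times> 'a" and m n p m' n'
    show "f \<in> Hom endo_prop m n \<Longrightarrow> FArr endo_functor f \<in> Hom C (FObj endo_functor m) (FObj endo_functor n)"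
      using hom[of f m n] by (auto simp: endo_functor_def Hom_def)
    show "FArr endo_functor (Ident endo_prop m) = Ident C (FObj endo_functor m)"
      by (simp add: endo_functor_def Hom_def)
    show "\<lbrakk>f \<in> Hom endo_prop m n; g \<in> Hom endo_prop n p\<rbrakk> \<Longrightarrow>
        FArr endo_functor (g \<cdot>\<^bsub>endo_prop\<^esub> f) = FArr endo_functor g \<cdot> FArr endo_functor f"
      by (elim endo_HomE) (simp add: endo_functor_def Hom_def)
    show "\<lbrakk>f \<in> Hom endo_prop m n; g \<in> Hom endo_prop m' n'\<rbrakk> \<Longrightarrow>
        FTens endo_functor n n' \<cdot> (FArr endo_functor f \<otimes> FArr endo_functor g) =
        FArr endo_functor (f \<otimes>\<^bsub>endo_prop\<^esub> g) \<cdot> FTens endo_functor m m'"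
      by (elim endo_HomE) (simp add: endo_functor_def Hom_def endo_tens_def)
    show "FArr endo_functor (Assoc endo_prop m n p) \<cdot> FTens endo_functor (m \<odot>\<^bsub>endo_prop\<^esub> n) p \<cdot>
          (FTens endo_functor m n \<otimes> Ident C (FObj endo_functor p)) =
        FTens endo_functor m (n \<odot>\<^bsub>endo_prop\<^esub> p) \<cdot>
          (Ident C (FObj endo_functor m) \<otimes> FTens endo_functor n p) \<cdot>
          Assoc C (FObj endo_functor m) (FObj endo_functor n) (FObj endo_functor p)"
      by (simp add: endo_functor_def Hom_def cat_assoc add.assoc)
  qed (auto simp: endo_functor_def Hom_def cat_zero_left)
qed

text \<open>The factors \<open>cat (Suc 0) (Suc 0)\<close> are inserted to cancel against the
  structure isomorphism in \<open>image_bimonoid\<close>, so that the image is exactly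
  \<open>X\<close>.\<close>

definition endo_bimonoid :: "('o, 'a) bimonoid_data \<Rightarrow> (nat, nat \<times> nat \<times> 'a) bimonoid_data" where
  "endo_bimonoid X = \<lparr>carr = 1,
     bmul = (Suc (Suc 0), Suc 0, bmul X \<cdot> inv_arrow C (cat (Suc 0) (Suc 0))), bone = (0, Suc 0, bone X),
     bcomul = (Suc 0, Suc (Suc 0), cat (Suc 0) (Suc 0) \<cdot> bcomul X), bcounit = (Suc 0, 0, bcounit X)\<rparr>"

lemma endo_bimonoid:
  assumes "bicommutative_bimonoid C X" and carr: "carr X = A"
  shows "prop_bimonoid endo_prop (endo_bimonoid X)"
    "prop_algebra.image_bimonoid C endo_functor (endo_bimonoid X) = X"
proof -
  interpret E: prop_category endo_prop by (rule prop_endo)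
  interpret F: prop_algebra endo_prop C endo_functor by (rule prop_algebra_endo)
  interpret X: bicommutative_bimonoid C X by fact
  note [simp] = HomD[OF X.mul_hom, simplified carr] HomD[OF X.one_hom, simplified carr]
    HomD[OF X.comul_hom, simplified carr] HomD[OF X.counit_hom, simplified carr]
  have c: "cat (Suc 0) (Suc 0) \<in> Arr C" "Dom C (cat (Suc 0) (Suc 0)) = A \<odot> A"
    "Cod C (cat (Suc 0) (Suc 0)) = A \<odot> A" "iso_arrow C (cat (Suc 0) (Suc 0))"
    using cat_arr[of "Suc 0" "Suc 0"] by (simp_all del: cat.simps)
  show image: "F.image_bimonoid (endo_bimonoid X) = X"
    by (rule bimonoid_data.equality)
      (simp_all add: F.image_bimonoid_def endo_bimonoid_def endo_functor_simps HomI c carr del: cat.simps)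
  interpret Y: prop_algebra_bimonoid endo_prop C endo_functor "endo_bimonoid X" 1
    by unfold_locales (simp_all add: endo_bimonoid_def Hom_def c del: cat.simps)
  \<comment> \<open>Between fixed exponents an arrow is determined by its underlying arrow of
    \<open>C\<close>; faithfulness lets the axioms be reflected.\<close>
  have "inj_on (FArr endo_functor) (Hom endo_prop m n)" for m n
    by (rule inj_onI, elim endo_HomE) (simp add: endo_functor_simps Hom_def)
  moreover have "bicommutative_bimonoid C (F.image_bimonoid (endo_bimonoid X))"
    unfolding image by fact
  ultimately have "bicommutative_bimonoid endo_prop (endo_bimonoid X)"
    by (rule Y.image_bimonoid_reflected)
  then show "prop_bimonoid endo_prop (endo_bimonoid X)"
    by (intro prop_bimonoid.intro prop_bimonoid_axioms.intro prop_endo) (simp_all add: endo_bimonoid_def)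
qed

end

context prop_bimonoid
begin

text \<open>The functor from \<open>FinSpan\<close> induced by \<open>X\<close> sends the generating
  bimonoid to \<open>X\<close> on the nose.\<close>

lemma matrix_generators:
  "matrix (Suc (Suc 0)) (Suc 0) (\<lambda>i j. 1) = \<mu>" "matrix 0 (Suc 0) (\<lambda>i j. 1) = \<eta>"
  "matrix (Suc 0) (Suc (Suc 0)) (\<lambda>i j. 1) = \<Delta>" "matrix (Suc 0) 0 (\<lambda>i j. 1) = \<epsilon>"
proof -
  have one: "matrix m (Suc 0) M = row m (M 0)" for m M
    by (simp add: del_copy_left)
  have 1: "row (Suc 0) (\<lambda>j. Suc 0) = I (Suc 0)"
    using scalar_one by (simp add: strict_mul_axioms)
  show "matrix (Suc (Suc 0)) (Suc 0) (\<lambda>i j. 1) = \<mu>"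
    unfolding one row.simps(2)[of "Suc 0"] using scalar_one 1 by (simp del: row.simps scalar.simps)
  show "matrix 0 (Suc 0) (\<lambda>i j. 1) = \<eta>"
    unfolding one by simp
  show "matrix (Suc 0) (Suc (Suc 0)) (\<lambda>i j. 1) = \<Delta>"
    unfolding matrix.simps(2)[of _ "Suc 0"] one using 1 by (simp del: row.simps)
qed simp

text \<open>An arrow determines its matrix only within range. By \<open>matrix_cong\<close> the
  arbitrary choice of the remaining entries does not affect the result.\<close>

definition span_arrow :: "nat \<times> nat \<times> nat span set \<Rightarrow> 'a" where
  "span_arrow x = matrix (Dom FinSpan x) (Cod FinSpan x)
     (SOME M. x = matrix_arrow (Dom FinSpan x) (Cod FinSpan x) M)"

lemma span_arrow_matrix [simp]: "span_arrow (matrix_arrow m n M) = matrix m n M"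
proof -
  have "matrix_arrow m n M = matrix_arrow m n (SOME N. matrix_arrow m n M = matrix_arrow m n N)"
    using someI[of "\<lambda>N. matrix_arrow m n M = matrix_arrow m n N" M] by simp
  then show ?thesis
    unfolding span_arrow_def matrix_arrow_simps by (intro matrix_cong) (simp add: matrix_arrow_eq_iff)
qed

lemma span_arrow_tens:
  "span_arrow (matrix_arrow m n M \<otimes>\<^bsub>FinSpan\<^esub> matrix_arrow m' n' N) = matrix m n M \<otimes> matrix m' n' N"
  unfolding FinSpan_TensA span_arrow_matrix matrix_tens[symmetric] by (rule matrix_cong) (simp add: block_sum_def)

lemma span_arrow_ident [simp]: "span_arrow (Ident FinSpan n) = I n"
  unfolding FinSpan_Ident span_arrow_matrix matrix_ident[symmetric] by (rule matrix_cong) (simp add: fun_matrix_def)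

lemma span_arrow_symm [simp]: "span_arrow (Symm FinSpan m n) = Symm T m n"
  unfolding FinSpan_Symm span_arrow_matrix matrix_symm[symmetric] by (rule matrix_cong) (simp add: fun_matrix_def)

text \<open>The composite of \<open>K\<close> with the matrix action from \<open>FinSpan\<close> to
  \<open>T\<close>. That action is strict and fixes the objects, so the structure isomorphisms are
  those of \<open>K\<close>.\<close>

definition span_functor :: "(nat, 'a, 'p, 'c) smf_data \<Rightarrow> (nat, nat \<times> nat \<times> nat span set, 'p, 'c) smf_data" where
  "span_functor K = \<lparr>FObj = FObj K, FArr = (\<lambda>x\<in>Arr FinSpan. FArr K (span_arrow x)),
     FTens = FTens K, FUnit = FUnit K\<rparr>"

lemma prop_algebra_span_functor:
  fixes D :: "('p, 'c, 'y) smc_data_scheme"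
  assumes "prop_algebra T D K"
  shows "prop_algebra FinSpan D (span_functor K)"
    "prop_algebra.image_bimonoid D (span_functor K) FinSpan_bimonoid = prop_algebra.image_bimonoid D K X"
proof -
  interpret K: prop_algebra T D K by fact
  have [simp]: "FArr (span_functor K) (matrix_arrow m n M) = FArr K (matrix m n M)" for m n M
    by (simp add: span_functor_def)
  have [simp]: "FArr (span_functor K) (Ident FinSpan n) = Ident D (FObj K n)" for n
    by (simp add: span_functor_def)
  have [simp]: "FArr (span_functor K) (Symm FinSpan m n) = FArr K (Symm T m n)" for m n
    by (simp add: span_functor_def)
  have [simp]: "FObj (span_functor K) = FObj K" "FTens (span_functor K) = FTens K" "FUnit (span_functor K) = FUnit K"
    by (simp_all add: span_functor_def)
  show "prop_algebra FinSpan D (span_functor K)"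
  proof
    fix f g :: "nat \<times> nat \<times> nat span set" and m n p m' n'
    show "FArr (span_functor K) \<in> extensional (Arr FinSpan)"
      by (simp add: span_functor_def)
    show "f \<in> Hom FinSpan m n \<Longrightarrow> FArr (span_functor K) f \<in> Hom D (FObj (span_functor K) m) (FObj (span_functor K) n)"
      by (elim FinSpan_HomE) (simp add: Hom_def)
    show "\<lbrakk>f \<in> Hom FinSpan m n; g \<in> Hom FinSpan n p\<rbrakk> \<Longrightarrow> FArr (span_functor K) (g \<cdot>\<^bsub>FinSpan\<^esub> f) =
        FArr (span_functor K) g \<cdot>\<^bsub>D\<^esub> FArr (span_functor K) f"
      by (elim FinSpan_HomE) (simp add: FinSpan_Comp matrix_comp)
    show "\<lbrakk>f \<in> Hom FinSpan m n; g \<in> Hom FinSpan m' n'\<rbrakk> \<Longrightarrow>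
        FTens (span_functor K) n n' \<cdot>\<^bsub>D\<^esub> (FArr (span_functor K) f \<otimes>\<^bsub>D\<^esub> FArr (span_functor K) g) =
        FArr (span_functor K) (f \<otimes>\<^bsub>FinSpan\<^esub> g) \<cdot>\<^bsub>D\<^esub> FTens (span_functor K) m m'"
    proof (elim FinSpan_HomE)
      fix M N assume fg: "f = matrix_arrow m n M" "g = matrix_arrow m' n' N"
      have "FArr (span_functor K) (f \<otimes>\<^bsub>FinSpan\<^esub> g) = FArr K (matrix m n M \<otimes> matrix m' n' N)"
        unfolding fg span_arrow_tens[symmetric] by (simp add: span_functor_def FinSpan_TensA)
      then show ?thesis
        using K.ftens_natural[of "matrix m n M" m n "matrix m' n' N" m' n'] by (simp add: fg Hom_def)
    qed
  qed (use K.ftens_assoc K.lunit_eq K.runit_eq K.ftens_symm in \<open>auto simp: add.assoc Hom_def\<close>)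
  then interpret L: prop_algebra FinSpan D "span_functor K" .
  show "L.image_bimonoid FinSpan_bimonoid = K.image_bimonoid X"
    using matrix_generators carr_one unfolding L.image_bimonoid_def K.image_bimonoid_def
    by (simp del: matrix.simps)
qed

end

section \<open>Bimonoid homomorphisms as monoidal transformations\<close>

text \<open>The assumption on arrows makes the bimonoid generate \<open>T\<close>, so naturality has
  to be checked on its structure arrows only.\<close>

locale algebra_pair = X: prop_bimonoid T X + F: prop_algebra T C F + G: prop_algebra T C G
  for T :: "(nat, 'a, 'z) smc_data_scheme"
  and C :: "('o, 'b, 'y) smc_data_scheme" (structure)
  and X F G +
  assumes generated: "f \<in> Hom T m n \<Longrightarrow> \<exists>M. f = X.matrix m n M"
begin

abbreviation "hom \<equiv> bimonoid_hom C (F.image_bimonoid X) (G.image_bimonoid X)"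

lemma hom_iff:
  "hom h \<longleftrightarrow> h \<in> Hom C (FObj F (Suc 0)) (FObj G (Suc 0)) \<and>
     (FArr G (bmul X) \<cdot> G.\<phi> (Suc 0) (Suc 0)) \<cdot> (h \<otimes> h) = h \<cdot> FArr F (bmul X) \<cdot> F.\<phi> (Suc 0) (Suc 0) \<and>
     h \<cdot> FArr F (bone X) \<cdot> F.u = FArr G (bone X) \<cdot> G.u \<and>
     (inv_arrow C (G.\<phi> (Suc 0) (Suc 0)) \<cdot> FArr G (bcomul X)) \<cdot> h =
       (h \<otimes> h) \<cdot> inv_arrow C (F.\<phi> (Suc 0) (Suc 0)) \<cdot> FArr F (bcomul X) \<and>
     (inv_arrow C G.u \<cdot> FArr G (bcounit X)) \<cdot> h = inv_arrow C F.u \<cdot> FArr F (bcounit X)"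
  by (simp add: bimonoid_hom_def F.image_bimonoid_def G.image_bimonoid_def X.carr_one)

text \<open>Both clauses are forced: they are the unit and tensor conditions on a monoidal
  transformation, solved for the components at \<open>0\<close> and at \<open>Suc n\<close>.\<close>

primrec extend :: "'b \<Rightarrow> nat \<Rightarrow> 'b" where
  "extend h 0 = G.u \<cdot> inv_arrow C F.u"
| "extend h (Suc n) = G.\<phi> n (Suc 0) \<cdot> (extend h n \<otimes> h) \<cdot> inv_arrow C (F.\<phi> n (Suc 0))"

context
  fixes h
  assumes h: "hom h"
begin

lemma h_simps [simp]: "h \<in> Arr C" "Dom C h = FObj F (Suc 0)" "Cod C h = FObj G (Suc 0)"
  using h by (auto simp: hom_iff Hom_def)

lemma extend_simps [simp]:
  "extend h n \<in> Arr C \<and> Dom C (extend h n) = FObj F n \<and> Cod C (extend h n) = FObj G n"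
  by (induction n) simp_all

text \<open>The recursion reaches \<open>1\<close> through \<open>0\<close>, so a left unitor of
  \<open>G\<close> and the inverse of one of \<open>F\<close> appear; naturality cancels
  them.\<close>

lemma extend_one: "extend h (Suc 0) = h"
proof -
  have F: "inv_arrow C (LUnit C (FObj F (Suc 0))) =
      (inv_arrow C F.u \<otimes> F.i (Suc 0)) \<cdot> inv_arrow C (F.\<phi> 0 (Suc 0))"
    unfolding F.lunit_eq by (subst F.C.inv_comp) (simp_all add: F.C.inv_tens)
  have "G.\<phi> 0 (Suc 0) \<cdot> (G.u \<otimes> h) = (G.\<phi> 0 (Suc 0) \<cdot> (G.u \<otimes> G.i (Suc 0))) \<cdot> (Ident C (MUnit C) \<otimes> h)"
    by simp
  also have "\<dots> = h \<cdot> LUnit C (FObj F (Suc 0))"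
    unfolding G.lunit_eq[symmetric] by (simp add: F.C.lunit_nat)
  finally have G: "G.\<phi> 0 (Suc 0) \<cdot> (G.u \<otimes> h) = h \<cdot> LUnit C (FObj F (Suc 0))" .
  have "extend h (Suc 0) =
      (G.\<phi> 0 (Suc 0) \<cdot> (G.u \<otimes> h)) \<cdot> ((inv_arrow C F.u \<otimes> F.i (Suc 0)) \<cdot> inv_arrow C (F.\<phi> 0 (Suc 0)))"
    by simp
  then show ?thesis unfolding G F[symmetric] by simp
qed

text \<open>The recursion only splits off a last factor. Induction on \<open>n\<close> and
  associativity of the comparison maps of \<open>F\<close> and \<open>G\<close> give arbitrary
  splittings.\<close>

lemma extend_tens: "extend h (m + n) \<cdot> F.\<phi> m n = G.\<phi> m n \<cdot> (extend h m \<otimes> extend h n)"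
proof (induction n)
  case 0
  show ?case
  proof (rule F.C.iso_cancel_right[where e = "F.i m \<otimes> F.u"])
    have "(G.\<phi> m 0 \<cdot> (extend h m \<otimes> extend h 0)) \<cdot> (F.i m \<otimes> F.u) =
        (G.\<phi> m 0 \<cdot> (G.i m \<otimes> G.u)) \<cdot> (extend h m \<otimes> Ident C (MUnit C))"
      by simp
    also have "\<dots> = extend h m \<cdot> RUnit C (FObj F m)"
      unfolding G.runit_eq[symmetric] by (simp add: F.C.runit_nat)
    finally show "(extend h (m + 0) \<cdot> F.\<phi> m 0) \<cdot> (F.i m \<otimes> F.u) =
        (G.\<phi> m 0 \<cdot> (extend h m \<otimes> extend h 0)) \<cdot> (F.i m \<otimes> F.u)"
      by (simp add: F.runit_eq)
  qed simp_all
next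
  case (Suc n)
  let ?\<alpha> = "Assoc C (FObj F m) (FObj F n) (FObj F (Suc 0))"
  let ?\<beta> = "Assoc C (FObj G m) (FObj G n) (FObj G (Suc 0))"
  show ?case
  proof (rule F.C.iso_cancel_right[where e = "(F.i m \<otimes> F.\<phi> n (Suc 0)) \<cdot> ?\<alpha>"])
    have "(extend h (m + Suc n) \<cdot> F.\<phi> m (Suc n)) \<cdot> (F.i m \<otimes> F.\<phi> n (Suc 0)) \<cdot> ?\<alpha> =
        extend h (m + Suc n) \<cdot> (F.\<phi> m (n + Suc 0) \<cdot> (F.i m \<otimes> F.\<phi> n (Suc 0)) \<cdot> ?\<alpha>)"
      by (simp del: extend.simps)
    also have "\<dots> = G.\<phi> (m + n) (Suc 0) \<cdot> ((extend h (m + n) \<cdot> F.\<phi> m n) \<otimes> h)"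
      unfolding F.ftens_assoc[symmetric] by simp
    also have "\<dots> = (G.\<phi> (m + n) (Suc 0) \<cdot> (G.\<phi> m n \<otimes> G.i (Suc 0))) \<cdot> ((extend h m \<otimes> extend h n) \<otimes> h)"
      unfolding Suc by simp
    also have "\<dots> = G.\<phi> m (Suc n) \<cdot> (G.i m \<otimes> G.\<phi> n (Suc 0)) \<cdot> ?\<beta> \<cdot> ((extend h m \<otimes> extend h n) \<otimes> h)"
      unfolding G.ftens_assoc by simp
    also have "\<dots> = G.\<phi> m (Suc n) \<cdot> (G.i m \<otimes> G.\<phi> n (Suc 0)) \<cdot> (extend h m \<otimes> extend h n \<otimes> h) \<cdot> ?\<alpha>"
      by (subst F.C.assoc_nat) simp_all
    also have "\<dots> = (G.\<phi> m (Suc n) \<cdot> (extend h m \<otimes> extend h (Suc n))) \<cdot> (F.i m \<otimes> F.\<phi> n (Suc 0)) \<cdot> ?\<alpha>"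
      by simp
    finally show "(extend h (m + Suc n) \<cdot> F.\<phi> m (Suc n)) \<cdot> (F.i m \<otimes> F.\<phi> n (Suc 0)) \<cdot> ?\<alpha> =
        (G.\<phi> m (Suc n) \<cdot> (extend h m \<otimes> extend h (Suc n))) \<cdot> (F.i m \<otimes> F.\<phi> n (Suc 0)) \<cdot> ?\<alpha>" .
  qed simp_all
qed

text \<open>The class of arrows at which the extension is natural. It contains the symmetries and
  the structure arrows and is closed under composition and tensor, hence contains all
  matrices.\<close>

definition natural :: "'a \<Rightarrow> bool" where
  "natural f \<longleftrightarrow> f \<in> Arr T \<and> extend h (Cod T f) \<cdot> FArr F f = FArr G f \<cdot> extend h (Dom T f)"

lemma naturalD: "natural f \<Longrightarrow> f \<in> Arr T"
  "natural f \<Longrightarrow> extend h (Cod T f) \<cdot> FArr F f = FArr G f \<cdot> extend h (Dom T f)"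
  by (simp_all add: natural_def)

lemma natural_ident: "natural (Ident T n)"
  by (simp add: natural_def)

lemma natural_comp:
  assumes f: "natural f" and g: "natural g" and "Dom T g = Cod T f"
  shows "natural (g \<cdot>\<^bsub>T\<^esub> f)"
proof -
  note [simp] = naturalD(1)[OF f] naturalD(1)[OF g]
  have "extend h (Cod T g) \<cdot> FArr F g \<cdot> FArr F f = FArr G g \<cdot> extend h (Cod T f) \<cdot> FArr F f"
    using F.C.comp_reduce[OF naturalD(2)[OF g], of "FArr F f"] assms(3) by (simp del: F.FArr_comp)
  also have "\<dots> = FArr G g \<cdot> FArr G f \<cdot> extend h (Dom T f)"
    by (simp only: naturalD(2)[OF f])
  finally show ?thesis using assms(3) by (simp add: natural_def)
qed

lemma natural_tens:
  assumes f: "natural f" and g: "natural g"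
  shows "natural (f \<otimes>\<^bsub>T\<^esub> g)"
proof -
  note [simp] = naturalD(1)[OF f] naturalD(1)[OF g]
  let ?m = "Dom T f" and ?n = "Cod T f" and ?p = "Dom T g" and ?q = "Cod T g"
  have F: "F.\<phi> ?n ?q \<cdot> (FArr F f \<otimes> FArr F g) = FArr F (f \<otimes>\<^bsub>T\<^esub> g) \<cdot> F.\<phi> ?m ?p"
    by (rule F.ftens_natural) (simp_all add: Hom_def)
  have G: "G.\<phi> ?n ?q \<cdot> (FArr G f \<otimes> FArr G g) = FArr G (f \<otimes>\<^bsub>T\<^esub> g) \<cdot> G.\<phi> ?m ?p"
    by (rule G.ftens_natural) (simp_all add: Hom_def)
  have "extend h (?n + ?q) \<cdot> FArr F (f \<otimes>\<^bsub>T\<^esub> g) = FArr G (f \<otimes>\<^bsub>T\<^esub> g) \<cdot> extend h (?m + ?p)"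
  proof (rule F.C.iso_cancel_right[where e = "F.\<phi> ?m ?p"])
    have "(extend h (?n + ?q) \<cdot> FArr F (f \<otimes>\<^bsub>T\<^esub> g)) \<cdot> F.\<phi> ?m ?p =
        (extend h (?n + ?q) \<cdot> F.\<phi> ?n ?q) \<cdot> (FArr F f \<otimes> FArr F g)"
      by (simp add: F)
    also have "\<dots> = G.\<phi> ?n ?q \<cdot> ((extend h ?n \<cdot> FArr F f) \<otimes> (extend h ?q \<cdot> FArr F g))"
      unfolding extend_tens by simp
    also have "\<dots> = (G.\<phi> ?n ?q \<cdot> (FArr G f \<otimes> FArr G g)) \<cdot> (extend h ?m \<otimes> extend h ?p)"
      using naturalD(2)[OF f] naturalD(2)[OF g] by simp
    also have "\<dots> = FArr G (f \<otimes>\<^bsub>T\<^esub> g) \<cdot> (G.\<phi> ?m ?p \<cdot> (extend h ?m \<otimes> extend h ?p))"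
      unfolding G by simp
    also have "\<dots> = (FArr G (f \<otimes>\<^bsub>T\<^esub> g) \<cdot> extend h (?m + ?p)) \<cdot> F.\<phi> ?m ?p"
      unfolding extend_tens[symmetric] by simp
    finally show "(extend h (?n + ?q) \<cdot> FArr F (f \<otimes>\<^bsub>T\<^esub> g)) \<cdot> F.\<phi> ?m ?p =
        (FArr G (f \<otimes>\<^bsub>T\<^esub> g) \<cdot> extend h (?m + ?p)) \<cdot> F.\<phi> ?m ?p" .
  qed simp_all
  then show ?thesis by (simp add: natural_def)
qed

lemma natural_symm: "natural (Symm T m n)"
proof -
  let ?s = "Symm T m n"
  have "extend h (n + m) \<cdot> FArr F ?s = FArr G ?s \<cdot> extend h (m + n)"
  proof (rule F.C.iso_cancel_right[where e = "F.\<phi> m n"])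
    have "(extend h (n + m) \<cdot> FArr F ?s) \<cdot> F.\<phi> m n =
        (extend h (n + m) \<cdot> F.\<phi> n m) \<cdot> Symm C (FObj F m) (FObj F n)"
      by (simp add: F.ftens_symm)
    also have "\<dots> = G.\<phi> n m \<cdot> ((extend h n \<otimes> extend h m) \<cdot> Symm C (FObj F m) (FObj F n))"
      unfolding extend_tens by simp
    also have "\<dots> = G.\<phi> n m \<cdot> Symm C (FObj G m) (FObj G n) \<cdot> (extend h m \<otimes> extend h n)"
      using F.C.symm_nat[of "extend h m" "extend h n"] by simp
    also have "\<dots> = FArr G ?s \<cdot> (G.\<phi> m n \<cdot> (extend h m \<otimes> extend h n))"
      using F.C.comp_reduce[OF G.ftens_symm[of n m], of "extend h m \<otimes> extend h n"] by simp
    also have "\<dots> = (FArr G ?s \<cdot> extend h (m + n)) \<cdot> F.\<phi> m n"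
      unfolding extend_tens[symmetric] by (simp add: add.commute)
    finally show "(extend h (n + m) \<cdot> FArr F ?s) \<cdot> F.\<phi> m n = (FArr G ?s \<cdot> extend h (m + n)) \<cdot> F.\<phi> m n" .
  qed (simp_all add: add.commute)
  then show ?thesis by (simp add: natural_def)
qed

lemma extend_two: "extend h (Suc (Suc 0)) \<cdot> F.\<phi> (Suc 0) (Suc 0) = G.\<phi> (Suc 0) (Suc 0) \<cdot> (h \<otimes> h)"
  using extend_tens[of "Suc 0" "Suc 0"] unfolding extend_one by simp

text \<open>These are the four homomorphism equations for \<open>h\<close>, with the structure
  isomorphisms of \<open>F\<close> and \<open>G\<close> moved across.\<close>

lemma natural_generators:
  "natural (bmul X)" "natural (bone X)" "natural (bcomul X)" "natural (bcounit X)"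
proof -
  let ?\<phi> = "F.\<phi> (Suc 0) (Suc 0)"
  note [simp del] = extend.simps(2)
  note [simp] = extend_one
  have "extend h (Suc 0) \<cdot> FArr F (bmul X) = FArr G (bmul X) \<cdot> extend h (Suc (Suc 0))"
    by (rule F.C.iso_cancel_right[where e = ?\<phi>]) (use h in \<open>simp_all add: extend_two hom_iff\<close>)
  then show "natural (bmul X)" by (simp add: natural_def)
  have "h \<cdot> FArr F (bone X) = FArr G (bone X) \<cdot> extend h 0"
    by (rule F.C.iso_cancel_right[where e = F.u]) (use h in \<open>simp_all add: hom_iff\<close>)
  then show "natural (bone X)" by (simp add: natural_def)
  have "FArr G (bcomul X) \<cdot> h = G.\<phi> (Suc 0) (Suc 0) \<cdot> (inv_arrow C (G.\<phi> (Suc 0) (Suc 0)) \<cdot> FArr G (bcomul X)) \<cdot> h"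
    by simp
  also have "\<dots> = (G.\<phi> (Suc 0) (Suc 0) \<cdot> (h \<otimes> h)) \<cdot> inv_arrow C ?\<phi> \<cdot> FArr F (bcomul X)"
    using h by (simp add: hom_iff)
  also have "\<dots> = extend h (Suc (Suc 0)) \<cdot> FArr F (bcomul X)"
    unfolding extend_two[symmetric] by simp
  finally show "natural (bcomul X)" by (simp add: natural_def)
  have "FArr G (bcounit X) \<cdot> h = G.u \<cdot> (inv_arrow C G.u \<cdot> FArr G (bcounit X)) \<cdot> h"
    by simp
  also have "\<dots> = extend h 0 \<cdot> FArr F (bcounit X)"
    using h by (simp add: hom_iff)
  finally show "natural (bcounit X)" by (simp add: natural_def)
qed

lemma natural_matrix: "natural (X.matrix m n M)"
proof -
  note n = natural_ident natural_tens natural_symm natural_generators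
  have scalar: "natural (X.scalar k)" for k
    by (induction k) (simp_all add: n natural_comp)
  have row: "natural (X.row m r)" for m r
    by (induction m) (simp_all add: n natural_comp scalar)
  have copy: "natural (X.copy m)" for m
    by (induction m) (simp_all add: X.mid_def n natural_comp)
  have del: "natural (X.del m)" for m
    by (induction m) (simp_all add: n)
  show ?thesis
    by (induction n) (simp_all add: n natural_comp row copy del)
qed

lemma extend_monoidal_nat_trans: "monoidal_nat_trans T C F G (extend h)"
proof -
  have "natural f" if "f \<in> Arr T" for f
  proof -
    from that obtain M where M: "f = X.matrix (Dom T f) (Cod T f) M"
      using generated[of f "Dom T f" "Cod T f"] by (auto simp: Hom_def)
    show ?thesis by (subst M) (rule natural_matrix)
  qed
  then show ?thesis
    using extend_tens by (auto simp: monoidal_nat_trans_def nat_trans_def Hom_def dest: naturalD(2))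
qed

end

text \<open>Naturality at the structure arrows makes the component at \<open>1\<close> a
  homomorphism. The tensor and unit conditions are the recursion for \<open>extend\<close>, so that
  component determines all others.\<close>

lemma monoidal_nat_trans_hom:
  assumes "monoidal_nat_trans T C F G \<theta>"
  shows "hom (\<theta> (Suc 0))" "\<theta> = extend (\<theta> (Suc 0))"
proof -
  have nat: "\<theta> (Cod T f) \<cdot> FArr F f = FArr G f \<cdot> \<theta> (Dom T f)" if "f \<in> Arr T" for f
    using assms that by (auto simp: monoidal_nat_trans_def nat_trans_def)
  have [simp]: "\<theta> n \<in> Arr C" "Dom C (\<theta> n) = FObj F n" "Cod C (\<theta> n) = FObj G n" for n
    using assms by (auto simp: monoidal_nat_trans_def nat_trans_def Hom_def)
  have tens: "\<theta> (m + n) \<cdot> F.\<phi> m n = G.\<phi> m n \<cdot> (\<theta> m \<otimes> \<theta> n)" for m n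
    using assms by (auto simp: monoidal_nat_trans_def)
  have unit: "\<theta> 0 \<cdot> F.u = G.u"
    using assms by (auto simp: monoidal_nat_trans_def)
  have tens': "\<theta> (m + n) = G.\<phi> m n \<cdot> (\<theta> m \<otimes> \<theta> n) \<cdot> inv_arrow C (F.\<phi> m n)" for m n
    using F.C.iso_transpose_right[OF tens[of m n]] by simp
  have unit': "\<theta> 0 = G.u \<cdot> inv_arrow C F.u"
    using F.C.iso_transpose_right[OF unit] by simp
  show "\<theta> = extend (\<theta> (Suc 0))"
  proof
    fix n show "\<theta> n = extend (\<theta> (Suc 0)) n"
    proof (induction n)
      case (Suc n)
      then show ?case using tens'[of n "Suc 0"] by simp
    qed (simp add: unit')
  qed
  show "hom (\<theta> (Suc 0))"
    unfolding hom_iff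
  proof (intro conjI)
    let ?h = "\<theta> (Suc 0)"
    show "?h \<in> Hom C (FObj F (Suc 0)) (FObj G (Suc 0))" by (simp add: Hom_def)
    have "?h \<cdot> FArr F (bmul X) \<cdot> F.\<phi> (Suc 0) (Suc 0) =
        FArr G (bmul X) \<cdot> \<theta> (Suc 0 + Suc 0) \<cdot> F.\<phi> (Suc 0) (Suc 0)"
      using F.C.comp_reduce[OF nat[of "bmul X"], of "F.\<phi> (Suc 0) (Suc 0)"] by simp
    then show "(FArr G (bmul X) \<cdot> G.\<phi> (Suc 0) (Suc 0)) \<cdot> (?h \<otimes> ?h) = ?h \<cdot> FArr F (bmul X) \<cdot> F.\<phi> (Suc 0) (Suc 0)"
      unfolding tens by simp
    show "?h \<cdot> FArr F (bone X) \<cdot> F.u = FArr G (bone X) \<cdot> G.u"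
      using F.C.comp_reduce[OF nat[of "bone X"], of F.u] by (simp add: unit)
    have "inv_arrow C (G.\<phi> (Suc 0) (Suc 0)) \<cdot> \<theta> (Suc 0 + Suc 0) \<cdot> FArr F (bcomul X) =
        (?h \<otimes> ?h) \<cdot> inv_arrow C (F.\<phi> (Suc 0) (Suc 0)) \<cdot> FArr F (bcomul X)"
      unfolding tens'[of "Suc 0" "Suc 0"] by simp
    then show "(inv_arrow C (G.\<phi> (Suc 0) (Suc 0)) \<cdot> FArr G (bcomul X)) \<cdot> ?h =
        (?h \<otimes> ?h) \<cdot> inv_arrow C (F.\<phi> (Suc 0) (Suc 0)) \<cdot> FArr F (bcomul X)"
      using nat[of "bcomul X"] by simp
    have "(inv_arrow C G.u \<cdot> FArr G (bcounit X)) \<cdot> ?h = inv_arrow C G.u \<cdot> \<theta> 0 \<cdot> FArr F (bcounit X)"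
      using nat[of "bcounit X"] by simp
    then show "(inv_arrow C G.u \<cdot> FArr G (bcounit X)) \<cdot> ?h = inv_arrow C F.u \<cdot> FArr F (bcounit X)"
      unfolding unit' by simp
  qed
qed

end

section \<open>The equivalence\<close>

text \<open>With strict surjectivity the chosen preimages satisfy \<open>FObj F (S Y) = Y\<close>.
  The inverse functor lifts arrows by fullness, and its laws follow from faithfulness.\<close>

lemma equivalent_categoriesI:
  fixes F :: "('o, 'a, 'p, 'b) functor_data"
  assumes "cat_functor D E F"
    and surj: "\<And>Y. Y \<in> Obj E \<Longrightarrow> \<exists>X\<in>Obj D. FObj F X = Y"
    and full: "\<And>A B g. \<lbrakk>A \<in> Obj D; B \<in> Obj D; g \<in> Hom E (FObj F A) (FObj F B)\<rbrakk> \<Longrightarrow>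
      \<exists>f\<in>Hom D A B. FArr F f = g"
    and faithful: "\<And>A B. \<lbrakk>A \<in> Obj D; B \<in> Obj D\<rbrakk> \<Longrightarrow> inj_on (FArr F) (Hom D A B)"
  shows "equivalent_categories D E"
proof -
  interpret F: cat_functor D E F by fact
  obtain S where S: "\<And>Y. Y \<in> Obj E \<Longrightarrow> S Y \<in> Obj D" "\<And>Y. Y \<in> Obj E \<Longrightarrow> FObj F (S Y) = Y"
    using surj by metis
  obtain L where "\<forall>A B g. A \<in> Obj D \<longrightarrow> B \<in> Obj D \<longrightarrow> g \<in> Hom E (FObj F A) (FObj F B) \<longrightarrow>
      L A B g \<in> Hom D A B \<and> FArr F (L A B g) = g"
    using full by metis
  then have L: "L A B g \<in> Hom D A B" "FArr F (L A B g) = g"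
    if "A \<in> Obj D" "B \<in> Obj D" "g \<in> Hom E (FObj F A) (FObj F B)" for A B g
    using that by blast+
  have eqI: "f = g" if "FArr F f = FArr F g" "f \<in> Hom D A B" "g \<in> Hom D A B" for f g A B
  proof -
    have "A \<in> Obj D" "B \<in> Obj D"
      using F.D.HomD[OF that(2)] F.D.dom_obj F.D.cod_obj by auto
    with faithful that show ?thesis by (auto dest: inj_onD)
  qed
  define G :: "('p, 'b, 'o, 'a) functor_data" where
    "G = \<lparr>FObj = (\<lambda>Y\<in>Obj E. S Y), FArr = (\<lambda>g\<in>Arr E. L (S (Dom E g)) (S (Cod E g)) g)\<rparr>"
  have G_obj: "FObj G Y = S Y" if "Y \<in> Obj E" for Y
    using that by (simp add: G_def)
  have G_arr: "FArr G g \<in> Hom D (S Y) (S Z)" "FArr F (FArr G g) = g" if "g \<in> Hom E Y Z" for g Y Z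
  proof -
    have "Y \<in> Obj E" "Z \<in> Obj E" using F.E.HomD[OF that] by auto
    moreover have "FArr G g = L (S Y) (S Z) g" using that by (simp add: G_def Hom_def)
    ultimately show "FArr G g \<in> Hom D (S Y) (S Z)" "FArr F (FArr G g) = g"
      using L[of "S Y" "S Z" g] that by (simp_all add: S)
  qed
  have "cat_functor E D G"
  proof
    fix f g Y Z W
    show "FObj G \<in> extensional (Obj E)" "FArr G \<in> extensional (Arr E)" by (simp_all add: G_def)
    show "Y \<in> Obj E \<Longrightarrow> FObj G Y \<in> Obj D" by (simp add: G_obj S)
    show "f \<in> Hom E Y Z \<Longrightarrow> FArr G f \<in> Hom D (FObj G Y) (FObj G Z)"
      using G_arr(1)[of f Y Z] F.E.HomD[of f Y Z] by (auto simp: G_obj)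
    show "FArr G (Ident E Y) = Ident D (FObj G Y)" if Y: "Y \<in> Obj E"
      by (rule eqI[of _ _ "S Y" "S Y"])
        (use Y G_arr[OF F.E.ident_hom[OF Y]] F.D.ident_hom[of "S Y"] in \<open>simp_all add: G_obj S F.pres_ident\<close>)
    show "FArr G (g \<cdot>\<^bsub>E\<^esub> f) = FArr G g \<cdot>\<^bsub>D\<^esub> FArr G f" if fg: "f \<in> Hom E Y Z" "g \<in> Hom E Z W"
      by (rule eqI[of _ _ "S Y" "S W"])
        (use G_arr[OF fg(1)] G_arr[OF fg(2)] G_arr[OF F.E.comp_hom[OF fg]] in
          \<open>auto simp: F.pres_comp intro: F.D.comp_hom\<close>)
  qed
  moreover have "naturally_isomorphic D D (id_functor D) (comp_functor D G F)"
  proof -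
    \<comment> \<open>\<open>A\<close> and \<open>S (FObj F A)\<close> have the same image, so
      identities lift in both directions; by faithfulness the lifts are mutually inverse.\<close>
    define \<eta> where "\<eta> = (\<lambda>A\<in>Obj D. L A (S (FObj F A)) (Ident E (FObj F A)))"
    define \<theta> where "\<theta> A = L (S (FObj F A)) A (Ident E (FObj F A))" for A
    have \<eta>: "\<eta> A \<in> Hom D A (S (FObj F A))" "FArr F (\<eta> A) = Ident E (FObj F A)"
      and \<theta>: "\<theta> A \<in> Hom D (S (FObj F A)) A" "FArr F (\<theta> A) = Ident E (FObj F A)" if "A \<in> Obj D" for A
      using that L[of A "S (FObj F A)"] L[of "S (FObj F A)" A] F.E.ident_hom[of "FObj F A"] F.obj[OF that]
      by (simp_all add: \<eta>_def \<theta>_def S)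
    have "nat_trans D D (id_functor D) (comp_functor D G F) \<eta>"
      unfolding nat_trans_def
    proof (intro conjI ballI)
      show "\<eta> \<in> extensional (Obj D)" by (simp add: \<eta>_def)
      show "\<eta> A \<in> Hom D (FObj (id_functor D) A) (FObj (comp_functor D G F) A)" if "A \<in> Obj D" for A
        using \<eta>(1)[OF that] that by (simp add: id_functor_def comp_functor_def G_obj F.obj)
      show "\<eta> (Cod D f) \<cdot>\<^bsub>D\<^esub> FArr (id_functor D) f = FArr (comp_functor D G F) f \<cdot>\<^bsub>D\<^esub> \<eta> (Dom D f)"
        if f: "f \<in> Arr D" for f
      proof -
        let ?A = "Dom D f" and ?B = "Cod D f"
        have hom: "f \<in> Hom D ?A ?B" and AB: "?A \<in> Obj D" "?B \<in> Obj D" using f by (auto simp: Hom_def)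
        note Ff = F.arr[OF hom]
        have "\<eta> ?B \<cdot>\<^bsub>D\<^esub> f = FArr G (FArr F f) \<cdot>\<^bsub>D\<^esub> \<eta> ?A"
        proof (rule eqI)
          show "\<eta> ?B \<cdot>\<^bsub>D\<^esub> f \<in> Hom D ?A (S (FObj F ?B))"
            by (rule F.D.comp_hom[OF hom \<eta>(1)[OF AB(2)]])
          show "FArr G (FArr F f) \<cdot>\<^bsub>D\<^esub> \<eta> ?A \<in> Hom D ?A (S (FObj F ?B))"
            by (rule F.D.comp_hom[OF \<eta>(1)[OF AB(1)] G_arr(1)[OF Ff]])
          show "FArr F (\<eta> ?B \<cdot>\<^bsub>D\<^esub> f) = FArr F (FArr G (FArr F f) \<cdot>\<^bsub>D\<^esub> \<eta> ?A)"
            using F.pres_comp[OF hom \<eta>(1)[OF AB(2)]] F.pres_comp[OF \<eta>(1)[OF AB(1)] G_arr(1)[OF Ff]]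
              G_arr(2)[OF Ff] \<eta>(2)[OF AB(1)] \<eta>(2)[OF AB(2)] F.E.HomD[OF Ff] by simp
        qed
        with f show ?thesis by (simp add: id_functor_def comp_functor_def)
      qed
    qed
    moreover have "iso_arrow D (\<eta> A)" if A: "A \<in> Obj D" for A
    proof (rule F.D.iso_arrowI[where g = "\<theta> A"])
      note e = F.D.HomD[OF \<eta>(1)[OF A]] F.D.HomD[OF \<theta>(1)[OF A]]
      have SA: "S (FObj F A) \<in> Obj D" "FObj F (S (FObj F A)) = FObj F A" "FObj F A \<in> Obj E"
        using S F.obj[OF A] by auto
      have "\<theta> A \<cdot>\<^bsub>D\<^esub> \<eta> A = Ident D A"
        by (rule eqI[OF _ F.D.comp_hom[OF \<eta>(1)[OF A] \<theta>(1)[OF A]] F.D.ident_hom[OF A]])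
          (use \<eta>(2)[OF A] \<theta>(2)[OF A] SA F.pres_comp[OF \<eta>(1)[OF A] \<theta>(1)[OF A]] F.pres_ident[OF A] in simp)
      then show "\<theta> A \<cdot>\<^bsub>D\<^esub> \<eta> A = Ident D (Dom D (\<eta> A))" using e by simp
      have "\<eta> A \<cdot>\<^bsub>D\<^esub> \<theta> A = Ident D (S (FObj F A))"
        by (rule eqI[OF _ F.D.comp_hom[OF \<theta>(1)[OF A] \<eta>(1)[OF A]] F.D.ident_hom[OF SA(1)]])
          (use \<eta>(2)[OF A] \<theta>(2)[OF A] SA F.pres_comp[OF \<theta>(1)[OF A] \<eta>(1)[OF A]] F.pres_ident[OF SA(1)] in simp)
      then show "\<eta> A \<cdot>\<^bsub>D\<^esub> \<theta> A = Ident D (Cod D (\<eta> A))" using e by simp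
    qed (use F.D.HomD[OF \<eta>(1)[OF A]] F.D.HomD[OF \<theta>(1)[OF A]] in simp_all)
    ultimately show ?thesis unfolding naturally_isomorphic_def by blast
  qed
  moreover have "naturally_isomorphic E E (comp_functor E F G) (id_functor E)"
  proof -
    have "nat_trans E E (comp_functor E F G) (id_functor E) (\<lambda>Y\<in>Obj E. Ident E Y)"
      unfolding nat_trans_def
    proof (intro conjI ballI)
      show "(\<lambda>Y\<in>Obj E. Ident E Y) (Cod E g) \<cdot>\<^bsub>E\<^esub> FArr (comp_functor E F G) g =
          FArr (id_functor E) g \<cdot>\<^bsub>E\<^esub> (\<lambda>Y\<in>Obj E. Ident E Y) (Dom E g)" if "g \<in> Arr E" for g
        using that G_arr(2)[of g "Dom E g" "Cod E g"] by (simp add: comp_functor_def id_functor_def Hom_def)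
    qed (simp_all add: comp_functor_def id_functor_def G_obj S F.E.ident_hom)
    then show ?thesis
      unfolding naturally_isomorphic_def by (intro exI[of _ "\<lambda>Y\<in>Obj E. Ident E Y"]) simp
  qed
  ultimately show ?thesis using assms(1) unfolding equivalent_categories_def by blast
qed

lemma monoidal_nat_trans_ident:
  assumes "prop_algebra T C F"
  shows "monoidal_nat_trans T C F F (\<lambda>n. Ident C (FObj F n))"
proof -
  interpret F: prop_algebra T C F by fact
  show ?thesis
    by (auto simp: monoidal_nat_trans_def nat_trans_def Hom_def)
qed

lemma monoidal_nat_trans_comp:
  assumes "prop_algebra T C F" "prop_algebra T C G" "prop_algebra T C H"
    and \<eta>: "monoidal_nat_trans T C F G \<eta>" and \<theta>: "monoidal_nat_trans T C G H \<theta>"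
  shows "monoidal_nat_trans T C F H (\<lambda>n. \<theta> n \<cdot>\<^bsub>C\<^esub> \<eta> n)"
proof -
  interpret F: prop_algebra T C F by fact
  interpret G: prop_algebra T C G by fact
  interpret H: prop_algebra T C H by fact
  have [simp]: "\<eta> n \<in> Arr C" "Dom C (\<eta> n) = FObj F n" "Cod C (\<eta> n) = FObj G n"
    "\<theta> n \<in> Arr C" "Dom C (\<theta> n) = FObj G n" "Cod C (\<theta> n) = FObj H n" for n
    using \<eta> \<theta> by (auto simp: monoidal_nat_trans_def nat_trans_def Hom_def)
  have nat: "\<eta> (Cod T f) \<cdot>\<^bsub>C\<^esub> FArr F f = FArr G f \<cdot>\<^bsub>C\<^esub> \<eta> (Dom T f)"
    "\<theta> (Cod T f) \<cdot>\<^bsub>C\<^esub> FArr G f = FArr H f \<cdot>\<^bsub>C\<^esub> \<theta> (Dom T f)" if "f \<in> Arr T" for f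
    using \<eta> \<theta> that by (auto simp: monoidal_nat_trans_def nat_trans_def)
  have tens: "\<eta> (m + n) \<cdot>\<^bsub>C\<^esub> FTens F m n = FTens G m n \<cdot>\<^bsub>C\<^esub> (\<eta> m \<otimes>\<^bsub>C\<^esub> \<eta> n)"
    "\<theta> (m + n) \<cdot>\<^bsub>C\<^esub> FTens G m n = FTens H m n \<cdot>\<^bsub>C\<^esub> (\<theta> m \<otimes>\<^bsub>C\<^esub> \<theta> n)" for m n
    using \<eta> \<theta> by (auto simp: monoidal_nat_trans_def)
  have unit: "\<eta> 0 \<cdot>\<^bsub>C\<^esub> FUnit F = FUnit G" "\<theta> 0 \<cdot>\<^bsub>C\<^esub> FUnit G = FUnit H"
    using \<eta> \<theta> by (auto simp: monoidal_nat_trans_def)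
  show ?thesis
    unfolding monoidal_nat_trans_def nat_trans_def
    by (auto simp: Hom_def nat tens unit F.C.comp_reduce[OF nat(2)] F.C.comp_reduce[OF tens(2)])
qed

lemma category_algebra:
  fixes C :: "('o, 'b, 'y) smc_data_scheme"
  assumes "symmetric_monoidal_category C"
  shows "category (algebra_category FinSpan C)"
proof -
  interpret C: symmetric_monoidal_category C by fact
  have alg: "symmetric_monoidal_functor FinSpan C F \<longleftrightarrow> prop_algebra FinSpan C F" for F
    using FinSpan.prop_category_axioms by (simp add: prop_algebra_def)
  have hom: "\<eta> n \<in> Arr C" "Dom C (\<eta> n) = FObj F n" "Cod C (\<eta> n) = FObj G n"
    if "monoidal_nat_trans FinSpan C F G \<eta>" for F G \<eta> n
    using that by (auto simp: monoidal_nat_trans_def nat_trans_def Hom_def)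
  \<comment> \<open>Every natural number is an object of a PROP, so extensionality of
    transformations is vacuous.\<close>
  have [simp]: "restrict f UNIV = f" for f :: "nat \<Rightarrow> 'b"
    by (simp add: restrict_def)
  show ?thesis
    by unfold_locales
      (auto simp: algebra_category_def Hom_def alg fun_eq_iff hom
        intro: monoidal_nat_trans_ident monoidal_nat_trans_comp)
qed

lemma bimonoid_hom_comp:
  assumes "symmetric_monoidal_category C" "bicommutative_bimonoid C X" "bicommutative_bimonoid C Y"
    "bicommutative_bimonoid C Z" "bimonoid_hom C X Y f" "bimonoid_hom C Y Z g"
  shows "bimonoid_hom C X Z (g \<cdot>\<^bsub>C\<^esub> f)"
proof -
  interpret C: symmetric_monoidal_category C by fact
  interpret X: bicommutative_bimonoid C X by fact
  interpret Y: bicommutative_bimonoid C Y by fact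
  interpret Z: bicommutative_bimonoid C Z by fact
  note [simp] = X.monoid_obj Y.monoid_obj Z.monoid_obj
    C.HomD[OF X.mul_hom] C.HomD[OF X.one_hom] C.HomD[OF X.comul_hom] C.HomD[OF X.counit_hom]
    C.HomD[OF Y.mul_hom] C.HomD[OF Y.one_hom] C.HomD[OF Y.comul_hom] C.HomD[OF Y.counit_hom]
    C.HomD[OF Z.mul_hom] C.HomD[OF Z.one_hom] C.HomD[OF Z.comul_hom] C.HomD[OF Z.counit_hom]
  have f: "f \<in> Hom C (carr X) (carr Y)"
    "bmul Y \<cdot>\<^bsub>C\<^esub> (f \<otimes>\<^bsub>C\<^esub> f) = f \<cdot>\<^bsub>C\<^esub> bmul X" "f \<cdot>\<^bsub>C\<^esub> bone X = bone Y"
    "bcomul Y \<cdot>\<^bsub>C\<^esub> f = (f \<otimes>\<^bsub>C\<^esub> f) \<cdot>\<^bsub>C\<^esub> bcomul X" "bcounit Y \<cdot>\<^bsub>C\<^esub> f = bcounit X"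
    using assms(5) by (auto simp: bimonoid_hom_def)
  have g: "g \<in> Hom C (carr Y) (carr Z)"
    "bmul Z \<cdot>\<^bsub>C\<^esub> (g \<otimes>\<^bsub>C\<^esub> g) = g \<cdot>\<^bsub>C\<^esub> bmul Y" "g \<cdot>\<^bsub>C\<^esub> bone Y = bone Z"
    "bcomul Z \<cdot>\<^bsub>C\<^esub> g = (g \<otimes>\<^bsub>C\<^esub> g) \<cdot>\<^bsub>C\<^esub> bcomul Y" "bcounit Z \<cdot>\<^bsub>C\<^esub> g = bcounit Y"
    using assms(6) by (auto simp: bimonoid_hom_def)
  note [simp] = C.HomD[OF f(1)] C.HomD[OF g(1)]
  have "bmul Z \<cdot>\<^bsub>C\<^esub> ((g \<cdot>\<^bsub>C\<^esub> f) \<otimes>\<^bsub>C\<^esub> (g \<cdot>\<^bsub>C\<^esub> f)) = (bmul Z \<cdot>\<^bsub>C\<^esub> (g \<otimes>\<^bsub>C\<^esub> g)) \<cdot>\<^bsub>C\<^esub> (f \<otimes>\<^bsub>C\<^esub> f)"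
    by simp
  then have "bmul Z \<cdot>\<^bsub>C\<^esub> ((g \<cdot>\<^bsub>C\<^esub> f) \<otimes>\<^bsub>C\<^esub> (g \<cdot>\<^bsub>C\<^esub> f)) = (g \<cdot>\<^bsub>C\<^esub> f) \<cdot>\<^bsub>C\<^esub> bmul X"
    unfolding g(2) by (simp add: f(2))
  moreover have "bcomul Z \<cdot>\<^bsub>C\<^esub> g \<cdot>\<^bsub>C\<^esub> f = ((g \<cdot>\<^bsub>C\<^esub> f) \<otimes>\<^bsub>C\<^esub> (g \<cdot>\<^bsub>C\<^esub> f)) \<cdot>\<^bsub>C\<^esub> bcomul X"
    by (simp add: C.comp_reduce[OF g(4)] f(4))
  ultimately show ?thesis
    unfolding bimonoid_hom_def by (simp add: Hom_def f(3) g(3) f(5) C.comp_reduce[OF g(5)])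
qed

lemma bimonoid_hom_ident:
  assumes "symmetric_monoidal_category C" "bicommutative_bimonoid C X"
  shows "bimonoid_hom C X X (Ident C (carr X))"
proof -
  interpret C: symmetric_monoidal_category C by fact
  interpret X: bicommutative_bimonoid C X by fact
  note [simp] = X.monoid_obj
    C.HomD[OF X.mul_hom] C.HomD[OF X.one_hom] C.HomD[OF X.comul_hom] C.HomD[OF X.counit_hom]
  show ?thesis unfolding bimonoid_hom_def by (simp add: Hom_def)
qed

lemma category_bimonoid:
  assumes "symmetric_monoidal_category C"
  shows "category (bimonoid_category C)"
proof -
  interpret C: symmetric_monoidal_category C by fact
  have hom: "f \<in> Arr C" "Dom C f = carr X" "Cod C f = carr Y" if "bimonoid_hom C X Y f" for X Y f
    using that by (auto simp: bimonoid_hom_def Hom_def)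
  show ?thesis
    by unfold_locales
      (auto simp: bimonoid_category_def Hom_def hom
        intro: bimonoid_hom_ident[OF assms] bimonoid_hom_comp[OF assms])
qed

definition algebra_bimonoid :: "('o, 'a, 'y) smc_data_scheme \<Rightarrow>
    ((nat, nat \<times> nat \<times> nat span set, 'o, 'a) smf_data,
     (nat, nat \<times> nat \<times> nat span set, 'o, 'a) smf_data \<times>
       (nat, nat \<times> nat \<times> nat span set, 'o, 'a) smf_data \<times> (nat \<Rightarrow> 'a),
     ('o, 'a) bimonoid_data, ('o, 'a) bimonoid_data \<times> ('o, 'a) bimonoid_data \<times> 'a) functor_data" where
  "algebra_bimonoid C =
     (let B = (\<lambda>F. prop_algebra.image_bimonoid C F FinSpan_bimonoid) in
      \<lparr>FObj = (\<lambda>F\<in>Obj (algebra_category FinSpan C). B F),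
       FArr = (\<lambda>(F, G, \<eta>)\<in>Arr (algebra_category FinSpan C). (B F, B G, \<eta> (Suc 0)))\<rparr>)"

theorem corollary8:
  fixes C :: "('o, 'a) smc_data"
  assumes "symmetric_monoidal_category C"
  shows "prop_category FinSpan \<and>
         equivalent_categories (algebra_category FinSpan C) (bimonoid_category C)"
proof
  let ?A = "algebra_category FinSpan C" and ?B = "bimonoid_category C" and ?\<Phi> = "algebra_bimonoid C"
  let ?b = "\<lambda>F. prop_algebra.image_bimonoid C F FinSpan_bimonoid"
  interpret C: symmetric_monoidal_category C by fact
  have alg: "symmetric_monoidal_functor FinSpan C F \<longleftrightarrow> prop_algebra FinSpan C F" for F
    using FinSpan.prop_category_axioms by (simp add: prop_algebra_def)
  \<comment> \<open>\<open>FinSpan_matrix\<close> is what shows that the bimonoid generates all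
    arrows.\<close>
  have pair: "algebra_pair FinSpan C FinSpan_bimonoid F G"
    if "prop_algebra FinSpan C F" "prop_algebra FinSpan C G" for F G
    using that FinSpan.prop_bimonoid_axioms
    by (auto simp: algebra_pair_def algebra_pair_axioms_def FinSpan_matrix elim: FinSpan_HomE)
  have b: "bicommutative_bimonoid C (?b F)" if F: "prop_algebra FinSpan C F" for F
  proof -
    interpret F: prop_algebra FinSpan C F by fact
    interpret F: prop_algebra_bimonoid FinSpan C F FinSpan_bimonoid "Suc 0"
      by unfold_locales simp_all
    show ?thesis
      by (rule F.image_bimonoid_preserved) (rule FinSpan.bicommutative_bimonoid_axioms)
  qed
  have A: "Obj ?A = {F. prop_algebra FinSpan C F}"
    "(x \<in> Hom ?A F G) = (\<exists>\<eta>. x = (F, G, \<eta>) \<and> prop_algebra FinSpan C F \<and> prop_algebra FinSpan C G \<and>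
       monoidal_nat_trans FinSpan C F G \<eta>)" for x F G
    by (auto simp: algebra_category_def Hom_def alg)
  have B: "Obj ?B = {X. bicommutative_bimonoid C X}"
    "(y \<in> Hom ?B X Y) = (\<exists>f. y = (X, Y, f) \<and> bicommutative_bimonoid C X \<and> bicommutative_bimonoid C Y \<and>
       bimonoid_hom C X Y f)" for y X Y
    by (auto simp: bimonoid_category_def Hom_def)
  have \<Phi>_obj: "FObj ?\<Phi> F = ?b F" if "prop_algebra FinSpan C F" for F
    using that by (simp add: algebra_bimonoid_def A Let_def)
  have \<Phi>_arr: "FArr ?\<Phi> (F, G, \<eta>) = (?b F, ?b G, \<eta> (Suc 0))" if "(F, G, \<eta>) \<in> Hom ?A F G" for F G \<eta>
    using that by (simp add: algebra_bimonoid_def Hom_def Let_def)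
  have \<Phi>_functor: "cat_functor ?A ?B ?\<Phi>"
  proof (intro cat_functor.intro cat_functor_axioms.intro category_algebra category_bimonoid assms)
    fix F G H x y
    show "FObj ?\<Phi> \<in> extensional (Obj ?A)" "FArr ?\<Phi> \<in> extensional (Arr ?A)"
      by (simp_all add: algebra_bimonoid_def Let_def)
    show "F \<in> Obj ?A \<Longrightarrow> FObj ?\<Phi> F \<in> Obj ?B"
      by (simp add: \<Phi>_obj A B b)
    show "x \<in> Hom ?A F G \<Longrightarrow> FArr ?\<Phi> x \<in> Hom ?B (FObj ?\<Phi> F) (FObj ?\<Phi> G)"
      using algebra_pair.monoidal_nat_trans_hom(1)[OF pair] by (auto simp: \<Phi>_arr \<Phi>_obj A B b)
    show "FArr ?\<Phi> (Ident ?A F) = Ident ?B (FObj ?\<Phi> F)" if "F \<in> Obj ?A"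
    proof -
      interpret F: prop_algebra FinSpan C F using that by (simp add: A)
      have "carr (?b F) = FObj F (Suc 0)" by (simp add: F.image_bimonoid_def)
      moreover have "Ident ?A F = (F, F, restrict (\<lambda>n. Ident C (FObj F n)) UNIV)"
        and "Ident ?B (?b F) = (?b F, ?b F, Ident C (carr (?b F)))"
        by (simp_all add: algebra_category_def bimonoid_category_def)
      ultimately show ?thesis
        using category.ident_hom[OF category_algebra[OF assms] that]
        by (simp add: \<Phi>_obj[OF F.prop_algebra_axioms] \<Phi>_arr)
    qed
    show "FArr ?\<Phi> (y \<cdot>\<^bsub>?A\<^esub> x) = FArr ?\<Phi> y \<cdot>\<^bsub>?B\<^esub> FArr ?\<Phi> x" if xy: "x \<in> Hom ?A F G" "y \<in> Hom ?A G H"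
    proof -
      obtain \<eta> \<theta> where [simp]: "x = (F, G, \<eta>)" "y = (G, H, \<theta>)"
        using xy by (auto simp: A)
      have comp: "y \<cdot>\<^bsub>?A\<^esub> x = (F, H, restrict (\<lambda>n. \<theta> n \<cdot>\<^bsub>C\<^esub> \<eta> n) UNIV)"
        by (simp add: algebra_category_def)
      have "(F, H, restrict (\<lambda>n. \<theta> n \<cdot>\<^bsub>C\<^esub> \<eta> n) UNIV) \<in> Hom ?A F H"
        using category.comp_hom[OF category_algebra[OF assms] xy] unfolding comp .
      then show ?thesis
        using xy unfolding comp by (simp add: \<Phi>_arr) (simp add: bimonoid_category_def)
    qed
  qed
  show "equivalent_categories ?A ?B"
  proof (rule equivalent_categoriesI[OF \<Phi>_functor])
    fix X assume "X \<in> Obj ?B"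
    then have X: "bicommutative_bimonoid C X" by (simp add: B)
    then interpret X: bicommutative_bimonoid C X .
    interpret tensor_powers C "carr X" by unfold_locales (rule X.monoid_obj)
    interpret E: prop_bimonoid endo_prop "endo_bimonoid X" by (rule endo_bimonoid(1)[OF X refl])
    note K = E.prop_algebra_span_functor[OF prop_algebra_endo]
    \<comment> \<open>The witness lets matrices act in the PROP of tensor powers of
      \<open>carr X\<close> and then includes that PROP into \<open>C\<close>.\<close>
    show "\<exists>F\<in>Obj ?A. FObj ?\<Phi> F = X"
      using K endo_bimonoid(2)[OF X refl] by (intro bexI[of _ "E.span_functor endo_functor"]) (simp_all add: \<Phi>_obj A(1))
  next
    fix F G g assume "F \<in> Obj ?A" "G \<in> Obj ?A" and g: "g \<in> Hom ?B (FObj ?\<Phi> F) (FObj ?\<Phi> G)"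
    then have FG: "prop_algebra FinSpan C F" "prop_algebra FinSpan C G" by (simp_all add: A)
    interpret P: algebra_pair FinSpan C FinSpan_bimonoid F G by (rule pair[OF FG])
    from g obtain h where h: "g = (?b F, ?b G, h)" "P.hom h" by (auto simp: B \<Phi>_obj FG)
    have "(F, G, P.extend h) \<in> Hom ?A F G"
      using P.extend_monoidal_nat_trans[OF h(2)] FG by (simp add: A)
    moreover have "FArr ?\<Phi> (F, G, P.extend h) = g"
      using \<Phi>_arr[OF calculation] P.extend_one[OF h(2)] h(1) by simp
    ultimately show "\<exists>x\<in>Hom ?A F G. FArr ?\<Phi> x = g" by blast
  next
    fix F G assume "F \<in> Obj ?A" "G \<in> Obj ?A"
    then have FG: "prop_algebra FinSpan C F" "prop_algebra FinSpan C G" by (simp_all add: A)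
    interpret P: algebra_pair FinSpan C FinSpan_bimonoid F G by (rule pair[OF FG])
    show "inj_on (FArr ?\<Phi>) (Hom ?A F G)"
    proof (rule inj_onI)
      fix x y assume xy: "x \<in> Hom ?A F G" "y \<in> Hom ?A F G" and eq: "FArr ?\<Phi> x = FArr ?\<Phi> y"
      obtain \<eta> \<theta> where x: "x = (F, G, \<eta>)" "monoidal_nat_trans FinSpan C F G \<eta>"
        and y: "y = (F, G, \<theta>)" "monoidal_nat_trans FinSpan C F G \<theta>"
        using xy by (auto simp: A)
      have "\<eta> (Suc 0) = \<theta> (Suc 0)" using eq xy x y by (simp add: \<Phi>_arr)
      then show "x = y"
        using P.monoidal_nat_trans_hom(2)[OF x(2)] P.monoidal_nat_trans_hom(2)[OF y(2)] x(1) y(1) by simp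
    qed
  qed
qed (rule FinSpan.prop_category_axioms)

end
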